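(* Consider the nearest-neighbour random walk $X(t)=X(t;\omega,0)$ on $\mathbb{Z}$ in random environment described in the context, and suppose that Condition $\mathbf{C}'$ (see context) is satisfied, that $\lambda<0$ and that $r(2)<1$. Suppose that the environment is i.i.d., that is, $(p_n)_{n\in\mathbb{Z}}$ is a sequence of independent identically distributed random variables. Let $\sigma^*=\sqrt{\mu^{-3}\sigma^2}$ and let $b(t)=b(t;\omega)$ be the explicit centering defined in the context. Then $$\lim_{t\to\infty}t^{-\frac12}\sum_{k=\mu^{-1}t}^{b(t)+\sqrt{t}\,\sigma^*x}(\mu_k-\mu)=0\quad\text{with $\mathbb{P}$-probability 1 for any real $x$,}$$ and thus for $\mathbb{P}$-almost every environment $\omega$ $$\lim_{t\to\infty}Pr_\omega\left\{\frac{X(t)-b(t)}{\sqrt{t}\,\sigma^*}\le x\right\}=\Phi(x)$$ with the convergence being uniform in $x\in\mathbb{R}$.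
   Context: Environment and walk. $(\Omega,\mathcal{F},\mathbb{P})$ is a probability space, $\mathcal{T}:\Omega\to\Omega$ is an invertible transformation preserving $\mathbb{P}$, and $p:\Omega\to(0,1)$ is measurable. Put $p_n=p_n(\omega)=p(\mathcal{T}^n\omega)$, $q_n=1-p_n$, $A_n=q_n/p_n$, $n\in\mathbb{Z}$. For fixed $\omega$, $X(t;\omega,z)$, $t=0,1,2,\dots$, is the Markov chain on $\mathbb{Z}$ started at $z$ which jumps from $n$ to $n+1$ with probability $p_n$ and from $n$ to $n-1$ with probability $q_n$. $Pr_\omega$ is the law of the walk for the fixed (quenched) environment $\omega$ (started at $0$ unless said otherwise), $\mathrm{Var}_\omega$ is the variance with respect to it, and $\mathbb{E}$ is the expectation with respect to $\mathbb{P}$. $\tau_k$ denotes the hitting time of $k+1$ by the walk started at $k$. Condition $\mathbf{C}'$: (C1) the dynamical system $(\Omega,\mathcal{F},\mathbb{P},\mathcal{T})$ is ergodic; (C3) there is $\gamma>2$ such that $\mathbb{E}p_k^{-\gamma}<\infty$ and $\mathbb{E}(1-p_k)^{-\gamma}<\infty$; (C4) $\limsup_{n\to\infty}\big(\mathbb{E}\prod_{j=1}^n (q_j/p_j)^\gamma\big)^{1/n}<\infty$. Notation. $\lambda=\mathbb{E}\ln A_j$ (independent of $j$). For $\kappa\in[0,\gamma]$, $r(\kappa)=\limsup_{n\to\infty}\big(\mathbb{E}\prod_{j=1}^nA_j^\kappa\big)^{1/n}$ (in the i.i.d. case $r(\kappa)=\mathbb{E}A_0^\kappa$). $\mu_k=\mu_k(\omega)=1+2\sum_{j=0}^\infty\prod_{i=k-j}^kA_i$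 and $\mu=\mathbb{E}\mu_k$ (finite under the assumptions). $\sigma^2=\mathbb{E}\,\mathrm{Var}_\omega(\tau_k)$ (independent of $k$). $\lfloor y\rfloor$ is the integer part of $y$; $H(n,\omega)=\sum_{k=0}^{n-1}\mu_k$ for integers $n\ge0$ and $H(y,\omega)=H(\lfloor y\rfloor,\omega)$ for real $y\ge0$. Explicit centering: $b(t;\omega)=2\mu^{-1}t-\mu^{-1}H(\mu^{-1}t,\omega)$. Summation convention: for real $b_1,b_2$, $\sum_{k=b_1}^{b_2}d_k$ means $\sum_{k=\lfloor b_1\rfloor}^{\lfloor b_2\rfloor}d_k$ if $\lfloor b_1\rfloor\le\lfloor b_2\rfloor$, and $-\sum_{k=\lfloor b_2\rfloor}^{\lfloor b_1\rfloor}d_k$ if $\lfloor b_2\rfloor<\lfloor b_1\rfloor$. $\Phi(x)=\frac1{\sqrt{2\pi}}\int_{-\infty}^xe^{-u^2/2}du$. *)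

theory Defs
  imports "HOL-Probability.Probability"
begin

definition invertible_mpt :: "'a measure \<Rightarrow> ('a \<Rightarrow> 'a) \<Rightarrow> bool" where
  "invertible_mpt M T \<longleftrightarrow>
     bij_betw T (space M) (space M) \<and>
     T \<in> measurable M M \<and>
     the_inv_into (space M) T \<in> measurable M M \<and>
     distr M M T = M"

definition ergodic_mpt :: "'a measure \<Rightarrow> ('a \<Rightarrow> 'a) \<Rightarrow> bool" where
  "ergodic_mpt M T \<longleftrightarrow>
     (\<forall>A\<in>sets M. T -` A \<inter> space M = A \<longrightarrow> measure M A = 0 \<or> measure M A = 1)"

definition random_environment :: "'a measure \<Rightarrow> ('a \<Rightarrow> 'a) \<Rightarrow> ('a \<Rightarrow> real) \<Rightarrow> bool" where
  "random_environment M T p \<longleftrightarrow>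
     prob_space M \<and> invertible_mpt M T \<and>
     p \<in> borel_measurable M \<and> (\<forall>\<omega>\<in>space M. 0 < p \<omega> \<and> p \<omega> < 1)"

definition int_iterate :: "'a measure \<Rightarrow> ('a \<Rightarrow> 'a) \<Rightarrow> int \<Rightarrow> 'a \<Rightarrow> 'a" where
  "int_iterate M T n =
     (if 0 \<le> n then T ^^ nat n else the_inv_into (space M) T ^^ nat (- n))"

text \<open>\<open>env M T p \<omega> n\<close> is $p_n(\omega)$, so \<open>env M T p \<omega>\<close> is the whole environment
  sampled at \<open>\<omega>\<close>.  Quenched quantities below are functions of such a sequence
  \<open>a :: int \<Rightarrow> real\<close>.\<close>

definition env :: "'a measure \<Rightarrow> ('a \<Rightarrow> 'a) \<Rightarrow> ('a \<Rightarrow> real) \<Rightarrow> 'a \<Rightarrow> int \<Rightarrow> real" where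
  "env M T p \<omega> n = p (int_iterate M T n \<omega>)"

definition odds :: "(int \<Rightarrow> real) \<Rightarrow> int \<Rightarrow> real" where
  "odds a n = (1 - a n) / a n"

definition iid_environment :: "'a measure \<Rightarrow> ('a \<Rightarrow> 'a) \<Rightarrow> ('a \<Rightarrow> real) \<Rightarrow> bool" where
  "iid_environment M T p \<longleftrightarrow>
     prob_space.indep_vars M (\<lambda>_. borel) (\<lambda>n \<omega>. env M T p \<omega> n) (UNIV :: int set) \<and>
     (\<forall>m n. distr M borel (\<lambda>\<omega>. env M T p \<omega> m) = distr M borel (\<lambda>\<omega>. env M T p \<omega> n))"

text \<open>The expectations in \<open>growth_rate\<close> may be infinite, hence the extended values.\<close>

definition ennreal_root :: "nat \<Rightarrow> ennreal \<Rightarrow> ennreal" where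
  "ennreal_root n x = (if x = \<infinity> then \<infinity> else ennreal (root n (enn2real x)))"

definition growth_rate :: "'a measure \<Rightarrow> ('a \<Rightarrow> 'a) \<Rightarrow> ('a \<Rightarrow> real) \<Rightarrow> real \<Rightarrow> ennreal" where
  "growth_rate M T p \<kappa> =
     limsup (\<lambda>n::nat. ennreal_root n
       (\<integral>\<^sup>+ \<omega>. ennreal (\<Prod>j\<in>{1..int n}. odds (env M T p \<omega>) j powr \<kappa>) \<partial>M))"

definition condition_C' :: "'a measure \<Rightarrow> ('a \<Rightarrow> 'a) \<Rightarrow> ('a \<Rightarrow> real) \<Rightarrow> bool" where
  "condition_C' M T p \<longleftrightarrow>
     ergodic_mpt M T \<and>
     (\<exists>\<gamma>>2.
        (\<forall>k::int. (\<integral>\<^sup>+ \<omega>. ennreal (env M T p \<omega> k powr (- \<gamma>)) \<partial>M) < \<infinity> \<and>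
                  (\<integral>\<^sup>+ \<omega>. ennreal ((1 - env M T p \<omega> k) powr (- \<gamma>)) \<partial>M) < \<infinity>) \<and>
        growth_rate M T p \<gamma> < \<infinity>)"

text \<open>The quenched law is the measure on paths \<open>nat \<Rightarrow> int\<close> obtained from the transition
  probabilities by the Ionescu-Tulcea theorem; \<open>walk_kernel a z i x\<close> is the conditional law
  of the position at time \<open>i\<close> given the path \<open>x\<close> up to time \<open>i - 1\<close>.\<close>

definition walk_kernel :: "(int \<Rightarrow> real) \<Rightarrow> int \<Rightarrow> nat \<Rightarrow> (nat \<Rightarrow> int) \<Rightarrow> int pmf" where
  "walk_kernel a z i x =
     (if i = 0 then return_pmf z
      else map_pmf (\<lambda>right. if right then x (i - 1) + 1 else x (i - 1) - 1)
             (bernoulli_pmf (a (x (i - 1)))))"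

definition quenched_law :: "(int \<Rightarrow> real) \<Rightarrow> int \<Rightarrow> (nat \<Rightarrow> int) measure" where
  "quenched_law a z =
     projective_family.lim UNIV
       (Ionescu_Tulcea.CI (\<lambda>i x. measure_pmf (walk_kernel a z i x)) (\<lambda>_. count_space UNIV))
       (\<lambda>_. count_space UNIV)"

lemma Ionescu_Tulcea_walk:
  "Ionescu_Tulcea (\<lambda>i x. measure_pmf (walk_kernel a z i x)) (\<lambda>_. count_space UNIV)"
proof
  fix i
  show "(\<lambda>x. measure_pmf (walk_kernel a z i x))
      \<in> PiM {0..<i} (\<lambda>_. count_space UNIV) \<rightarrow>\<^sub>M subprob_algebra (count_space UNIV)"
  proof (cases "i = 0")
    case True
    then show ?thesis
      by (simp add: walk_kernel_def measure_pmf_in_subprob_algebra)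
  next
    case False
    have "(\<lambda>x. x (i - 1)) \<in> PiM {0..<i} (\<lambda>_. count_space (UNIV :: int set)) \<rightarrow>\<^sub>M count_space UNIV"
      using False by (intro measurable_component_singleton) auto
    moreover have "(\<lambda>y. measure_pmf (map_pmf (\<lambda>right. if right then y + 1 else y - 1)
        (bernoulli_pmf (a y)))) \<in> count_space UNIV \<rightarrow>\<^sub>M subprob_algebra (count_space (UNIV :: int set))"
      by (auto simp: measure_pmf_in_subprob_algebra)
    ultimately show ?thesis
      using False by (simp add: walk_kernel_def)
  qed
qed

lemma space_quenched_law: "space (quenched_law a z) = UNIV"
  and sets_quenched_law: "sets (quenched_law a z) = sets (PiM UNIV (\<lambda>_. count_space UNIV))"
proof -
  interpret IT: Ionescu_Tulcea "\<lambda>i x. measure_pmf (walk_kernel a z i x)" "\<lambda>_. count_space UNIV"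
    by (rule Ionescu_Tulcea_walk)
  show "space (quenched_law a z) = UNIV"
    by (simp add: quenched_law_def IT.PF.space_lim space_PiM)
  show "sets (quenched_law a z) = sets (PiM UNIV (\<lambda>_. count_space UNIV))"
    by (simp add: quenched_law_def IT.PF.sets_lim)
qed

lemma emeasure_quenched_law_cylinder:
  "emeasure (quenched_law a z) {x. \<forall>i\<in>{0..<n}. x i = y i} =
     ennreal (\<Prod>i<n. pmf (walk_kernel a z i y) (y i))"
proof -
  interpret IT: Ionescu_Tulcea "\<lambda>i x. measure_pmf (walk_kernel a z i x)" "\<lambda>_. count_space UNIV"
    by (rule Ionescu_Tulcea_walk)
  let ?N = "\<lambda>n::nat. PiM {0..<n} (\<lambda>_. count_space (UNIV :: int set))"
  have sing: "{restrict y {0..<n}} \<in> sets (?N n)" for n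
  proof -
    have "{restrict y {0..<n}} = PiE {0..<n} (\<lambda>i. {y i})"
      by (auto simp: PiE_iff extensional_def restrict_def fun_eq_iff)
    also have "\<dots> \<in> sets (?N n)"
      by (intro sets_PiM_I_finite) auto
    finally show ?thesis .
  qed
  have C: "emeasure (IT.C 0 n (\<lambda>_. undefined)) {restrict y {0..<n}} =
      ennreal (\<Prod>i<n. pmf (walk_kernel a z i y) (y i))" for n
  proof (induction n)
    case 0
    have "{\<lambda>_::nat. undefined} \<in> sets (PiM {} (\<lambda>_. count_space (UNIV :: int set)))"
      using sing[of 0] by (simp add: restrict_def)
    then show ?case
      by (simp add: restrict_def emeasure_return)
  next
    case (Suc n)
    have u: "(\<lambda>_. undefined) \<in> space (?N 0)" by (simp add: space_PiM)
    have eP: "emeasure (IT.eP n x) {restrict y {0..<Suc n}} =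
        ennreal (pmf (walk_kernel a z n y) (y n)) * indicator {restrict y {0..<n}} x"
      if x: "x \<in> space (?N n)" for x
    proof -
      have ext: "x i = undefined" if "i \<ge> n" for i
        using x that by (auto simp: space_PiM PiE_iff extensional_def)
      have vimage: "(\<lambda>v. x(n := v)) -` {restrict y {0..<Suc n}} =
          (if x = restrict y {0..<n} then {y n} else {})"
      proof (cases "x = restrict y {0..<n}")
        case True
        have "x(n := v) = restrict y {0..<Suc n} \<longleftrightarrow> v = y n" for v
        proof
          assume "x(n := v) = restrict y {0..<Suc n}"
          from fun_cong[OF this, of n] show "v = y n" by simp
        next
          assume "v = y n"
          with True ext show "x(n := v) = restrict y {0..<Suc n}"
            by (simp add: fun_eq_iff restrict_def less_Suc_eq)
        qed
        with True show ?thesis by auto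
      next
        case False
        then obtain i where "x i \<noteq> restrict y {0..<n} i" by (auto simp: fun_eq_iff)
        with ext have i: "i < n" "x i \<noteq> y i" by (auto simp: restrict_def not_less split: if_splits)
        have "x(n := v) \<noteq> restrict y {0..<Suc n}" for v
        proof
          assume "x(n := v) = restrict y {0..<Suc n}"
          from fun_cong[OF this, of i] i show False by simp
        qed
        with False show ?thesis by auto
      qed
      have k: "walk_kernel a z n (restrict y {0..<n}) = walk_kernel a z n y"
        by (simp add: walk_kernel_def cong: if_cong)
      show ?thesis
        using vimage k
        by (simp add: IT.emeasure_eP[OF x sing] emeasure_pmf_single)
    qed
    have "emeasure (IT.C 0 (Suc n) (\<lambda>_. undefined)) {restrict y {0..<Suc n}} =
        (\<integral>\<^sup>+ x. emeasure (IT.eP n x) {restrict y {0..<Suc n}} \<partial>IT.C 0 n (\<lambda>_. undefined))"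
      using u IT.prob_space_C[OF u, THEN prob_space.not_empty, of n] sing
      by (simp add: emeasure_bind[where N = "?N (Suc n)"] measurable_cong_sets[OF IT.sets_C[OF u] refl])
    also have "\<dots> = (\<integral>\<^sup>+ x. ennreal (pmf (walk_kernel a z n y) (y n)) *
        indicator {restrict y {0..<n}} x \<partial>IT.C 0 n (\<lambda>_. undefined))"
      by (intro nn_integral_cong eP) (simp add: IT.space_C[OF u])
    also have "\<dots> = ennreal (pmf (walk_kernel a z n y) (y n)) *
        ennreal (\<Prod>i<n. pmf (walk_kernel a z i y) (y i))"
      using sing by (subst nn_integral_cmult_indicator) (auto simp: IT.sets_C[OF u] Suc.IH)
    finally show ?case
      by (simp only: prod.lessThan_Suc) (simp only: ennreal_mult' pmf_nonneg mult.commute)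
  qed
  have "{x. \<forall>i\<in>{0..<n}. x i = y i} =
      prod_emb UNIV (\<lambda>_. count_space UNIV) {0..<n} {restrict y {0..<n}}"
    by (auto simp: prod_emb_def space_PiM restrict_def fun_eq_iff; metis)
  moreover have "emeasure (IT.CI {0..<n}) {restrict y {0..<n}} =
      emeasure (IT.C 0 n (\<lambda>_. undefined)) {restrict y {0..<n}}"
    using sets.sets_into_space[OF sing[of n]]
    by (subst IT.emeasure_CI[OF order_refl sing]) (simp add: prod_emb_id space_PiM)
  ultimately show ?thesis
    unfolding quenched_law_def by (simp add: IT.lim[OF _ sing] C)
qed

lemma prob_space_quenched_law: "prob_space (quenched_law a z)"
  using emeasure_quenched_law_cylinder[where n = 0]
  by (intro prob_spaceI) (simp add: space_quenched_law)

lemma measure_quenched_law_cylinder: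
  assumes "\<And>k. 0 < a k" "\<And>k. a k < 1"
  shows "measure (quenched_law a z) {x. \<forall>i\<le>n. x i = y i} =
    (if y 0 = z
     then (\<Prod>i<n. if y (Suc i) = y i + 1 then a (y i)
                   else if y (Suc i) = y i - 1 then 1 - a (y i) else 0)
     else 0)"
proof -
  have step: "pmf (walk_kernel a z (Suc i) y) (y (Suc i)) =
      (if y (Suc i) = y i + 1 then a (y i)
       else if y (Suc i) = y i - 1 then 1 - a (y i) else 0)" for i
    using assms[of "y i"]
    by (auto simp: walk_kernel_def map_pmf_def pmf_bind pmf_return indicator_def)
  have "{x. \<forall>i\<le>n. x i = y i} = {x. \<forall>i\<in>{0..<Suc n}. x i = y i}"
    by (auto simp: less_Suc_eq_le)
  then have "measure (quenched_law a z) {x. \<forall>i\<le>n. x i = y i} =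
      (\<Prod>i<Suc n. pmf (walk_kernel a z i y) (y i))"
    using emeasure_quenched_law_cylinder[of a z "Suc n" y]
    by (simp add: measure_def prod_nonneg del: prod.lessThan_Suc)
  also have "\<dots> = pmf (walk_kernel a z 0 y) (y 0) *
      (\<Prod>i<n. pmf (walk_kernel a z (Suc i) y) (y (Suc i)))"
    by (rule prod.lessThan_Suc_shift)
  finally show ?thesis
    by (simp add: step) (simp add: walk_kernel_def pmf_return)
qed

text \<open>The first time the path \<open>x\<close> is at \<open>y\<close>.  The value on paths that never visit \<open>y\<close>
  is immaterial: when $\lambda < 0$ the walk is transient to the right and these paths form a
  null set for the \<open>y\<close> used below.\<close>

definition hitting_time :: "(nat \<Rightarrow> int) \<Rightarrow> int \<Rightarrow> nat" where
  "hitting_time x y = (LEAST t. x t = y)"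

text \<open>This is $\mathrm{Var}_\omega(\tau_k)$; like every Bochner integral it is \<open>0\<close> when the
  second moment is infinite, which happens only on a null set of environments once $r(2) < 1$.\<close>

definition var_tau :: "(int \<Rightarrow> real) \<Rightarrow> int \<Rightarrow> real" where
  "var_tau a k =
     prob_space.variance (quenched_law a k) (\<lambda>x. real (hitting_time x (k + 1)))"

definition mu_env :: "(int \<Rightarrow> real) \<Rightarrow> int \<Rightarrow> real" where
  "mu_env a k = 1 + 2 * (\<Sum>j::nat. \<Prod>i\<in>{k - int j..k}. odds a i)"

definition H_sum :: "(int \<Rightarrow> real) \<Rightarrow> real \<Rightarrow> real" where
  "H_sum a y = (\<Sum>k\<in>{0..<\<lfloor>y\<rfloor>}. mu_env a k)"

text \<open>The next three expectations do not depend on the index of the site, by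
  stationarity; site \<open>0\<close> is used.\<close>

definition log_drift :: "'a measure \<Rightarrow> ('a \<Rightarrow> 'a) \<Rightarrow> ('a \<Rightarrow> real) \<Rightarrow> real" where
  "log_drift M T p = prob_space.expectation M (\<lambda>\<omega>. ln (odds (env M T p \<omega>) 0))"

definition mu_mean :: "'a measure \<Rightarrow> ('a \<Rightarrow> 'a) \<Rightarrow> ('a \<Rightarrow> real) \<Rightarrow> real" where
  "mu_mean M T p = prob_space.expectation M (\<lambda>\<omega>. mu_env (env M T p \<omega>) 0)"

definition sigma2 :: "'a measure \<Rightarrow> ('a \<Rightarrow> 'a) \<Rightarrow> ('a \<Rightarrow> real) \<Rightarrow> real" where
  "sigma2 M T p = prob_space.expectation M (\<lambda>\<omega>. var_tau (env M T p \<omega>) 0)"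

definition sigma_star :: "'a measure \<Rightarrow> ('a \<Rightarrow> 'a) \<Rightarrow> ('a \<Rightarrow> real) \<Rightarrow> real" where
  "sigma_star M T p = sqrt (inverse (mu_mean M T p) ^ 3 * sigma2 M T p)"

definition centering :: "'a measure \<Rightarrow> ('a \<Rightarrow> 'a) \<Rightarrow> ('a \<Rightarrow> real) \<Rightarrow> real \<Rightarrow> 'a \<Rightarrow> real" where
  "centering M T p t \<omega> =
     2 * inverse (mu_mean M T p) * t
     - inverse (mu_mean M T p) * H_sum (env M T p \<omega>) (inverse (mu_mean M T p) * t)"

text \<open>The reversed sum includes both end points too, so it is not the additive convention.\<close>

definition sum_between :: "(int \<Rightarrow> real) \<Rightarrow> real \<Rightarrow> real \<Rightarrow> real" where
  "sum_between d b1 b2 =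
     (if \<lfloor>b1\<rfloor> \<le> \<lfloor>b2\<rfloor> then (\<Sum>k\<in>{\<lfloor>b1\<rfloor>..\<lfloor>b2\<rfloor>}. d k) else - (\<Sum>k\<in>{\<lfloor>b2\<rfloor>..\<lfloor>b1\<rfloor>}. d k))"

end

theory Submission
  imports Defs "HOL-Real_Asymp.Real_Asymp"
begin

text \<open>For a fixed environment the hitting time of \<open>n\<close> is a sum of independent crossing times with
  means \<open>\<mu>\<^sub>k\<close>, and the ergodic theorem supplies the Lindeberg condition, so the hitting times
  satisfy a quenched central limit theorem centred at \<open>H(n)\<close>. It transfers to the position because
  the walk is unlikely to fall back by more than a logarithmic distance, and because centring at
  \<open>H\<close> can be inverted explicitly. The inversion costs the sum of \<open>\<mu>\<^sub>k - \<mu>\<close> over a window of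
  length about \<open>sqrt t\<close> near \<open>t / \<mu>\<close>. Since \<open>\<mu>\<^sub>k = 1 + A\<^sub>k (1 + \<mu>\<^bsub>k-1\<^esub>)\<close>, such sums are
  martingales up to boundary terms; \<open>r(2) < 1\<close> leaves room for slightly more than two moments, and
  with them a chaining argument shows that window sums are \<open>o(sqrt t)\<close> uniformly in the window.\<close>

section \<open>Birkhoff's theorem for ergodic transformations\<close>

text \<open>The centring and the summation range both depend on the environment, so a moment bound
  for one fixed window does not suffice: window sums have to be controlled for all positions and
  lengths at once, outside a single null set. With moments of order \<open>2 + 2 s\<close> the bound
  for position x and length y is, up to a logarithm, the power 1 / (2 + 2 s) of x^(1 + s/8) y^s. For
  y = x this stays below x^(5/8), which confines the random end points; for y of order x^(5/8) it is
  o(sqrt x), which is what the limit needs. A suitable s exists because the moment of A_0 of order k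
  is continuous in k as k decreases to 2. On the quenched side everything comes from conditioning on
  the first step. First-passage probabilities obey a recursion in time, the strong Markov property
  turns into a convolution identity for them, and moments are compared with explicit solutions of
  first-step equations by induction on a truncation of time, so finiteness is a result and not a
  premise.\<close>

definition birkhoff_sum :: "('a \<Rightarrow> 'a) \<Rightarrow> ('a \<Rightarrow> real) \<Rightarrow> nat \<Rightarrow> 'a \<Rightarrow> real" where
  "birkhoff_sum T f n x = (\<Sum>k<n. f ((T ^^ k) x))"

text \<open>The maximum of the Birkhoff sums of lengths 1 to \<open>n + 1\<close>. As a recursion
  along the orbit it makes the comparison between the maxima at \<open>x\<close> and at
  \<open>T x\<close> definitional.\<close>

fun birkhoff_max :: "('a \<Rightarrow> 'a) \<Rightarrow> ('a \<Rightarrow> real) \<Rightarrow> nat \<Rightarrow> 'a \<Rightarrow> real" where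
  "birkhoff_max T f 0 x = f x"
| "birkhoff_max T f (Suc n) x = f x + max 0 (birkhoff_max T f n (T x))"

lemma birkhoff_sum_Suc: "birkhoff_sum T f (Suc n) x = f x + birkhoff_sum T f n (T x)"
  unfolding birkhoff_sum_def by (subst sum.lessThan_Suc_shift) (simp add: funpow_swap1)

lemma birkhoff_sum_le_max: "birkhoff_sum T f (Suc n) x \<le> birkhoff_max T f n x"
proof (induction n arbitrary: x)
  case 0
  show ?case by (simp add: birkhoff_sum_def)
next
  case (Suc n)
  show ?case using Suc[of "T x"] by (subst birkhoff_sum_Suc) simp
qed

lemma birkhoff_max_mono: "birkhoff_max T f n x \<le> birkhoff_max T f (Suc n) x"
proof (induction n arbitrary: x)
  case (Suc n)
  show ?case using Suc[of "T x"] by simp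
qed simp

lemma birkhoff_max_ge: "f x \<le> birkhoff_max T f n x"
  by (cases n) auto

lemma birkhoff_max_incseq: "m \<le> n \<Longrightarrow> birkhoff_max T f m x \<le> birkhoff_max T f n x"
  by (rule lift_Suc_mono_le[of "\<lambda>n. birkhoff_max T f n x"]) (rule birkhoff_max_mono)

lemma integral_mpt:
  fixes f :: "'a \<Rightarrow> real"
  assumes T: "T \<in> measurable M M" "distr M M T = M" and f: "integrable M f"
  shows "integrable M (\<lambda>x. f (T x))" "(\<integral>x. f (T x) \<partial>M) = integral\<^sup>L M f"
proof -
  have fm: "f \<in> borel_measurable M" using f by auto
  have "integrable (distr M M T) f" using f T by simp
  then show "integrable M (\<lambda>x. f (T x))" using integrable_distr_eq[OF T(1) fm] by simp
  show "(\<integral>x. f (T x) \<partial>M) = integral\<^sup>L M f"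
    using integral_distr[OF T(1) fm] T(2) by simp
qed

text \<open>Unboundedness of the maxima is an invariant event, since the maxima at \<open>x\<close>
  and at \<open>T x\<close> differ by \<open>f x\<close> and a positive part. If it had probability
  one, the differences between the maximum of index \<open>n + 1\<close> at \<open>x\<close> and
  that of index \<open>n\<close> at \<open>T x\<close> would converge to \<open>f\<close>. Their
  integrals are nonnegative by monotonicity and invariance, which contradicts the negative
  mean.\<close>

lemma birkhoff_max_bounded:
  fixes f :: "'a \<Rightarrow> real"
  assumes "prob_space M" and T [measurable]: "T \<in> measurable M M" and pres: "distr M M T = M"
    and erg: "ergodic_mpt M T" and f: "integrable M f" and neg: "integral\<^sup>L M f < 0"
  shows "AE x in M. \<exists>K. \<forall>n. birkhoff_max T f n x \<le> K"
proof -
  interpret prob_space M by fact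
  have fm [measurable]: "f \<in> borel_measurable M" using f by auto
  let ?F = "birkhoff_max T f"
  have Fm [measurable]: "?F n \<in> borel_measurable M" for n
  proof (induction n)
    case 0
    show ?case using fm by (simp cong: measurable_cong)
  next
    case (Suc n)
    note [measurable] = Suc
    show ?case by simp
  qed
  have Fi: "integrable M (?F n)" for n
  proof (induction n)
    case 0
    show ?case using f by (simp cong: integrable_cong)
  next
    case (Suc n)
    show ?case
      using integral_mpt(1)[OF T pres Suc] f by (simp cong: integrable_cong)
  qed
  define A where "A = {x \<in> space M. \<forall>K::nat. \<exists>n. real K < ?F n x}"
  have A [measurable]: "A \<in> sets M" unfolding A_def by measurable
  have unb: "(\<forall>K::nat. \<exists>n. real K < ?F n x) \<longleftrightarrow> (\<forall>K::nat. \<exists>n. real K < ?F n (T x))" for x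
  proof (intro iffI allI)
    fix K :: nat assume a: "\<forall>K::nat. \<exists>n. real K < ?F n x"
    obtain K' :: nat where K': "real K + \<bar>f x\<bar> \<le> real K'" using real_arch_simple by blast
    from a obtain n where "real K' < ?F n x" by blast
    then have "real K' < ?F (Suc n) x" using birkhoff_max_mono[of T f n x] by linarith
    then have "real K < max 0 (?F n (T x))" using K' by simp
    then show "\<exists>n. real K < ?F n (T x)" by (intro exI[of _ n]) simp
  next
    fix K :: nat assume a: "\<forall>K::nat. \<exists>n. real K < ?F n (T x)"
    obtain K' :: nat where K': "real K + \<bar>f x\<bar> \<le> real K'" using real_arch_simple by blast
    from a obtain n where "real K' < ?F n (T x)" by blast
    then show "\<exists>n. real K < ?F n x" using K' by (intro exI[of _ "Suc n"]) simp
  qed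
  have "T -` A \<inter> space M = A"
    unfolding A_def using unb measurable_space[OF T] by blast
  then have "measure M A = 0 \<or> measure M A = 1"
    using erg A unfolding ergodic_mpt_def by blast
  moreover have "measure M A \<noteq> 1"
  proof
    assume "measure M A = 1"
    then have AEA: "AE x in M. x \<in> A" using prob_eq_1[OF A] by simp
    let ?D = "\<lambda>n x. f x + max 0 (- ?F n (T x))"
    have D: "?D n x = ?F (Suc n) x - ?F n (T x)" for n x by simp
    have "0 \<le> (\<integral>x. ?D n x \<partial>M)" for n
    proof -
      have "(\<integral>x. ?D n x \<partial>M) = (\<integral>x. ?F (Suc n) x \<partial>M) - (\<integral>x. ?F n (T x) \<partial>M)"
        unfolding D using Fi[of "Suc n"] integral_mpt(1)[OF T pres Fi[of n]]
        by (intro Bochner_Integration.integral_diff)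
      also have "\<dots> = (\<integral>x. ?F (Suc n) x \<partial>M) - (\<integral>x. ?F n x \<partial>M)"
        using integral_mpt(2)[OF T pres Fi[of n]] by simp
      also have "\<dots> \<ge> 0"
        using integral_mono[OF Fi[of n] Fi[of "Suc n"] birkhoff_max_mono] by simp
      finally show ?thesis .
    qed
    \<comment> \<open>Domination: every maximum is at least \<open>f\<close>, so its negative part
      at \<open>T x\<close> is at most \<bar>f (T x)\<bar>.\<close>
    moreover have "(\<lambda>n. \<integral>x. ?D n x \<partial>M) \<longlonglongrightarrow> integral\<^sup>L M f"
    proof (rule integral_dominated_convergence[where w = "\<lambda>x. \<bar>f x\<bar> + \<bar>f (T x)\<bar>"])
      show "integrable M (\<lambda>x. \<bar>f x\<bar> + \<bar>f (T x)\<bar>)"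
        using f integral_mpt(1)[OF T pres f] by auto
      show "AE x in M. norm (?D n x) \<le> \<bar>f x\<bar> + \<bar>f (T x)\<bar>" for n
      proof (rule AE_I2)
        fix x show "norm (?D n x) \<le> \<bar>f x\<bar> + \<bar>f (T x)\<bar>"
          using birkhoff_max_ge[of f "T x" T n] by (auto simp: max_def abs_if)
      qed
      show "AE x in M. (\<lambda>n. ?D n x) \<longlonglongrightarrow> f x"
        using AEA
      proof eventually_elim
        case (elim x)
        then have "\<forall>K::nat. \<exists>n. real K < ?F n (T x)" using unb[of x] unfolding A_def by blast
        from this[rule_format, of 0] obtain n where n: "0 < ?F n (T x)" by auto
        have "eventually (\<lambda>m. ?D m x = f x) sequentially"
        proof (rule eventually_sequentiallyI[of n])
          fix m assume "n \<le> m"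
          with n birkhoff_max_incseq[of n m T f "T x"] show "?D m x = f x" by simp
        qed
        then show ?case by (rule tendsto_eventually)
      qed
    qed simp_all
    ultimately have "0 \<le> integral\<^sup>L M f" by (intro LIMSEQ_le_const) auto
    with neg show False by simp
  qed
  ultimately have "measure M A = 0" by simp
  then have "AE x in M. x \<notin> A" using A by (simp add: prob_eq_0)
  then show ?thesis
    using AE_space
  proof eventually_elim
    case (elim x)
    then show ?case unfolding A_def by (auto simp: not_less)
  qed
qed

lemma birkhoff_limsup:
  fixes f :: "'a \<Rightarrow> real"
  assumes M: "prob_space M" and T: "T \<in> measurable M M" "distr M M T = M"
    and erg: "ergodic_mpt M T" and f: "integrable M f" and e: "0 < e"
  shows "AE x in M. eventually (\<lambda>n. birkhoff_sum T f n x / n \<le> integral\<^sup>L M f + e) sequentially"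
proof -
  interpret prob_space M by fact
  \<comment> \<open>One half of \<open>e\<close> makes the mean of \<open>f - c\<close> negative,
    the other half absorbs the bounded remainder divided by \<open>n\<close>.\<close>
  define c where "c = integral\<^sup>L M f + e / 2"
  have "integrable M (\<lambda>x. f x - c)" "(\<integral>x. f x - c \<partial>M) < 0"
    using f e by (simp_all add: c_def prob_space)
  from birkhoff_max_bounded[OF M T erg this] show ?thesis
  proof eventually_elim
    case (elim x)
    then obtain K where K: "\<And>n. birkhoff_max T (\<lambda>x. f x - c) n x \<le> K" by blast
    have b: "birkhoff_sum T f n x \<le> n * c + \<bar>K\<bar>" for n
    proof (cases n)
      case 0
      then show ?thesis by (simp add: birkhoff_sum_def)
    next
      case (Suc m)
      have "birkhoff_sum T (\<lambda>x. f x - c) n x \<le> K"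
        unfolding Suc using birkhoff_sum_le_max[of T "\<lambda>x. f x - c" m x] K[of m] by (rule order_trans)
      then show ?thesis by (simp add: birkhoff_sum_def sum_subtractf)
    qed
    have "(\<lambda>n. \<bar>K\<bar> / real n) \<longlonglongrightarrow> 0" by (rule lim_const_over_n)
    then have "eventually (\<lambda>n. \<bar>K\<bar> / real n < e / 2) sequentially"
      using e by (intro order_tendstoD) auto
    then show ?case using eventually_gt_at_top[of 0]
    proof eventually_elim
      case (elim n)
      have "birkhoff_sum T f n x / n \<le> (n * c + \<bar>K\<bar>) / n" using b by (intro divide_right_mono) auto
      also have "\<dots> = c + \<bar>K\<bar> / n" using elim by (simp add: field_simps)
      finally show ?case using elim(1) unfolding c_def by linarith
    qed
  qed
qed

theorem birkhoff_ergodic: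
  fixes f :: "'a \<Rightarrow> real"
  assumes M: "prob_space M" and T: "T \<in> measurable M M" "distr M M T = M"
    and erg: "ergodic_mpt M T" and f: "integrable M f"
  shows "AE x in M. (\<lambda>n. (\<Sum>k<n. f ((T ^^ k) x)) / n) \<longlonglongrightarrow> integral\<^sup>L M f"
proof -
  have f': "integrable M (\<lambda>x. - f x)" using f by simp
  have "AE x in M. \<forall>m::nat. eventually (\<lambda>n. birkhoff_sum T f n x / n \<le> integral\<^sup>L M f + 1 / Suc m) sequentially"
    unfolding AE_all_countable by (intro allI birkhoff_limsup[OF M T erg f]) simp
  moreover have "AE x in M. \<forall>m::nat. eventually (\<lambda>n. birkhoff_sum T (\<lambda>x. - f x) n x / n \<le> integral\<^sup>L M (\<lambda>x. - f x) + 1 / Suc m) sequentially"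
    unfolding AE_all_countable by (intro allI birkhoff_limsup[OF M T erg f']) simp
  ultimately show ?thesis
  proof eventually_elim
    case (elim x)
    show ?case
    proof (rule tendstoI)
      fix e :: real assume "0 < e"
      then obtain m where m: "1 / real (Suc m) < e" using nat_approx_posE by blast
      from elim(1)[rule_format, of m] elim(2)[rule_format, of m]
      show "eventually (\<lambda>n. dist ((\<Sum>k<n. f ((T ^^ k) x)) / n) (integral\<^sup>L M f) < e) sequentially"
      proof eventually_elim
        case (elim n)
        then show ?case using m
          by (simp add: birkhoff_sum_def sum_negf dist_real_def abs_less_iff)
      qed
    qed
  qed
qed

section \<open>The Lindeberg central limit theorem\<close>

text \<open>Polya's argument: convergence on a finite grid is uniform, monotonicity carries it to
  the cells between grid points, and the two tails are controlled because all functions stay in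
  [0, 1]. Uniform continuity of the limit on a compact interval fixes the mesh.\<close>

lemma uniform_limit_cdf:
  fixes F :: "nat \<Rightarrow> real \<Rightarrow> real" and G :: "real \<Rightarrow> real"
  assumes G: "real_distribution P" "G = cdf P" "continuous_on UNIV G"
    and F: "\<And>n. mono (F n)" "\<And>n x. 0 \<le> F n x" "\<And>n x. F n x \<le> 1"
    and lim: "\<And>x. (\<lambda>n. F n x) \<longlonglongrightarrow> G x"
  shows "uniform_limit UNIV F G sequentially"
proof (rule uniform_limitI)
  fix e :: real assume e: "0 < e"
  interpret P: real_distribution P by fact
  have monoG: "mono G" unfolding G(2) mono_def using P.cdf_nondecreasing by blast
  have G01: "0 \<le> G x" "G x \<le> 1" for x
    unfolding G(2) by (auto simp: P.cdf_nonneg P.cdf_bounded_prob)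
  have "eventually (\<lambda>x. G x < e/2) at_bot"
    using P.cdf_lim_at_bot e unfolding G(2) by (intro order_tendstoD(2)[where a="e/2"]) auto
  then obtain a where a: "\<And>x. x \<le> a \<Longrightarrow> G x < e/2" unfolding eventually_at_bot_linorder by auto
  have "eventually (\<lambda>x. G x > 1 - e/2) at_top"
    using P.cdf_lim_at_top_prob e unfolding G(2) by (intro order_tendstoD(1)[where a="1-e/2"]) auto
  then obtain b where b: "\<And>x. x \<ge> b \<Longrightarrow> G x > 1 - e/2" unfolding eventually_at_top_linorder by auto
  define c where "c = max b (a + 1)"
  have ac: "a < c" and c: "\<And>x. x \<ge> c \<Longrightarrow> G x > 1 - e/2" using b by (auto simp: c_def)
  have "uniformly_continuous_on {a..c} G"
    by (rule compact_uniformly_continuous) (auto intro: continuous_on_subset[OF G(3)])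
  then obtain d where d: "0 < d" "\<And>x y. \<lbrakk>x \<in> {a..c}; y \<in> {a..c}; dist y x < d\<rbrakk> \<Longrightarrow> dist (G y) (G x) < e/2"
    using e unfolding uniformly_continuous_on_def by (meson half_gt_zero)
  obtain N :: nat where N: "(c - a) / d < real N" using reals_Archimedean2 by blast
  have N0: "0 < N" using N ac d(1) by (cases N) (auto simp: divide_less_0_iff)
  define g where "g i = a + real i * (c - a) / real N" for i
  have g0: "g 0 = a" and gN: "g N = c" using N0 by (auto simp: g_def)
  have gstep: "g (Suc i) - g i < d" for i
  proof -
    have "g (Suc i) - g i = (c - a) / N" using N0 by (simp add: g_def field_simps)
    also have "\<dots> < d" using N d(1) N0 by (simp add: field_simps)
    finally show ?thesis .
  qed
  have gmono: "g i \<le> g j" if "i \<le> j" for i j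
    using that ac by (auto simp: g_def intro!: divide_right_mono mult_right_mono)
  have "eventually (\<lambda>n. \<forall>i\<in>{..N}. dist (F n (g i)) (G (g i)) < e/2) sequentially"
    using e by (intro eventually_ball_finite ballI tendstoD[OF lim]) auto
  then show "\<forall>\<^sub>F n in sequentially. \<forall>x\<in>UNIV. dist (F n x) (G x) < e"
  proof eventually_elim
    case (elim n)
    have g: "\<bar>F n (g i) - G (g i)\<bar> < e/2" if "i \<le> N" for i
      using elim that by (auto simp: dist_real_def)
    show ?case
    proof
      fix x
      consider "x \<le> a" | "x \<ge> c" | "a < x" "x < c" by linarith
      then show "dist (F n x) (G x) < e"
      proof cases
        case 1
        have "F n x \<le> F n a" "G x < e/2" using monoD[OF F(1) 1] a[OF 1] by auto
        moreover have "F n a < G a + e/2" using g[of 0] unfolding g0 by linarith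
        moreover have "G a < e/2" using a by simp
        ultimately show ?thesis using G01[of x] F(2)[of n x] by (auto simp: dist_real_def)
      next
        case 2
        have "F n c \<le> F n x" "G x > 1 - e/2" using monoD[OF F(1) 2] c[OF 2] by auto
        moreover have "F n c > G c - e/2" using g[of N] unfolding gN by linarith
        moreover have "G c > 1 - e/2" using c by simp
        ultimately show ?thesis using G01[of x] F(3)[of n x] by (auto simp: dist_real_def)
      next
        case 3
        \<comment> \<open>The right end of the grid cell that contains \<open>x\<close>; its
          predecessor is the left end by minimality.\<close>
        define i where "i = (LEAST i. x < g i)"
        have xg: "x < g i" unfolding i_def by (rule LeastI[of _ N]) (use 3 gN in simp)
        have iN: "i \<le> N" unfolding i_def by (rule Least_le) (use 3 gN in simp)
        have i0: "i \<noteq> 0"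
        proof
          assume "i = 0"
          then have "x < a" using xg g0 by simp
          then show False using 3 by simp
        qed
        then obtain j where j: "i = Suc j" by (cases i) auto
        have gx: "g j \<le> x" using not_less_Least[of j "\<lambda>i. x < g i"] j by (auto simp: i_def[symmetric] not_less)
        have in1: "g j \<in> {a..c}" "g i \<in> {a..c}" "x \<in> {a..c}"
          using gmono[of 0 j] gmono[of i N] gmono[of j N] gmono[of 0 i] g0 gN iN j 3 by auto
        have d1: "dist (G x) (G (g j)) < e/2" "dist (G (g i)) (G x) < e/2"
          using in1 xg gx gstep[of j] j by (intro d(2); simp add: dist_real_def)+
        have "F n (g j) \<le> F n x" "F n x \<le> F n (g i)" using F(1)[of n] gx xg by (auto simp: mono_def)
        moreover have "\<bar>F n (g j) - G (g j)\<bar> < e/2" "\<bar>F n (g i) - G (g i)\<bar> < e/2"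
          using g iN j by auto
        ultimately show ?thesis using d1 unfolding dist_real_def by linarith
      qed
    qed
  qed
qed

lemma exp_minus_approx:
  fixes y :: real
  assumes "0 \<le> y"
  shows "\<bar>exp (- y) - (1 - y)\<bar> \<le> y\<^sup>2"
proof -
  have 1: "1 - y \<le> exp (-y)" using exp_ge_add_one_self[of "-y"] by simp
  have "exp (-y) \<le> 1 / (1 + y)"
    using exp_ge_add_one_self[of y] assms by (simp add: exp_minus inverse_eq_divide frac_le)
  also have "\<dots> \<le> 1 - y + y\<^sup>2"
  proof -
    have "1 \<le> (1 - y + y\<^sup>2) * (1 + y)"
      using assms by (simp add: algebra_simps power2_eq_square)
    then show ?thesis using assms by (simp add: divide_le_eq)
  qed
  finally show ?thesis using 1 by simp
qed

text \<open>The Lindeberg condition enters only through the truncated second moments \<open>g K k\<close>,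
  which also control each single variance: \<open>w k \<le> K\<^sup>2 + g K k\<close>.\<close>

lemma lindeberg_char_prod:
  fixes N :: "nat \<Rightarrow> real measure" and w :: "nat \<Rightarrow> real" and g :: "nat \<Rightarrow> nat \<Rightarrow> real" and s2 t :: real
  assumes rd: "\<And>k. real_distribution (N k)"
    and i1: "\<And>k. integrable (N k) (\<lambda>x. x)" and m0: "\<And>k. (\<integral>x. x \<partial>N k) = 0"
    and i2: "\<And>k. integrable (N k) (\<lambda>x. x\<^sup>2)"
    and w: "\<And>k. w k = (\<integral>x. x\<^sup>2 \<partial>N k)"
    and g: "\<And>K k. g K k = (\<integral>x. x\<^sup>2 * indicator {x. real K < \<bar>x\<bar>} x \<partial>N k)"
    and lim: "(\<lambda>n. (\<Sum>k<n. w k) / n) \<longlonglongrightarrow> s2" and s2: "0 < s2"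
    and lind: "\<And>e. 0 < e \<Longrightarrow> \<exists>K::nat. eventually (\<lambda>n. (\<Sum>k<n. g K k) / n \<le> e) sequentially"
  shows "(\<lambda>n. \<Prod>k<n. char (N k) (t / sqrt (s2 * n))) \<longlonglongrightarrow> of_real (exp (- t\<^sup>2 / 2))"
proof -
  interpret N: real_distribution "N k" for k by (rule rd)
  define u where "u n = t / sqrt (s2 * real n)" for n
  have u2: "(u n)\<^sup>2 = t\<^sup>2 / (s2 * n)" for n
    using s2 by (simp add: u_def power_divide)
  have w0: "0 \<le> w k" for k unfolding w by (rule integral_nonneg_AE) auto
  have ig: "integrable (N k) (\<lambda>x. x\<^sup>2 * indicator {x. real K < \<bar>x\<bar>} x)" for K k
  proof (rule Bochner_Integration.integrable_bound[OF i2[of k]])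
    show "AE x in N k. norm (x\<^sup>2 * indicator {x. real K < \<bar>x\<bar>} x) \<le> norm (x\<^sup>2)"
      by (auto simp: indicator_def)
  qed (use measurable_ident in simp)
  have g0: "0 \<le> g K k" for K k unfolding g by (rule integral_nonneg_AE) auto
  have wg: "w k \<le> (real K)\<^sup>2 + g K k" for K k
  proof -
    have "w k \<le> (\<integral>x. (real K)\<^sup>2 + x\<^sup>2 * indicator {x. real K < \<bar>x\<bar>} x \<partial>N k)"
      unfolding w
    proof (rule integral_mono[OF i2])
      show "integrable (N k) (\<lambda>x. (real K)\<^sup>2 + x\<^sup>2 * indicator {x. real K < \<bar>x\<bar>} x)" using ig by simp
      fix x :: real
      show "x\<^sup>2 \<le> (real K)\<^sup>2 + x\<^sup>2 * indicator {x. real K < \<bar>x\<bar>} x"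
        by (auto simp: indicator_def abs_le_square_iff[symmetric])
    qed
    also have "\<dots> = (real K)\<^sup>2 + g K k" using ig by (simp add: g N.prob_space[simplified])
    finally show ?thesis .
  qed
  \<comment> \<open>Two errors are added. In the Taylor remainder the cubic bound is used for
    \<bar>x\<bar> \<le> K and the quadratic one beyond \<open>K\<close>. Replacing 1 - y by exp (-
    y) costs y^2, where one factor y is bounded through \<open>wg\<close>.\<close>
  have char_bound: "cmod (char (N k) (u n) - of_real (exp (- ((u n)\<^sup>2 * w k / 2)))) \<le>
     (u n)\<^sup>2 * (\<bar>u n\<bar> * K * w k + g K k) + ((u n)\<^sup>2 * w k / 2) * ((u n)\<^sup>2 * ((real K)\<^sup>2 + g K k))" for n k and K :: nat
  proof -
    have "cmod (char (N k) (u n) - (1 - (u n)\<^sup>2 * w k / 2)) \<le>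
       ((u n)\<^sup>2 / 6) * (\<integral>x. min (6 * x\<^sup>2) (\<bar>u n\<bar> * \<bar>x\<bar> ^ 3) \<partial>N k)"
      using m0[of k] by (intro N.char_approx3 i1 m0 i2) (simp add: w)
    also have "(\<integral>x. min (6 * x\<^sup>2) (\<bar>u n\<bar> * \<bar>x\<bar> ^ 3) \<partial>N k) \<le>
       (\<integral>x. \<bar>u n\<bar> * K * x\<^sup>2 + 6 * (x\<^sup>2 * indicator {x. real K < \<bar>x\<bar>} x) \<partial>N k)"
    proof (rule integral_mono)
      show "integrable (N k) (\<lambda>x. min (6 * x\<^sup>2) (\<bar>u n\<bar> * \<bar>x\<bar> ^ 3))"
        by (rule Bochner_Integration.integrable_bound[where f="\<lambda>x. 6 * x\<^sup>2"]) (use i2 in auto)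
      show "integrable (N k) (\<lambda>x. \<bar>u n\<bar> * K * x\<^sup>2 + 6 * (x\<^sup>2 * indicator {x. real K < \<bar>x\<bar>} x))"
        using i2 ig by simp
      fix x :: real
      have "\<bar>u n\<bar> * \<bar>x\<bar> ^ 3 \<le> \<bar>u n\<bar> * K * x\<^sup>2" if "\<bar>x\<bar> \<le> K"
      proof -
        have "\<bar>x\<bar> ^ 3 = \<bar>x\<bar> * x\<^sup>2" by (simp add: power3_eq_cube power2_eq_square)
        also have "\<dots> \<le> K * x\<^sup>2" using that by (intro mult_right_mono) auto
        finally show ?thesis by (simp add: mult.assoc mult_left_mono)
      qed
      moreover have "0 \<le> \<bar>u n\<bar> * K * x\<^sup>2" by simp
      ultimately show "min (6 * x\<^sup>2) (\<bar>u n\<bar> * \<bar>x\<bar> ^ 3) \<le> \<bar>u n\<bar> * K * x\<^sup>2 + 6 * (x\<^sup>2 * indicator {x. real K < \<bar>x\<bar>} x)"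
        by (cases "\<bar>x\<bar> \<le> K") (simp_all add: indicator_def min_le_iff_disj)
    qed
    also have "\<dots> = \<bar>u n\<bar> * K * w k + 6 * g K k"
      using i2 ig by (simp add: w g)
    finally have 1: "cmod (char (N k) (u n) - (1 - (u n)\<^sup>2 * w k / 2)) \<le> (u n)\<^sup>2 / 6 * (\<bar>u n\<bar> * K * w k + 6 * g K k)"
      by (simp add: mult_left_mono)
    also have "\<dots> \<le> (u n)\<^sup>2 * (\<bar>u n\<bar> * K * w k + g K k)"
    proof -
      have "0 \<le> (u n)\<^sup>2 * (\<bar>u n\<bar> * K * w k)" using w0 by simp
      then show ?thesis by (simp add: algebra_simps)
    qed
    finally have 1: "cmod (char (N k) (u n) - (1 - (u n)\<^sup>2 * w k / 2)) \<le> (u n)\<^sup>2 * (\<bar>u n\<bar> * K * w k + g K k)" .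
    define y where "y = (u n)\<^sup>2 * w k / 2"
    have y0: "0 \<le> y" using w0 by (simp add: y_def)
    have "(1 - complex_of_real y) - of_real (exp (- y)) = of_real ((1 - y) - exp (- y))" by simp
    then have "cmod ((1 - complex_of_real y) - of_real (exp (- y))) = \<bar>exp (- y) - (1 - y)\<bar>"
      by (simp only: norm_of_real abs_minus_commute)
    also have "\<dots> \<le> y * y" using exp_minus_approx[OF y0] by (simp add: power2_eq_square)
    also have "\<dots> \<le> y * ((u n)\<^sup>2 * ((real K)\<^sup>2 + g K k))"
    proof (rule mult_left_mono[OF _ y0])
      have "y \<le> (u n)\<^sup>2 * w k" using w0 by (simp add: y_def)
      also have "\<dots> \<le> (u n)\<^sup>2 * ((real K)\<^sup>2 + g K k)" by (intro mult_left_mono wg) simp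
      finally show "y \<le> (u n)\<^sup>2 * ((real K)\<^sup>2 + g K k)" .
    qed
    finally have 2: "cmod ((1 - complex_of_real y) - of_real (exp (- y))) \<le> y * ((u n)\<^sup>2 * ((real K)\<^sup>2 + g K k))" .
    have "cmod (char (N k) (u n) - of_real (exp (- y))) \<le>
        cmod (char (N k) (u n) - (1 - complex_of_real y)) + cmod ((1 - complex_of_real y) - of_real (exp (- y)))"
      using norm_triangle_ineq[of "char (N k) (u n) - (1 - complex_of_real y)" "(1 - complex_of_real y) - of_real (exp (- y))"]
      by simp
    then show ?thesis using 1 2 unfolding y_def by simp
  qed
  have e_prod: "(\<Prod>k<n. complex_of_real (exp (- ((u n)\<^sup>2 * w k / 2)))) = of_real (exp (- (t\<^sup>2 / (2 * s2)) * ((\<Sum>k<n. w k) / n)))" for n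
    by (simp only: of_real_prod[symmetric] exp_sum[symmetric, OF finite_lessThan] sum_negf sum_divide_distrib[symmetric]
        sum_distrib_left[symmetric] u2) simp
  have lim2: "(\<lambda>n. complex_of_real (exp (- (t\<^sup>2 / (2 * s2)) * ((\<Sum>k<n. w k) / n)))) \<longlonglongrightarrow> of_real (exp (- (t\<^sup>2 / (2 * s2)) * s2))"
    by (intro tendsto_of_real tendsto_exp tendsto_mult tendsto_const lim)
  have diff: "(\<lambda>n. (\<Prod>k<n. char (N k) (u n)) - (\<Prod>k<n. complex_of_real (exp (- ((u n)\<^sup>2 * w k / 2))))) \<longlonglongrightarrow> 0"
  proof (rule tendstoI)
    fix e :: real assume e: "0 < e"
    define c where "c = t\<^sup>2 / s2"
    have c0: "0 \<le> c" using s2 by (simp add: c_def)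
    \<comment> \<open>Chosen so that the estimate reached at the end,
      \<open>(c + 1) * (2 * d * (1 + c * (s2 + 1)))\<close>, is at most
      \<open>e / 2\<close>.\<close>
    define d where "d = min 1 (e / (4 * (c + 1) * (1 + c * (s2 + 1))))"
    have den: "0 < 4 * (c + 1) * (1 + c * (s2 + 1))" using c0 s2 by (intro mult_pos_pos) (auto intro: add_pos_nonneg)
    have d: "0 < d" using e den by (simp add: d_def)
    obtain K :: nat where K: "eventually (\<lambda>n. (\<Sum>k<n. g K k) / n \<le> d) sequentially"
      using lind[OF d] by blast
    have "eventually (\<lambda>n. (\<Sum>k<n. w k) / n < s2 + 1) sequentially"
      by (rule order_tendstoD[OF lim]) simp
    moreover have "eventually (\<lambda>n. \<bar>u n\<bar> * K * (s2 + 1) < d) sequentially"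
    proof -
      have "(\<lambda>n. t / sqrt (s2 * real n)) \<longlonglongrightarrow> 0" using s2 by real_asymp
      then have "(\<lambda>n. \<bar>u n\<bar> * K * (s2 + 1)) \<longlonglongrightarrow> \<bar>0::real\<bar> * K * (s2 + 1)"
        unfolding u_def by (intro tendsto_intros)
      then show ?thesis using d by (intro order_tendstoD) auto
    qed
    moreover have "eventually (\<lambda>n. (real K)\<^sup>2 / n < d) sequentially"
      using lim_const_over_n[of "(real K)\<^sup>2"] d by (intro order_tendstoD) auto
    ultimately show "eventually (\<lambda>n. dist ((\<Prod>k<n. char (N k) (u n)) - (\<Prod>k<n. complex_of_real (exp (- ((u n)\<^sup>2 * w k / 2))))) 0 < e) sequentially"
      using K eventually_gt_at_top[of 0]
    proof eventually_elim
      case (elim n)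
      have n: "0 < real n" using elim by simp
      have un: "(u n)\<^sup>2 = c / n" unfolding u2 c_def by (simp add: field_simps)
      have sw: "0 \<le> (\<Sum>k<n. w k)" "(\<Sum>k<n. w k) \<le> n * (s2 + 1)" using elim n w0 by (auto simp: sum_nonneg field_simps)
      have sg: "0 \<le> (\<Sum>k<n. g K k)" "(\<Sum>k<n. g K k) \<le> n * d" using elim n g0 by (auto simp: sum_nonneg field_simps)
      \<comment> \<open>A single truncated moment is bounded by the whole sum. With
        \<open>wg\<close> this is the uniform smallness of the individual variances relative to
        \<open>n\<close>.\<close>
      have gk: "g K k \<le> n * d" if "k < n" for k
        using sg(2) member_le_sum[of k "{..<n}" "g K"] that g0 by auto
      have "norm ((\<Prod>k<n. char (N k) (u n)) - (\<Prod>k<n. complex_of_real (exp (- ((u n)\<^sup>2 * w k / 2)))))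
         \<le> (\<Sum>k<n. norm (char (N k) (u n) - complex_of_real (exp (- ((u n)\<^sup>2 * w k / 2)))))"
        using w0 by (intro norm_prod_diff) (auto intro: N.cmod_char_le_1)
      also have "\<dots> \<le> (\<Sum>k<n. (u n)\<^sup>2 * (\<bar>u n\<bar> * K * w k + g K k) + ((u n)\<^sup>2 * w k / 2) * ((u n)\<^sup>2 * ((real K)\<^sup>2 + g K k)))"
        by (intro sum_mono char_bound)
      also have "\<dots> \<le> (\<Sum>k<n. (u n)\<^sup>2 * (\<bar>u n\<bar> * K * w k + g K k) + ((u n)\<^sup>2 * w k) * (c * (2 * d)))"
      proof (rule sum_mono, rule add_left_mono, rule mult_mono)
        fix k assume "k \<in> {..<n}"
        then have "(real K)\<^sup>2 + g K k \<le> n * (2 * d)" using gk[of k] elim n by (simp add: field_simps)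
        then have "(u n)\<^sup>2 * ((real K)\<^sup>2 + g K k) \<le> (u n)\<^sup>2 * (n * (2 * d))" by (intro mult_left_mono) auto
        also have "\<dots> = c * (2 * d)" using n by (simp add: un)
        finally show "(u n)\<^sup>2 * ((real K)\<^sup>2 + g K k) \<le> c * (2 * d)" .
      qed (use w0 g0 in auto)
      also have "\<dots> = (u n)\<^sup>2 * (\<bar>u n\<bar> * K * (\<Sum>k<n. w k) + (\<Sum>k<n. g K k) + (c * (2 * d)) * (\<Sum>k<n. w k))"
        by (simp add: sum.distrib sum_distrib_left sum_distrib_right algebra_simps)
      also have "\<dots> \<le> (u n)\<^sup>2 * (n * d + n * d + (c * (2 * d)) * (n * (s2 + 1)))"
      proof (intro mult_left_mono add_mono)
        have "\<bar>u n\<bar> * K * (\<Sum>k<n. w k) \<le> \<bar>u n\<bar> * K * (n * (s2 + 1))" using sw by (intro mult_left_mono) auto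
        also have "\<dots> = n * (\<bar>u n\<bar> * K * (s2 + 1))" by (simp add: algebra_simps)
        also have "\<dots> \<le> n * d" using elim by (intro mult_left_mono) auto
        finally show "\<bar>u n\<bar> * K * (\<Sum>k<n. w k) \<le> n * d" .
      qed (use sw sg c0 d in auto)
      also have "\<dots> = c * (2 * d * (1 + c * (s2 + 1)))"
        unfolding un using n by (simp add: field_simps)
      also have "\<dots> \<le> (c + 1) * (2 * d * (1 + c * (s2 + 1)))"
        using c0 d s2 by (intro mult_right_mono) auto
      also have "\<dots> = d * (4 * (c + 1) * (1 + c * (s2 + 1))) / 2" by (simp add: algebra_simps)
      also have "\<dots> \<le> e / 2"
      proof -
        have "d \<le> e / (4 * (c + 1) * (1 + c * (s2 + 1)))" by (simp add: d_def)
        then have "d * (4 * (c + 1) * (1 + c * (s2 + 1))) \<le> e" using den by (simp only: pos_le_divide_eq)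
        then show ?thesis by simp
      qed
      finally show ?case using e by simp
    qed
  qed
  have "(\<lambda>n. \<Prod>k<n. char (N k) (u n)) \<longlonglongrightarrow> 0 + of_real (exp (- (t\<^sup>2 / (2 * s2)) * s2))"
    using tendsto_add[OF diff lim2] by (simp add: e_prod)
  then show ?thesis using s2 by (simp add: u_def)
qed

text \<open>By Tonelli the series of the \<open>f n\<close> has finite integral, hence converges
  almost everywhere, and its terms tend to zero. It serves in place of Markov's inequality combined
  with Borel-Cantelli.\<close>

lemma AE_tendsto_0_of_summable_integral:
  fixes f :: "nat \<Rightarrow> 'a \<Rightarrow> real"
  assumes f: "\<And>n. integrable M (f n)" "\<And>n x. x \<in> space M \<Longrightarrow> 0 \<le> f n x"
    and c: "\<And>n. integral\<^sup>L M (f n) \<le> c n" "summable c"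
  shows "AE x in M. (\<lambda>n. f n x) \<longlonglongrightarrow> 0"
proof -
  have [measurable]: "f n \<in> borel_measurable M" for n using f(1) by auto
  have nn: "(\<integral>\<^sup>+x. ennreal (f n x) \<partial>M) = ennreal (integral\<^sup>L M (f n))" for n
    using f by (intro nn_integral_eq_integral AE_I2) auto
  have i0: "0 \<le> integral\<^sup>L M (f n)" for n using f(2) by (intro integral_nonneg_AE AE_I2)
  have c0: "0 \<le> c n" for n using i0[of n] c(1)[of n] by linarith
  have "(\<integral>\<^sup>+x. (\<Sum>n. ennreal (f n x)) \<partial>M) = (\<Sum>n. \<integral>\<^sup>+x. ennreal (f n x) \<partial>M)"
    by (rule nn_integral_suminf) simp
  also have "\<dots> \<le> (\<Sum>n. ennreal (c n))"
    unfolding nn by (intro suminf_le ennreal_leI c(1)) auto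
  also have "\<dots> = ennreal (\<Sum>n. c n)" by (rule suminf_ennreal2[OF c0 c(2)])
  finally have "(\<integral>\<^sup>+x. (\<Sum>n. ennreal (f n x)) \<partial>M) \<noteq> \<infinity>" by (auto simp: top_unique)
  then have "AE x in M. (\<Sum>n. ennreal (f n x)) \<noteq> \<infinity>" by (intro nn_integral_PInf_AE) auto
  then show ?thesis using AE_space
  proof eventually_elim
    case (elim x)
    then have "summable (\<lambda>n. f n x)"
      using f(2) by (intro summable_suminf_not_top) auto
    then show ?case by (rule summable_LIMSEQ_zero)
  qed
qed

section \<open>A moment inequality for martingale sums\<close>

text \<open>A smooth substitute for the power 2 + 2 s of \<bar>x\<bar>: adding 1 removes the lack of
  smoothness at the origin, so a second-order Taylor expansion is available for every positive
  \<open>s\<close>.\<close>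

definition smooth_pow :: "real \<Rightarrow> real \<Rightarrow> real" where
  "smooth_pow s x = (1 + x\<^sup>2) powr (1 + s)"

definition smooth_pow' :: "real \<Rightarrow> real \<Rightarrow> real" where
  "smooth_pow' s x = 2 * (1 + s) * x * (1 + x\<^sup>2) powr s"

definition smooth_pow'' :: "real \<Rightarrow> real \<Rightarrow> real" where
  "smooth_pow'' s x = 2 * (1 + s) * (1 + x\<^sup>2) powr s + 4 * s * (1 + s) * x\<^sup>2 * (1 + x\<^sup>2) powr (s - 1)"

lemma one_add_power2_pos: "0 < 1 + (x::real)\<^sup>2"
  by (simp add: add_pos_nonneg)

lemma DERIV_smooth_pow: "DERIV (smooth_pow s) x :> smooth_pow' s x"
  unfolding smooth_pow_def[abs_def] smooth_pow'_def
  using one_add_power2_pos[of x] by (auto intro!: derivative_eq_intros simp: field_simps)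

lemma DERIV_smooth_pow': "DERIV (smooth_pow' s) x :> smooth_pow'' s x"
  unfolding smooth_pow'_def[abs_def] smooth_pow''_def
  using one_add_power2_pos[of x] by (auto intro!: derivative_eq_intros simp: field_simps power2_eq_square)

lemma smooth_pow''_le:
  assumes "0 \<le> s"
  shows "smooth_pow'' s x \<le> 2 * (1 + s) * (1 + 2 * s) * (1 + x\<^sup>2) powr s"
proof -
  have "x\<^sup>2 * (1 + x\<^sup>2) powr (s - 1) \<le> (1 + x\<^sup>2) * (1 + x\<^sup>2) powr (s - 1)"
    by (intro mult_right_mono) auto
  also have "\<dots> = (1 + x\<^sup>2) powr s"
    using one_add_power2_pos[of x] by (simp add: powr_diff)
  finally have "4 * s * (1 + s) * (x\<^sup>2 * (1 + x\<^sup>2) powr (s - 1)) \<le> 4 * s * (1 + s) * (1 + x\<^sup>2) powr s"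
    using assms by (intro mult_left_mono) auto
  then show ?thesis unfolding smooth_pow''_def by (simp add: algebra_simps)
qed

text \<open>Either \<open>d\<^sup>2\<close> is below the fraction 1/n of
  \<open>1 + x\<^sup>2\<close>, or it dominates that fraction. The free parameter \<open>n\<close>
  will be the number of steps: the coefficient 1/n of the first term is what lets the estimate be
  iterated \<open>n\<close> times with a bounded factor.\<close>

lemma powr_mult_square_le:
  fixes n s x d :: real
  assumes "0 < n" "0 \<le> s"
  shows "(1 + x\<^sup>2) powr s * d\<^sup>2 \<le> (1 + x\<^sup>2) powr (1 + s) / n + n powr s * (d\<^sup>2) powr (1 + s)"
proof (cases "n * d\<^sup>2 \<le> 1 + x\<^sup>2")
  case True
  have "(1 + x\<^sup>2) powr s * d\<^sup>2 \<le> (1 + x\<^sup>2) powr s * ((1 + x\<^sup>2) / n)"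
    using True assms by (intro mult_left_mono) (auto simp: field_simps)
  also have "\<dots> = (1 + x\<^sup>2) powr (1 + s) / n"
    using one_add_power2_pos[of x] by (simp add: powr_add)
  also have "\<dots> \<le> (1 + x\<^sup>2) powr (1 + s) / n + n powr s * (d\<^sup>2) powr (1 + s)" by simp
  finally show ?thesis .
next
  case False
  then have d: "0 < d\<^sup>2" using assms one_add_power2_pos[of x] by (metis less_le_trans linorder_not_le mult.commute mult_zero_left zero_less_power2 power_zero_numeral less_imp_le)
  have "(1 + x\<^sup>2) powr s * d\<^sup>2 \<le> (n * d\<^sup>2) powr s * d\<^sup>2"
    using False assms one_add_power2_pos[of x] by (intro mult_right_mono powr_mono2) auto
  also have "\<dots> = n powr s * (d\<^sup>2) powr (1 + s)"
    using d assms by (simp add: powr_mult powr_add)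
  also have "\<dots> \<le> (1 + x\<^sup>2) powr (1 + s) / n + n powr s * (d\<^sup>2) powr (1 + s)"
    using assms by simp
  finally show ?thesis .
qed

text \<open>Taylor expansion with the linear term kept exactly, because it vanishes in expectation
  for martingale increments. The intermediate point satisfies \<bar>t\<bar> \<le> \<bar>x\<bar> +
  \<bar>d\<bar>, hence 1 + t^2 is at most four times the maximum of 1 + x^2 and d^2; this is the
  origin of \<open>4 powr s\<close>.\<close>

lemma smooth_pow_add_le:
  fixes n s x d :: real
  assumes n: "1 \<le> n" and s: "0 \<le> s"
  defines "C \<equiv> (1 + s) * (1 + 2 * s) * 4 powr s"
  shows "smooth_pow s (x + d) \<le> smooth_pow s x + smooth_pow' s x * d
     + C * (smooth_pow s x / n + 2 * n powr s * (d\<^sup>2) powr (1 + s))"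
proof (cases "d = 0")
  case True
  then show ?thesis using n s by (simp add: C_def smooth_pow_def)
next
  case False
  define diff :: "nat \<Rightarrow> real \<Rightarrow> real" where
    "diff m = (if m = 0 then smooth_pow s else if m = 1 then smooth_pow' s else smooth_pow'' s)" for m
  have "\<exists>t. (if x + d < x then x + d < t \<and> t < x else x < t \<and> t < x + d) \<and>
     smooth_pow s (x + d) = (\<Sum>m<2. diff m x / fact m * (x + d - x) ^ m) + diff 2 t / fact 2 * (x + d - x) ^ 2"
  proof (rule Taylor[where a = "min x (x + d)" and b = "max x (x + d)"])
    show "\<forall>m t. m < 2 \<and> min x (x + d) \<le> t \<and> t \<le> max x (x + d) \<longrightarrow> (diff m has_real_derivative diff (Suc m) t) (at t)"
      by (auto simp: diff_def less_2_cases_iff DERIV_smooth_pow DERIV_smooth_pow')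
  qed (use False in \<open>auto simp: diff_def\<close>)
  then obtain t where t0: "if x + d < x then x + d < t \<and> t < x else x < t \<and> t < x + d"
    and eq0: "smooth_pow s (x + d) = (\<Sum>m<2. diff m x / fact m * (x + d - x) ^ m) + diff 2 t / fact 2 * (x + d - x) ^ 2"
    by blast
  have t: "min x (x + d) \<le> t" "t \<le> max x (x + d)" using t0 by (auto split: if_splits)
  have eq: "smooth_pow s (x + d) = smooth_pow s x + smooth_pow' s x * d + smooth_pow'' s t / 2 * d\<^sup>2"
    using eq0 by (simp add: diff_def lessThan_nat_numeral)
  have "\<bar>t\<bar> \<le> \<bar>x\<bar> + \<bar>d\<bar>" using t by (auto simp: min_def max_def split: if_splits)
  then have "t\<^sup>2 \<le> (\<bar>x\<bar> + \<bar>d\<bar>)\<^sup>2" by (metis abs_ge_zero power2_abs power_mono)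
  also have "\<dots> \<le> 2 * x\<^sup>2 + 2 * d\<^sup>2"
    using sum_squares_bound[of "\<bar>x\<bar>" "\<bar>d\<bar>"] by (simp add: power2_sum)
  finally have "t\<^sup>2 \<le> 2 * x\<^sup>2 + 2 * d\<^sup>2" .
  then have t2: "1 + t\<^sup>2 \<le> 4 * max (1 + x\<^sup>2) (d\<^sup>2)"
    using zero_le_power2[of x] zero_le_power2[of d] by (cases "1 + x\<^sup>2 \<le> d\<^sup>2") (simp_all add: max_def)
  have "(1 + t\<^sup>2) powr s \<le> (4 * max (1 + x\<^sup>2) (d\<^sup>2)) powr s"
    using one_add_power2_pos[of t] t2 s by (intro powr_mono2) auto
  also have "\<dots> = 4 powr s * max (1 + x\<^sup>2) (d\<^sup>2) powr s"
    by (rule powr_mult)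
  also have "\<dots> \<le> 4 powr s * ((1 + x\<^sup>2) powr s + (d\<^sup>2) powr s)"
    by (intro mult_left_mono) (auto simp: max_def)
  finally have t3: "(1 + t\<^sup>2) powr s \<le> 4 powr s * ((1 + x\<^sup>2) powr s + (d\<^sup>2) powr s)" .
  have "smooth_pow'' s t / 2 * d\<^sup>2 \<le> (1 + s) * (1 + 2 * s) * (1 + t\<^sup>2) powr s * d\<^sup>2"
    using smooth_pow''_le[OF s, of t] by (intro mult_right_mono) (simp_all add: field_simps)
  also have "\<dots> \<le> (1 + s) * (1 + 2 * s) * (4 powr s * ((1 + x\<^sup>2) powr s + (d\<^sup>2) powr s)) * d\<^sup>2"
    using s by (intro mult_right_mono mult_left_mono t3) auto
  also have "\<dots> = C * ((1 + x\<^sup>2) powr s * d\<^sup>2 + (d\<^sup>2) powr (1 + s))"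
    using False by (simp add: C_def powr_add algebra_simps)
  also have "\<dots> \<le> C * (smooth_pow s x / n + 2 * n powr s * (d\<^sup>2) powr (1 + s))"
  proof (rule mult_left_mono)
    have "(d\<^sup>2) powr (1 + s) \<le> n powr s * (d\<^sup>2) powr (1 + s)"
      using ge_one_powr_ge_zero[OF n s] mult_right_mono[of 1 "n powr s" "(d\<^sup>2) powr (1 + s)"] by simp
    then show "(1 + x\<^sup>2) powr s * d\<^sup>2 + (d\<^sup>2) powr (1 + s) \<le> smooth_pow s x / n + 2 * n powr s * (d\<^sup>2) powr (1 + s)"
      using powr_mult_square_le[of n s x d] n s unfolding smooth_pow_def by linarith
  qed (use s in \<open>simp add: C_def\<close>)
  finally show ?thesis unfolding eq by simp
qed

text \<open>Makes the cross term of the expansion integrable as soon as the sum so far and the new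
  increment have moments of order 2 + 2 s.\<close>

lemma abs_smooth_pow'_mult_le:
  assumes s: "0 \<le> s"
  shows "\<bar>smooth_pow' s x * d\<bar> \<le> 2 * (1 + s) * (smooth_pow s x + (d\<^sup>2) powr (1 + s))"
proof -
  define m where "m = max (1 + x\<^sup>2) (d\<^sup>2)"
  have m0: "0 < m" using one_add_power2_pos[of x] by (simp add: m_def less_max_iff_disj)
  have "\<bar>x\<bar> * \<bar>d\<bar> \<le> (x\<^sup>2 + d\<^sup>2) / 2" using sum_squares_bound[of "\<bar>x\<bar>" "\<bar>d\<bar>"] by simp
  also have "\<dots> \<le> m" by (simp add: m_def max_def)
  finally have xd: "\<bar>x\<bar> * \<bar>d\<bar> \<le> m" .
  have "\<bar>x\<bar> * \<bar>d\<bar> * (1 + x\<^sup>2) powr s \<le> m * m powr s"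
    using xd m0 s one_add_power2_pos[of x] by (intro mult_mono powr_mono2) (auto simp: m_def)
  also have "\<dots> = m powr (1 + s)" using m0 by (simp add: powr_add)
  also have "\<dots> \<le> smooth_pow s x + (d\<^sup>2) powr (1 + s)" by (auto simp: m_def max_def smooth_pow_def)
  finally have "2 * (1 + s) * (\<bar>x\<bar> * \<bar>d\<bar> * (1 + x\<^sup>2) powr s) \<le> 2 * (1 + s) * (smooth_pow s x + (d\<^sup>2) powr (1 + s))"
    using s by (intro mult_left_mono) auto
  then show ?thesis using s by (simp add: smooth_pow'_def abs_mult mult_ac)
qed

lemma borel_measurable_smooth_pow [measurable]:
  "smooth_pow s \<in> borel_measurable borel" "smooth_pow' s \<in> borel_measurable borel"
  unfolding smooth_pow_def[abs_def] smooth_pow'_def[abs_def] by measurable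

text \<open>A one-sided Burkholder-type bound with the correct growth in \<open>n\<close>.
  Orthogonality removes the linear term, and each step multiplies the expectation by at most 1 + C/n
  and adds a term of order n^s. Orthogonality is assumed only under integrability of the preceding
  sum, since that integrability is established along the same induction.\<close>

lemma (in prob_space) martingale_moment_bound:
  fixes D :: "nat \<Rightarrow> 'a \<Rightarrow> real" and s m :: real
  assumes s: "0 \<le> s" and [measurable]: "\<And>k. D k \<in> borel_measurable M"
    and D: "\<And>k. integrable M (\<lambda>x. ((D k x)\<^sup>2) powr (1 + s))"
      "\<And>k. (\<integral>x. ((D k x)\<^sup>2) powr (1 + s) \<partial>M) \<le> m"
    and orth: "\<And>k. integrable M (\<lambda>x. smooth_pow s (\<Sum>i<k. D i x)) \<Longrightarrow> (\<integral>x. smooth_pow' s (\<Sum>i<k. D i x) * D k x \<partial>M) = 0"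
    and n: "1 \<le> n"
  defines "C \<equiv> (1 + s) * (1 + 2 * s) * 4 powr s"
  shows "integrable M (\<lambda>x. smooth_pow s (\<Sum>i<n. D i x))"
    and "(\<integral>x. smooth_pow s (\<Sum>i<n. D i x) \<partial>M) \<le> exp C * (1 + 2 * C * m) * real n powr (1 + s)"
proof -
  let ?S = "\<lambda>k x. \<Sum>i<k. D i x"
  have C0: "0 \<le> C" using s by (simp add: C_def)
  have n1: "1 \<le> real n" using n by simp
  have m0: "0 \<le> m" by (rule order_trans[OF _ D(2)[of 0]]) (auto intro!: integral_nonneg_AE)
  let ?R = "\<lambda>k x. smooth_pow s (?S k x) + smooth_pow' s (?S k x) * D k x
     + C * (smooth_pow s (?S k x) / n + 2 * real n powr s * ((D k x)\<^sup>2) powr (1 + s))"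
  have le: "smooth_pow s (?S (Suc k) x) \<le> ?R k x" for k x
    using smooth_pow_add_le[OF n1 s, of "?S k x" "D k x"] by (simp add: C_def)
  have I: "integrable M (\<lambda>x. smooth_pow s (?S k x)) \<Longrightarrow> integrable M (\<lambda>x. smooth_pow' s (?S k x) * D k x)" for k
    by (rule Bochner_Integration.integrable_bound[where f="\<lambda>x. 2 * (1 + s) * (smooth_pow s (?S k x) + ((D k x)\<^sup>2) powr (1 + s))"])
      (use D abs_smooth_pow'_mult_le[OF s] s in \<open>auto simp: smooth_pow_def abs_mult\<close>)
  have int: "integrable M (\<lambda>x. smooth_pow s (?S k x))" for k
  proof (induction k)
    case 0
    then show ?case by simp
  next
    case (Suc k)
    show ?case
    proof (rule Bochner_Integration.integrable_bound[where f = "?R k"])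
      show "integrable M (?R k)" using Suc I[OF Suc] D by auto
      show "AE x in M. norm (smooth_pow s (?S (Suc k) x)) \<le> norm (?R k x)"
      proof (rule AE_I2)
        fix x
        have "0 \<le> smooth_pow s (?S (Suc k) x)" by (simp add: smooth_pow_def)
        with le[of x k] show "norm (smooth_pow s (?S (Suc k) x)) \<le> norm (?R k x)" by simp
      qed
    qed measurable
  qed
  then show "integrable M (\<lambda>x. smooth_pow s (\<Sum>i<n. D i x))" .
  let ?e = "\<lambda>k. \<integral>x. smooth_pow s (?S k x) \<partial>M"
  have e0: "0 \<le> ?e k" for k by (rule integral_nonneg_AE) (simp add: smooth_pow_def)
  have step: "?e (Suc k) \<le> (1 + C / n) * ?e k + 2 * C * real n powr s * m" for k
  proof -
    have "?e (Suc k) \<le> (\<integral>x. ?R k x \<partial>M)"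
      by (rule integral_mono[OF int _ le]) (use int I[OF int] D in auto)
    also have "\<dots> = ?e k + 0 + C * (?e k / n + 2 * real n powr s * (\<integral>x. ((D k x)\<^sup>2) powr (1 + s) \<partial>M))"
      using int I[OF int] D orth[OF int] by simp
    also have "\<dots> \<le> ?e k + 0 + C * (?e k / n + 2 * real n powr s * m)"
      using C0 D(2)[of k] by (intro add_mono order_refl mult_left_mono) auto
    also have "\<dots> = (1 + C / n) * ?e k + 2 * C * real n powr s * m" by (simp add: algebra_simps)
    finally show ?thesis .
  qed
  \<comment> \<open>Discrete Gronwall inequality; after \<open>n\<close> steps the factor is at most
    exp C.\<close>
  have bound: "?e k \<le> (1 + C / n) ^ k * (1 + real k * (2 * C * real n powr s * m))" for k
  proof (induction k)
    case 0
    then show ?case by (simp add: smooth_pow_def prob_space)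
  next
    case (Suc k)
    define b where "b = 2 * C * real n powr s * m"
    have b0: "0 \<le> b" using C0 m0 by (simp add: b_def)
    have q1: "1 \<le> (1 + C / n) ^ Suc k" using C0 by (intro one_le_power) simp
    have "?e (Suc k) \<le> (1 + C / n) * ?e k + b" using step[of k] by (simp add: b_def)
    also have "\<dots> \<le> (1 + C / n) * ((1 + C / n) ^ k * (1 + real k * b)) + (1 + C / n) ^ Suc k * b"
      using Suc C0 b0 q1 mult_right_mono[OF q1 b0] unfolding b_def[symmetric]
      by (intro add_mono mult_left_mono) auto
    also have "\<dots> = (1 + C / n) ^ Suc k * (1 + real (Suc k) * b)"
      by (simp only: power_Suc of_nat_Suc) (simp only: distrib_left distrib_right mult_ac mult_1_left mult_1_right add_ac)
    finally show ?case by (simp add: b_def)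
  qed
  have "(1 + C / n) ^ n \<le> exp (C / n) ^ n"
    using C0 by (intro power_mono) auto
  also have "\<dots> = exp C" using n by (simp add: exp_of_nat_mult[symmetric])
  finally have eC: "(1 + C / n) ^ n \<le> exp C" .
  have "?e n \<le> exp C * (1 + real n * (2 * C * real n powr s * m))"
    using bound[of n] by (rule order_trans) (intro mult_right_mono eC, use C0 m0 in simp)
  also have "\<dots> = exp C * (1 + 2 * C * m * real n powr (1 + s))"
    using n by (simp add: powr_add algebra_simps)
  also have "\<dots> \<le> exp C * ((1 + 2 * C * m) * real n powr (1 + s))"
    using ge_one_powr_ge_zero[OF n1, of "1 + s"] s by (intro mult_left_mono) (auto simp: algebra_simps)
  finally show "?e n \<le> exp C * (1 + 2 * C * m) * real n powr (1 + s)" by (simp add: mult.assoc)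
qed

section \<open>Chaining over dyadic intervals\<close>

text \<open>The binary digits of \<open>m\<close> below position \<open>j\<close> are cleared one at
  a time, from the lowest upwards. Clearing a digit 1 costs one dyadic increment, clearing a digit 0
  costs nothing.\<close>

lemma dyadic_chain_point:
  fixes S :: "nat \<Rightarrow> real"
  assumes inc: "\<And>j i. j \<le> J \<Longrightarrow> (i + 1) * 2 ^ j \<le> n \<Longrightarrow> \<bar>S ((i + 1) * 2 ^ j) - S (i * 2 ^ j)\<bar> \<le> B"
    and B: "0 \<le> B" and m: "m \<le> n" and j: "j \<le> J"
  shows "\<bar>S m - S (m div 2 ^ j * 2 ^ j)\<bar> \<le> real j * B"
  using j
proof (induction j)
  case (Suc j)
  define q where "q = m div 2 ^ j"
  have q: "m div 2 ^ Suc j = q div 2" by (simp add: q_def div_mult2_eq[symmetric] mult.commute)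
  have "q * 2 ^ j \<le> m" unfolding q_def by (rule div_times_less_eq_dividend)
  then have qm: "q * 2 ^ j \<le> n" using m by linarith
  have IH: "\<bar>S m - S (q * 2 ^ j)\<bar> \<le> real j * B" using Suc by (simp add: q_def)
  have "\<bar>S (q * 2 ^ j) - S (q div 2 * 2 ^ Suc j)\<bar> \<le> B"
  proof (cases "even q")
    case True
    then have "q div 2 * 2 ^ Suc j = q * 2 ^ j" by (metis dvd_div_mult_self mult.assoc power_Suc)
    then show ?thesis using B by (simp only: diff_self abs_zero)
  next
    case False
    then have q2: "q = q div 2 * 2 + 1" by presburger
    then have "(q div 2 * 2 + 1) * 2 ^ j \<le> n" using qm by simp
    then have "\<bar>S ((q div 2 * 2 + 1) * 2 ^ j) - S ((q div 2 * 2) * 2 ^ j)\<bar> \<le> B" using inc[of j "q div 2 * 2"] Suc.prems by auto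
    then show ?thesis unfolding q2[symmetric] by (simp add: mult.assoc)
  qed
  then show ?case using IH unfolding q by (simp add: algebra_simps)
qed simp

text \<open>Both end points are rounded down to multiples of \<open>2 ^ J\<close>. As
  \<open>b \<le> a + 2 ^ J\<close>, the rounded points coincide or are adjacent, so one further
  increment joins the two chains.\<close>

lemma dyadic_chain:
  fixes S :: "nat \<Rightarrow> real"
  assumes inc: "\<And>j i. j \<le> J \<Longrightarrow> (i + 1) * 2 ^ j \<le> n \<Longrightarrow> \<bar>S ((i + 1) * 2 ^ j) - S (i * 2 ^ j)\<bar> \<le> B"
    and B: "0 \<le> B" and ab: "a \<le> b" "b \<le> n" "b \<le> a + 2 ^ J"
  shows "\<bar>S b - S a\<bar> \<le> (2 * real J + 1) * B"
proof -
  let ?a = "a div 2 ^ J" and ?b = "b div 2 ^ J"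
  have pt: "\<bar>S m - S (m div 2 ^ J * 2 ^ J)\<bar> \<le> real J * B" if "m \<le> n" for m
    using that by (intro dyadic_chain_point[OF inc B]) auto
  have a: "\<bar>S a - S (?a * 2 ^ J)\<bar> \<le> real J * B" and b: "\<bar>S b - S (?b * 2 ^ J)\<bar> \<le> real J * B"
    using pt ab by auto
  have "?b \<le> (a + 2 ^ J) div 2 ^ J" using ab(3) by (rule div_le_mono)
  then have "?b \<le> ?a + 1" by simp
  moreover have "?a \<le> ?b" using ab(1) by (rule div_le_mono)
  ultimately consider "?b = ?a" | "?b = ?a + 1" by linarith
  then have "\<bar>S (?b * 2 ^ J) - S (?a * 2 ^ J)\<bar> \<le> B"
  proof cases
    case 2
    have "?b * 2 ^ J \<le> n" using div_times_less_eq_dividend[of b "2 ^ J"] ab(2) by linarith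
    then show ?thesis using inc[of J ?a] 2 by simp
  qed (use B in simp)
  with a b show ?thesis by (simp add: algebra_simps)
qed

text \<open>With \<open>p = 2 + 2 * s\<close> finite moments, the weights below make the sum over all dyadic
  increments of all scales \<open>N\<close> integrable, at the price of a factor \<open>2 powr (N * s / 8)\<close>.\<close>

lemma (in prob_space) AE_dyadic_increments:
  fixes S :: "nat \<Rightarrow> 'a \<Rightarrow> real" and s C :: real
  assumes s: "0 < s"
    and inc: "\<And>a b. a < b \<Longrightarrow> integrable M (\<lambda>x. ((S b x - S a x)\<^sup>2) powr (1 + s))"
      "\<And>a b. a < b \<Longrightarrow> (\<integral>x. ((S b x - S a x)\<^sup>2) powr (1 + s) \<partial>M) \<le> C * real (b - a) powr (1 + s)"
  shows "AE x in M. \<exists>K>0. \<forall>N j i. j \<le> N \<longrightarrow> (i + 1) * 2 ^ j \<le> 2 ^ N \<longrightarrow>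
    ((S ((i + 1) * 2 ^ j) x - S (i * 2 ^ j) x)\<^sup>2) powr (1 + s) \<le> K * ((2 ^ N) powr (1 + s / 8) * (2 ^ j) powr s)"
proof -
  let ?Z = "\<lambda>j i x. ((S ((i + 1) * 2 ^ j) x - S (i * 2 ^ j) x)\<^sup>2) powr (1 + s)"
  let ?w = "\<lambda>N j::nat. inverse ((2 ^ N) powr (1 + s / 8) * (2 ^ j) powr s)"
  let ?W = "\<lambda>N x. \<Sum>j\<le>N. \<Sum>i<2 ^ (N - j). ?w N j * ?Z j i x"
  have lt: "i * 2 ^ j < (i + 1) * 2 ^ j" for i j :: nat by simp
  have len: "real ((i + 1) * 2 ^ j - i * 2 ^ j) = 2 ^ j" for i j :: nat by (simp add: algebra_simps)
  have C0: "0 \<le> C"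
  proof -
    have "0 \<le> (\<integral>x. ((S 1 x - S 0 x)\<^sup>2) powr (1 + s) \<partial>M)" by (rule integral_nonneg_AE) auto
    also have "\<dots> \<le> C" using inc(2)[of 0 1] by simp
    finally show ?thesis .
  qed
  have W: "integrable M (?W N)" for N
    using inc(1)[OF lt] by auto
  have "AE x in M. (\<lambda>N. ?W N x) \<longlonglongrightarrow> 0"
  proof (rule AE_tendsto_0_of_summable_integral[OF W, where c = "\<lambda>N. C * ((real N + 1) * (2 ^ N) powr (- s / 8))"])
    show "0 \<le> ?W N x" for N x by (intro sum_nonneg) auto
    show "integral\<^sup>L M (?W N) \<le> C * ((real N + 1) * (2 ^ N) powr (- s / 8))" for N
    proof -
      have "integral\<^sup>L M (?W N) = (\<Sum>j\<le>N. \<Sum>i<2 ^ (N - j). ?w N j * (\<integral>x. ?Z j i x \<partial>M))"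
        using inc(1)[OF lt] by simp
      also have "\<dots> \<le> (\<Sum>j\<le>N. \<Sum>i<(2::nat) ^ (N - j). ?w N j * (C * (2 ^ j) powr (1 + s)))"
        using inc(2)[OF lt] unfolding len by (intro sum_mono mult_left_mono) auto
      \<comment> \<open>Level \<open>j\<close> has \<open>2 ^ (N - j)\<close> intervals, each of
        moment at most C times the power 1 + s of \<open>2 ^ j\<close>. The weight cancels
        everything except the small gain in \<open>N\<close>, so each of the N + 1 levels
        contributes equally.\<close>
      also have "\<dots> = (\<Sum>j\<le>N. C * (2 ^ N) powr (- s / 8))"
      proof (rule sum.cong[OF refl])
        fix j assume "j \<in> {..N}"
        then have e: "(2::real) ^ (N - j) * 2 ^ j = 2 ^ N" by (simp add: power_add[symmetric])
        have "(\<Sum>i<(2::nat) ^ (N - j). ?w N j * (C * (2 ^ j) powr (1 + s))) = C * (2 ^ (N - j) * 2 ^ j) * (2 ^ j) powr s * ?w N j"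
          by (simp add: powr_add)
        also have "\<dots> = C * (2 ^ N * inverse ((2 ^ N) powr (1 + s / 8)))" unfolding e by simp
        also have "2 ^ N * inverse ((2 ^ N) powr (1 + s / 8)) = (2 ^ N) powr (- s / 8)"
          by (simp add: powr_add powr_minus)
        finally show "(\<Sum>i<(2::nat) ^ (N - j). ?w N j * (C * (2 ^ j) powr (1 + s))) = C * (2 ^ N) powr (- s / 8)" .
      qed
      also have "\<dots> = C * ((real N + 1) * (2 ^ N) powr (- s / 8))" by simp
      finally show ?thesis .
    qed
    have pw: "(2 ^ N) powr (- s / 8) = (2 powr (- s / 8)) ^ N" for N :: nat
      by (simp add: powr_realpow[symmetric] powr_powr mult.commute)
    have "summable (\<lambda>N. (real N + 1) * (2 powr (- s / 8)) ^ N)"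
    proof -
      have x: "\<bar>2 powr (- s / 8)\<bar> < 1" using s by (simp add: powr_less_one)
      have "summable (\<lambda>N. real (Suc N) * (2 powr (- s / 8)) ^ N)"
        using x summable_geometric[of "2 powr (- s / 8)"] termdiff_converges[of "2 powr (- s / 8)" 1 "\<lambda>_. 1"]
        by (simp add: diffs_def)
      then show ?thesis by (simp add: add.commute)
    qed
    then show "summable (\<lambda>N. C * ((real N + 1) * (2 ^ N) powr (- s / 8)))"
      unfolding pw by (rule summable_mult)
  qed
  then show ?thesis
  proof eventually_elim
    case (elim x)
    \<comment> \<open>Of the convergence only boundedness in \<open>N\<close> is kept; the bound is
      the random constant \<open>K\<close>.\<close>
    then have "Bseq (\<lambda>N. ?W N x)" by (intro convergent_imp_Bseq) (auto simp: convergent_def)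
    then obtain K where K: "0 < K" "\<And>N. norm (?W N x) \<le> K" unfolding Bseq_def by blast
    show ?case
    proof (intro exI[of _ K] conjI allI impI K(1))
      fix N j i :: nat assume j: "j \<le> N" and i: "(i + 1) * 2 ^ j \<le> 2 ^ N"
      have "(2::nat) ^ N = 2 ^ (N - j) * 2 ^ j" using j by (simp add: power_add[symmetric])
      with i have "(i + 1) * 2 ^ j \<le> 2 ^ (N - j) * 2 ^ j" by simp
      then have i2: "i < 2 ^ (N - j)" by (simp only: mult_le_cancel2) simp
      have "?w N j * ?Z j i x \<le> (\<Sum>i<2 ^ (N - j). ?w N j * ?Z j i x)"
        using i2 by (intro member_le_sum[where f = "\<lambda>i. ?w N j * ?Z j i x"]) auto
      also have "\<dots> \<le> ?W N x"
        using j by (intro member_le_sum[where f = "\<lambda>j. \<Sum>i<2 ^ (N - j). ?w N j * ?Z j i x"]) (auto intro!: sum_nonneg)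
      also have "\<dots> \<le> K" using K(2)[of N] by simp
      finally show "?Z j i x \<le> K * ((2 ^ N) powr (1 + s / 8) * (2 ^ j) powr s)"
        by (simp add: field_simps)
    qed
  qed
qed

text \<open>Position and length are rounded up to powers of two, and the window is chained through
  dyadic intervals no longer than its rounded length. The number of scales gives the logarithm. The
  exponent \<open>q\<close> undoes the moment: the power (1 + s) q = 1/2 of the squared increment is
  its absolute value.\<close>

lemma window_bound:
  fixes S :: "nat \<Rightarrow> real" and s K :: real
  assumes s: "0 < s" and K: "0 < K"
    and inc: "\<And>N j i. j \<le> N \<Longrightarrow> (i + 1) * 2 ^ j \<le> 2 ^ N \<Longrightarrow>
      ((S ((i + 1) * 2 ^ j) - S (i * 2 ^ j))\<^sup>2) powr (1 + s) \<le> K * ((2 ^ N) powr (1 + s / 8) * (2 ^ j) powr s)"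
  defines "q \<equiv> 1 / (2 * (1 + s))"
  obtains K' where "0 \<le> K'" "\<And>x y a b. 1 \<le> y \<Longrightarrow> y \<le> x \<Longrightarrow> a \<le> b \<Longrightarrow> real b \<le> x \<Longrightarrow> real b \<le> real a + y \<Longrightarrow>
     \<bar>S b - S a\<bar> \<le> K' * (1 + ln x) * (x powr (1 + s / 8) * y powr s) powr q"
proof -
  have q0: "0 < q" using s by (simp add: q_def)
  define K2 where "K2 = (K * 2 powr (1 + s / 8) * 2 powr s) powr q"
  have bound: "\<bar>S b - S a\<bar> \<le> (2 / ln 2 + 3) * K2 * (1 + ln x) * (x powr (1 + s / 8) * y powr s) powr q"
    if xy: "1 \<le> y" "y \<le> x" and ab: "a \<le> b" "real b \<le> x" "real b \<le> real a + y" for x y :: real and a b :: nat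
  proof -
    have ceil: "\<exists>N::nat. z \<le> 2 ^ N \<and> 2 ^ N \<le> 2 * z \<and> real N \<le> log 2 z + 1" if z: "1 \<le> z" for z :: real
    proof -
      define N where "N = nat \<lceil>log 2 z\<rceil>"
      have l0: "0 \<le> log 2 z" using z by simp
      have N: "log 2 z \<le> real N" "real N \<le> log 2 z + 1" using l0 by (auto simp: N_def)
      have "z = 2 powr (log 2 z)" using z by simp
      also have "\<dots> \<le> 2 powr real N" using N by (intro powr_mono) auto
      finally have 1: "z \<le> 2 ^ N" by (simp add: powr_realpow)
      have "2 powr real N \<le> 2 powr (log 2 z + 1)" using N by (intro powr_mono) auto
      also have "\<dots> = 2 * z" using z by (simp add: powr_add)
      finally have "2 ^ N \<le> 2 * z" by (simp add: powr_realpow)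
      with 1 N show ?thesis by blast
    qed
    obtain N where N: "x \<le> 2 ^ N" "2 ^ N \<le> 2 * x" using ceil[of x] xy by auto
    obtain J0 where J0: "y \<le> 2 ^ J0" "2 ^ J0 \<le> 2 * y" "real J0 \<le> log 2 y + 1" using ceil[of y] xy by auto
    \<comment> \<open>The cap keeps all chaining scales within the range of the hypothesis at level
      \<open>N\<close>; as \<open>y \<le> x\<close>, a window of length \<open>y\<close> still fits
      into \<open>2 ^ J\<close>.\<close>
    define J where "J = min J0 N"
    have J: "y \<le> 2 ^ J" "2 ^ J \<le> 2 * y" "real J \<le> log 2 y + 1" "J \<le> N"
    proof -
      show "y \<le> 2 ^ J" using J0(1) N(1) xy by (cases "J0 \<le> N") (auto simp: J_def)
      have "(2::real) ^ J \<le> 2 ^ J0" by (intro power_increasing) (auto simp: J_def)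
      then show "2 ^ J \<le> 2 * y" using J0 by linarith
      show "real J \<le> log 2 y + 1" using J0(3) by (simp add: J_def)
    qed (simp add: J_def)
    define B where "B = K2 * (x powr (1 + s / 8) * y powr s) powr q"
    have B0: "0 \<le> B" by (simp add: B_def K2_def)
    have "\<bar>S b - S a\<bar> \<le> (2 * real J + 1) * B"
    proof (rule dyadic_chain[where n = "2 ^ N"])
      fix j i :: nat assume j: "j \<le> J" and i: "(i + 1) * 2 ^ j \<le> 2 ^ N"
      let ?d = "S ((i + 1) * 2 ^ j) - S (i * 2 ^ j)"
      have "(?d\<^sup>2) powr (1 + s) \<le> K * ((2 ^ N) powr (1 + s / 8) * (2 ^ j) powr s)"
        using inc[of j N i] j i J(4) by simp
      also have "\<dots> \<le> K * ((2 * x) powr (1 + s / 8) * (2 * y) powr s)"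
      proof -
        have "(2::real) ^ j \<le> 2 ^ J" using j by (intro power_increasing) auto
        then have "(2::real) ^ j \<le> 2 * y" using J(2) by linarith
        then show ?thesis using K N(2) s xy by (intro mult_left_mono mult_mono powr_mono2) auto
      qed
      also have "\<dots> = K * 2 powr (1 + s / 8) * 2 powr s * (x powr (1 + s / 8) * y powr s)"
        using xy by (simp add: powr_mult)
      finally have "((?d\<^sup>2) powr (1 + s)) powr q \<le> (K * 2 powr (1 + s / 8) * 2 powr s * (x powr (1 + s / 8) * y powr s)) powr q"
        using q0 by (intro powr_mono2) auto
      also have "\<dots> = B" using K by (simp add: B_def K2_def powr_mult)
      also have "((?d\<^sup>2) powr (1 + s)) powr q = (?d\<^sup>2) powr (1 / 2)"
      proof -
        have "(1 + s) * q = 1 / 2" using s by (simp add: q_def field_simps)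
        then show ?thesis by (simp only: powr_powr)
      qed
      also have "\<dots> = \<bar>?d\<bar>" by (simp add: powr_half_sqrt)
      finally show "\<bar>?d\<bar> \<le> B" .
    next
      have "real b \<le> real (2 ^ N)" unfolding of_nat_power of_nat_numeral using ab N by linarith
      then show "b \<le> 2 ^ N" by (simp only: of_nat_le_iff)
      have "real b \<le> real (a + 2 ^ J)" unfolding of_nat_add of_nat_power of_nat_numeral using ab J by linarith
      then show "b \<le> a + 2 ^ J" by (simp only: of_nat_le_iff)
    qed (use B0 ab in auto)
    also have "\<dots> \<le> ((2 / ln 2 + 3) * (1 + ln x)) * B"
    proof (rule mult_right_mono[OF _ B0])
      have lxy: "ln y \<le> ln x" "0 \<le> ln x" using xy by auto
      have "2 * real J + 1 \<le> 2 * (log 2 x + 1) + 1"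
      proof -
        have "log 2 y + 1 \<le> log 2 x + 1" using xy by simp
        then have "real J \<le> log 2 x + 1" using J(3) by (rule order_trans[rotated])
        then show ?thesis by (simp only: mult_le_cancel_left_pos zero_less_numeral add_le_cancel_right)
      qed
      also have "\<dots> = 2 / ln 2 * ln x + 3" by (simp add: log_def)
      also have "\<dots> \<le> (2 / ln 2 + 3) * (1 + ln x)"
      proof -
        have "c * l + 3 \<le> (c + 3) * (1 + l)" if "0 \<le> c" "0 \<le> l" for c l :: real
          using that by (simp add: algebra_simps)
        from this[of "2 / ln 2" "ln x"] show ?thesis using lxy by simp
      qed
      finally show "2 * real J + 1 \<le> (2 / ln 2 + 3) * (1 + ln x)" .
    qed
    finally show ?thesis by (simp add: B_def mult_ac)
  qed
  show ?thesis
  proof (rule that)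
    show "0 \<le> (2 / ln 2 + 3) * K2" by (simp add: K2_def)
  qed (rule bound)
qed

section \<open>The walk in a fixed environment\<close>

abbreviation path_space :: "(nat \<Rightarrow> int) measure" where
  "path_space \<equiv> PiM UNIV (\<lambda>_. count_space UNIV)"

definition cylinder :: "nat \<Rightarrow> (nat \<Rightarrow> int) \<Rightarrow> (nat \<Rightarrow> int) set" where
  "cylinder n y = {x. \<forall>i\<in>{0..<n}. x i = y i}"

lemma space_path_space: "space path_space = UNIV"
  by (simp add: space_PiM)

lemma measurable_coordinate [measurable]: "(\<lambda>x. x i) \<in> path_space \<rightarrow>\<^sub>M count_space UNIV"
  by (rule measurable_component_singleton) simp

lemma sets_cylinder: "cylinder n y \<in> sets path_space"
proof -
  have "{x \<in> space path_space. \<forall>i\<in>{0..<n}. x i = y i} \<in> sets path_space" by measurable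
  then show ?thesis by (simp add: cylinder_def space_path_space)
qed

lemma sets_path_pred: "Measurable.pred path_space Q \<Longrightarrow> {x. Q x} \<in> sets path_space"
  using measurable_sets[of Q path_space "count_space UNIV" "{True}"]
  by (simp add: space_path_space vimage_def)

text \<open>Two cylinders with a common point \<open>x\<close> are both cylinders around
  \<open>x\<close>, so the one fixing more coordinates is their intersection. The empty set is
  included for the disjoint case.\<close>

lemma Int_stable_cylinder: "Int_stable (insert {} (range (\<lambda>(n, y). cylinder n y)))"
proof (rule Int_stableI)
  fix A B assume AB: "A \<in> insert {} (range (\<lambda>(n, y). cylinder n y))" "B \<in> insert {} (range (\<lambda>(n, y). cylinder n y))"
  show "A \<inter> B \<in> insert {} (range (\<lambda>(n, y). cylinder n y))"
  proof (cases "A \<inter> B = {}")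
    case False
    then obtain x where x: "x \<in> A" "x \<in> B" by auto
    from AB x obtain n y m y' where "A = cylinder n y" "B = cylinder m y'" by auto
    then have "A = cylinder n x" "B = cylinder m x" using x by (auto simp: cylinder_def)
    then have "A \<inter> B = cylinder (max n m) x" by (auto simp: cylinder_def less_max_iff_disj)
    then show ?thesis by (metis case_prod_conv insertCI rangeI)
  qed simp
qed

text \<open>The event that coordinate \<open>i\<close> has a given value is a union of cylinders
  over the possible histories before time \<open>i\<close>. These are lists of integers of length
  \<open>i\<close>, hence countably many.\<close>

lemma sets_path_space_eq: "sets path_space = sigma_sets UNIV (insert {} (range (\<lambda>(n, y). cylinder n y)))"
proof
  let ?G = "insert {} (range (\<lambda>(n, y). cylinder n y))"
  have "?G \<subseteq> sets path_space" using sets_cylinder by auto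
  then show "sigma_sets UNIV ?G \<subseteq> sets path_space"
    using sets.sigma_sets_subset[of ?G path_space] by (simp add: space_path_space)
  let ?N = "sigma UNIV ?G"
  have cyl: "cylinder n y \<in> sets ?N" for n y by (auto intro!: sigma_sets.Basic)
  have coord: "(\<lambda>x. x i) \<in> ?N \<rightarrow>\<^sub>M count_space UNIV" for i
  proof (subst measurable_count_space_eq2_countable, safe)
    fix v :: int
    have "(\<lambda>x. x i) -` {v} \<inter> space ?N = (\<Union>l\<in>{l. length l = i}. cylinder (Suc i) (\<lambda>j. (l @ [v]) ! j))"
    proof safe
      fix x assume "v = x i"
      show "x \<in> (\<Union>l\<in>{l. length l = i}. cylinder (Suc i) (\<lambda>j. (l @ [x i]) ! j))"
        by (rule UN_I[of "map x [0..<i]"]) (auto simp: cylinder_def nth_append less_Suc_eq)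
    qed (auto simp: cylinder_def nth_append)
    also have "\<dots> \<in> sets ?N" by (intro sets.countable_UN'' cyl) auto
    finally show "(\<lambda>x. x i) -` {v} \<inter> space ?N \<in> sets ?N" .
  qed auto
  have "(\<lambda>x. x) \<in> ?N \<rightarrow>\<^sub>M path_space"
    using measurable_PiM_single'[of UNIV "\<lambda>i x. x i" ?N "\<lambda>_. count_space UNIV"] coord by (auto simp: space_PiM)
  then show "sets path_space \<subseteq> sigma_sets UNIV ?G"
    using measurable_sets[of "\<lambda>x. x" ?N path_space] by auto
qed

lemma measurable_case_nat_path: "case_nat z \<in> path_space \<rightarrow>\<^sub>M path_space"
proof -
  have "(\<lambda>x i. case_nat z x i) \<in> path_space \<rightarrow>\<^sub>M path_space"
  proof (rule measurable_PiM_single')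
    fix i :: nat show "(\<lambda>x. case_nat z x i) \<in> path_space \<rightarrow>\<^sub>M count_space UNIV"
      by (cases i) auto
  qed (auto simp: space_PiM)
  then show ?thesis by simp
qed

lemma pmf_walk_kernel_Suc:
  assumes "0 < a (y n)" "a (y n) < 1"
  shows "pmf (walk_kernel a z (Suc n) y) v = (if v = y n + 1 then a (y n) else if v = y n - 1 then 1 - a (y n) else 0)"
  using assms by (auto simp: walk_kernel_def map_pmf_def pmf_bind pmf_return indicator_def)

locale walk_env =
  fixes a :: "int \<Rightarrow> real"
  assumes a_pos: "0 < a k" and a_less_1: "a k < 1"
begin

abbreviation "law \<equiv> quenched_law a"

sublocale law: prob_space "quenched_law a z" for z by (rule prob_space_quenched_law)

text \<open>\<open>case_nat z x\<close> is the path \<open>x\<close> preceded by the starting point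
  \<open>z\<close>. On cylinders both sides are explicit products of transition probabilities;
  lengths 0 and 1 are separate because no transition is prescribed there.\<close>

lemma first_step_cylinder:
  "emeasure (law z) (cylinder n y) = ennreal (a z) * emeasure (law (z + 1)) {x. case_nat z x \<in> cylinder n y}
     + ennreal (1 - a z) * emeasure (law (z - 1)) {x. case_nat z x \<in> cylinder n y}"
proof (cases n)
  case 0
  have "emeasure (law w) UNIV = 1" for w using law.emeasure_space_1[of w] by (simp add: space_quenched_law)
  then show ?thesis using 0 a_pos[of z] a_less_1[of z]
    by (simp add: cylinder_def ennreal_plus[symmetric] del: ennreal_plus)
next
  case (Suc m)
  have cn: "{x. case_nat z x \<in> cylinder n y} = (if y 0 = z then cylinder m (\<lambda>i. y (Suc i)) else {})"
    unfolding Suc cylinder_def by (auto simp: Ball_def less_Suc_eq_0_disj split: nat.splits)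
  have ker: "pmf (walk_kernel a z' (Suc i) (\<lambda>i. y (Suc i))) v = pmf (walk_kernel a z'' (Suc (Suc i)) y) v" for i v z' z''
    using a_pos a_less_1 by (simp add: pmf_walk_kernel_Suc)
  have k0: "pmf (walk_kernel a z' 0 y') v = (if v = z' then 1 else 0)" for z' y' v
    by (simp add: walk_kernel_def pmf_return)
  show ?thesis
  proof (cases "y 0 = z")
    case False
    then show ?thesis unfolding cn using emeasure_quenched_law_cylinder[of a z n y]
      by (simp add: Suc cylinder_def prod.lessThan_Suc_shift k0 del: prod.lessThan_Suc)
  next
    case True
    show ?thesis
    proof (cases m)
      case 0
      have "emeasure (law w) UNIV = 1" for w using law.emeasure_space_1[of w] by (simp add: space_quenched_law)
      then show ?thesis unfolding cn using emeasure_quenched_law_cylinder[of a z n y] True a_pos[of z] a_less_1[of z]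
        by (simp add: Suc 0 k0 cylinder_def ennreal_plus[symmetric] del: ennreal_plus)
    next
      case (Suc l)
      define R where "R = (\<Prod>i<l. pmf (walk_kernel a z (Suc (Suc i)) y) (y (Suc (Suc i))))"
      have R0: "0 \<le> R" by (simp add: R_def prod_nonneg)
      have L: "emeasure (law z) (cylinder n y) = ennreal (pmf (walk_kernel a z (Suc 0) y) (y 1) * R)"
        using emeasure_quenched_law_cylinder[of a z n y]
        by (simp add: \<open>n = Suc m\<close> Suc cylinder_def prod.lessThan_Suc_shift k0 True R_def del: prod.lessThan_Suc)
      have W: "emeasure (law w) (cylinder m (\<lambda>i. y (Suc i))) = ennreal ((if y 1 = w then 1 else 0) * R)" for w
        using emeasure_quenched_law_cylinder[of a w m "\<lambda>i. y (Suc i)"]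
        by (simp add: Suc cylinder_def prod.lessThan_Suc_shift k0 ker[of _ _ _ z] R_def del: prod.lessThan_Suc)
      show ?thesis unfolding cn L using True a_pos[of z] a_less_1[of z] R0
        by (auto simp: W pmf_walk_kernel_Suc ennreal_mult)
    qed
  qed
qed

text \<open>The law from \<open>z\<close> and the mixture of the two prefixed laws agree on the
  intersection-stable generator of cylinders, hence on all events. This is the only form in which
  the Markov property enters.\<close>

lemma first_step_emeasure:
  assumes E: "E \<in> sets path_space"
  shows "emeasure (law z) E = ennreal (a z) * emeasure (law (z + 1)) {x. case_nat z x \<in> E}
     + ennreal (1 - a z) * emeasure (law (z - 1)) {x. case_nat z x \<in> E}"
proof -
  let ?K = "\<lambda>r. distr (law (if r then z + 1 else z - 1)) path_space (case_nat z)"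
  define N where "N = measure_pmf (bernoulli_pmf (a z)) \<bind> ?K"
  have cm: "case_nat z \<in> law w \<rightarrow>\<^sub>M path_space" for w
    using measurable_case_nat_path by (simp add: measurable_cong_sets[OF sets_quenched_law refl])
  have K: "?K \<in> measure_pmf (bernoulli_pmf (a z)) \<rightarrow>\<^sub>M subprob_algebra path_space"
    using law.prob_space_distr[OF cm] by (auto simp: space_subprob_algebra intro: prob_space_imp_subprob_space)
  have setsN: "sets N = sets path_space" unfolding N_def by (rule sets_bind) (auto simp: K)
  have N: "emeasure N E = ennreal (a z) * emeasure (law (z + 1)) {x. case_nat z x \<in> E}
     + ennreal (1 - a z) * emeasure (law (z - 1)) {x. case_nat z x \<in> E}" if "E \<in> sets path_space" for E
  proof -
    have KE: "emeasure (?K r) E = emeasure (law (if r then z + 1 else z - 1)) {x. case_nat z x \<in> E}" for r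
      using that cm by (simp add: emeasure_distr space_quenched_law vimage_def)
    have "emeasure N E = (\<integral>\<^sup>+r. emeasure (?K r) E \<partial>bernoulli_pmf (a z))"
      unfolding N_def by (rule emeasure_bind[OF _ K that]) simp
    also have "\<dots> = emeasure (?K True) E * ennreal (a z) + emeasure (?K False) E * ennreal (1 - a z)"
      using a_pos[of z] a_less_1[of z] by (subst nn_integral_bernoulli_pmf) auto
    finally show ?thesis unfolding KE by (simp add: mult.commute)
  qed
  have "law z = N"
  proof (rule measure_eqI_generator_eq[OF Int_stable_cylinder, where \<Omega> = UNIV and A = "\<lambda>_. cylinder 0 (\<lambda>_. 0)"])
    show "sets (law z) = sigma_sets UNIV (insert {} (range (\<lambda>(n, y). cylinder n y)))"
      "sets N = sigma_sets UNIV (insert {} (range (\<lambda>(n, y). cylinder n y)))"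
      by (simp_all only: setsN sets_quenched_law sets_path_space_eq)
    show "emeasure (law z) X = emeasure N X" if "X \<in> insert {} (range (\<lambda>(n, y). cylinder n y))" for X
      using that first_step_cylinder N[OF sets_cylinder] by auto
    show "range (\<lambda>_::nat. cylinder 0 (\<lambda>_. 0)) \<subseteq> insert {} (range (\<lambda>(n, y). cylinder n y))"
      by (auto intro!: image_eqI[where x = "(0, \<lambda>_. 0)"])
  qed (simp_all add: cylinder_def)
  then show ?thesis using N[OF E] by simp
qed

lemma first_step_prob:
  assumes E: "{x. Q x} \<in> sets path_space"
  shows "measure (law z) {x. Q x} = a z * measure (law (z + 1)) {x. Q (case_nat z x)}
     + (1 - a z) * measure (law (z - 1)) {x. Q (case_nat z x)}"
  using first_step_emeasure[OF E, of z] a_pos[of z] a_less_1[of z]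
  by (simp add: law.emeasure_eq_measure ennreal_mult[symmetric] ennreal_plus[symmetric] del: ennreal_plus)

lemma prob_start: "measure (law z) {x. Q (x 0)} = (if Q z then 1 else 0)"
proof -
  have "measure (law z) (cylinder 1 (\<lambda>_. z)) = 1"
    using emeasure_quenched_law_cylinder[of a z 1 "\<lambda>_. z"]
    by (simp add: cylinder_def walk_kernel_def pmf_return law.emeasure_eq_measure)
  then have "AE x in law z. x \<in> cylinder 1 (\<lambda>_. z)"
    using sets_cylinder by (subst law.AE_in_set_eq_1) (simp_all add: sets_quenched_law)
  then have AE: "AE x in law z. x 0 = z" by (auto simp: cylinder_def)
  have sets: "{x. Q (x 0)} \<in> sets (law z)"
  proof -
    have "{x \<in> space path_space. Q (x 0)} \<in> sets path_space" by measurable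
    then show ?thesis by (simp add: space_path_space sets_quenched_law)
  qed
  show ?thesis
  proof (cases "Q z")
    case True
    then have "AE x in law z. x \<in> {x. Q (x 0)}" using AE by auto
    then show ?thesis using True law.AE_in_set_eq_1[OF sets] by simp
  next
    case False
    then have "AE x in law z. x \<notin> {x. Q (x 0)}" using AE by auto
    then show ?thesis using False law.prob_eq_0[OF sets] by simp
  qed
qed

end

section \<open>First-passage and survival probabilities by first-step recursion\<close>

fun first_passage :: "(int \<Rightarrow> real) \<Rightarrow> nat \<Rightarrow> int \<Rightarrow> int \<Rightarrow> real" where
  "first_passage a 0 z y = (if z = y then 1 else 0)"
| "first_passage a (Suc t) z y =
     (if z = y then 0 else a z * first_passage a t (z + 1) y + (1 - a z) * first_passage a t (z - 1) y)"

text \<open>The probability that \<open>y\<close> is not visited up to and including time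
  \<open>t\<close>, the starting time being counted; \<open>survival_eq\<close> relates it to
  \<open>first_passage\<close>. Its own recursion has the first-step form needed for comparisons by
  induction on time.\<close>

fun survival :: "(int \<Rightarrow> real) \<Rightarrow> nat \<Rightarrow> int \<Rightarrow> int \<Rightarrow> real" where
  "survival a 0 z y = (if z = y then 0 else 1)"
| "survival a (Suc t) z y =
     (if z = y then 0 else a z * survival a t (z + 1) y + (1 - a z) * survival a t (z - 1) y)"

lemma first_passage_shift: "first_passage (\<lambda>i. a (i + c)) t z y = first_passage a t (z + c) (y + c)"
  by (induction t arbitrary: z) (auto simp: algebra_simps)

lemma survival_eq: "survival a t z y = 1 - (\<Sum>s\<le>t. first_passage a s z y)"
proof (induction t arbitrary: z)
  case (Suc t)
  show ?case
  proof (cases "z = y")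
    case True
    have "(\<Sum>s\<le>Suc t. first_passage a s y y) = 1" for t
      by (subst sum.atMost_Suc_shift) simp
    then show ?thesis using True by simp
  next
    case False
    have "(\<Sum>s\<le>Suc t. first_passage a s z y) =
       (\<Sum>s\<le>t. a z * first_passage a s (z + 1) y + (1 - a z) * first_passage a s (z - 1) y)"
      using False by (subst sum.atMost_Suc_shift) simp
    also have "\<dots> = a z * (\<Sum>s\<le>t. first_passage a s (z + 1) y) + (1 - a z) * (\<Sum>s\<le>t. first_passage a s (z - 1) y)"
      by (simp add: sum.distrib sum_distrib_left)
    finally show ?thesis using False by (simp add: Suc algebra_simps)
  qed
qed simp

text \<open>A nearest-neighbour path from \<open>z\<close> to \<open>y\<close> has to pass through
  the intermediate site \<open>n\<close>. The identity is the strong Markov property at the first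
  visit to \<open>n\<close>, obtained by induction on time: from \<open>z < n\<close> the first step
  stays at or below \<open>n\<close>, and for \<open>z = n\<close> only the term
  \<open>s = 0\<close> survives.\<close>

lemma first_passage_convolution:
  assumes "z \<le> n" "n \<le> y"
  shows "first_passage a t z y = (\<Sum>s\<le>t. first_passage a s z n * first_passage a (t - s) n y)"
  using assms(1)
proof (induction t arbitrary: z)
  case 0
  then show ?case using assms(2) by auto
next
  case (Suc t)
  show ?case
  proof (cases "z = n")
    case True
    have "(\<Sum>s\<le>Suc t. first_passage a s n n * first_passage a (Suc t - s) n y) = first_passage a (Suc t) n y"
      by (subst sum.atMost_Suc_shift) simp
    then show ?thesis using True by simp
  next
    case False
    then have z: "z < n" using Suc.prems by simp
    have "(\<Sum>s\<le>Suc t. first_passage a s z n * first_passage a (Suc t - s) n y) =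
       (\<Sum>s\<le>t. (a z * first_passage a s (z + 1) n + (1 - a z) * first_passage a s (z - 1) n) * first_passage a (t - s) n y)"
      using False by (subst sum.atMost_Suc_shift) simp
    also have "\<dots> = a z * (\<Sum>s\<le>t. first_passage a s (z + 1) n * first_passage a (t - s) n y)
        + (1 - a z) * (\<Sum>s\<le>t. first_passage a s (z - 1) n * first_passage a (t - s) n y)"
      by (simp only: distrib_right sum.distrib sum_distrib_left mult.assoc)
    also have "\<dots> = first_passage a (Suc t) z y"
      using Suc.IH[of "z + 1"] Suc.IH[of "z - 1"] z assms(2) by simp
    finally show ?thesis by simp
  qed
qed

context walk_env
begin

lemma first_passage_nonneg: "0 \<le> first_passage a t z y"
  using a_pos a_less_1 by (induction t arbitrary: z) (auto intro!: add_nonneg_nonneg mult_nonneg_nonneg simp: less_imp_le)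

lemma survival_nonneg: "0 \<le> survival a t z y"
  using a_pos a_less_1 by (induction t arbitrary: z) (auto intro!: add_nonneg_nonneg mult_nonneg_nonneg simp: less_imp_le)

lemma sum_first_passage_le_1: "(\<Sum>s\<le>t. first_passage a s z y) \<le> 1"
  using survival_nonneg[of t z y] by (simp add: survival_eq)

lemma summable_first_passage: "summable (\<lambda>t. first_passage a t z y)"
  by (rule bounded_imp_summable[OF first_passage_nonneg sum_first_passage_le_1])

lemma prob_first_passage: "measure (law z) {x. (\<forall>s<t. x s \<noteq> y) \<and> x t = y} = first_passage a t z y"
proof (induction t arbitrary: z)
  case 0
  then show ?case using prob_start[of z "\<lambda>v. v = y"] by simp
next
  case (Suc t)
  have "{x. (\<forall>s<Suc t. x s \<noteq> y) \<and> x (Suc t) = y} \<in> sets path_space"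
    by (rule sets_path_pred) measurable
  from first_step_prob[OF this, of z]
  have "measure (law z) {x. (\<forall>s<Suc t. x s \<noteq> y) \<and> x (Suc t) = y} =
    a z * measure (law (z + 1)) {x. z \<noteq> y \<and> (\<forall>s<t. x s \<noteq> y) \<and> x t = y}
    + (1 - a z) * measure (law (z - 1)) {x. z \<noteq> y \<and> (\<forall>s<t. x s \<noteq> y) \<and> x t = y}"
    by (simp add: All_less_Suc2 conj_assoc)
  then show ?case using Suc by (cases "z = y") auto
qed

lemma prob_position_0: "measure (law z) {x. x 0 \<le> w} = (if z \<le> w then 1 else 0)"
  using prob_start[of z "\<lambda>v. v \<le> w"] by simp

lemma prob_position_Suc:
  "measure (law z) {x. x (Suc t) \<le> w} = a z * measure (law (z + 1)) {x. x t \<le> w} + (1 - a z) * measure (law (z - 1)) {x. x t \<le> w}"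
proof -
  have "{x. x (Suc t) \<le> w} \<in> sets path_space" by (rule sets_path_pred) measurable
  from first_step_prob[OF this, of z] show ?thesis by simp
qed

text \<open>A walk that starts at or below \<open>w + 1\<close> and has not visited
  \<open>w + 1\<close> is still at or below \<open>w\<close>, since it cannot jump over a
  site.\<close>

lemma survival_le_prob_position: "z \<le> w + 1 \<Longrightarrow> survival a t z (w + 1) \<le> measure (law z) {x. x t \<le> w}"
proof (induction t arbitrary: z)
  case 0
  then show ?case using prob_position_0[of z w] by auto
next
  case (Suc t)
  show ?case
  proof (cases "z = w + 1")
    case False
    then have "z + 1 \<le> w + 1" "z - 1 \<le> w + 1" using Suc.prems by auto
    then show ?thesis unfolding prob_position_Suc using False Suc.IH a_pos[of z] a_less_1[of z]
      by (auto intro!: add_mono mult_left_mono)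
  qed simp
qed

end

text \<open>The gambler's ruin function of the walk to the right of \<open>w\<close>, without
  normalisation: it is harmonic in \<open>n\<close> for \<open>n > w\<close>, decreases in
  \<open>n\<close>, and is at least 1 at \<open>n = w\<close>, where the first product is empty. The
  chance of ever falling back from \<open>n\<close> to \<open>w\<close> is therefore at most its
  value at \<open>n\<close>.\<close>

definition ladder_tail :: "(int \<Rightarrow> real) \<Rightarrow> int \<Rightarrow> int \<Rightarrow> real" where
  "ladder_tail a w n = (\<Sum>j. \<Prod>i\<in>{w + 1..n + int j}. odds a i)"

context walk_env
begin

lemma odds_pos: "0 < odds a k"
  using a_pos[of k] a_less_1[of k] by (simp add: odds_def)

lemma odds_mult: "a k * odds a k = 1 - a k"
  using a_pos[of k] by (simp add: odds_def)

lemma ladder_tail_nonneg: "summable (\<lambda>j. \<Prod>i\<in>{w + 1..n + int j}. odds a i) \<Longrightarrow> 0 \<le> ladder_tail a w n"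
  unfolding ladder_tail_def by (rule suminf_nonneg) (auto intro!: prod_nonneg simp: less_imp_le odds_pos)

lemma summable_ladder_shift:
  assumes "summable (\<lambda>j. \<Prod>i\<in>{w + 1..w + int j}. odds a i)" "w \<le> n"
  shows "summable (\<lambda>j. \<Prod>i\<in>{w + 1..n + int j}. odds a i)"
proof -
  have "summable (\<lambda>j. \<Prod>i\<in>{w + 1..w + int (j + nat (n - w))}. odds a i)"
    using assms(1) by (rule summable_ignore_initial_segment)
  then show ?thesis using assms(2) by (simp add: algebra_simps)
qed

lemma ladder_tail_step:
  assumes "summable (\<lambda>j. \<Prod>i\<in>{w + 1..w + int j}. odds a i)" "w \<le> n"
  shows "ladder_tail a w n = (\<Prod>i\<in>{w + 1..n}. odds a i) + ladder_tail a w (n + 1)"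
  using suminf_split_head[OF summable_ladder_shift[OF assms]]
  unfolding ladder_tail_def by (simp add: add_ac)

text \<open>Comparison with a harmonic majorant, by induction on time. At \<open>z = w\<close> the
  value of the majorant is at least 1 and the bound is trivial; at \<open>z > w\<close> the defect
  of harmonicity vanishes because \<open>a z * odds a z = 1 - a z\<close>.\<close>

lemma prob_position_le_ladder:
  assumes sm: "summable (\<lambda>j. \<Prod>i\<in>{w + 1..w + int j}. odds a i)" and z: "w \<le> z"
  shows "measure (law z) {x. x t \<le> w} \<le> ladder_tail a w z"
  using z
proof (induction t arbitrary: z)
  case 0
  have "1 \<le> ladder_tail a w w"
    using ladder_tail_step[OF sm order_refl] ladder_tail_nonneg[OF summable_ladder_shift[OF sm, of "w + 1"]] by simp
  then show ?case using 0 ladder_tail_nonneg[OF summable_ladder_shift[OF sm, of z]]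
    by (auto simp: prob_position_0)
next
  case (Suc t)
  show ?case
  proof (cases "z = w")
    case True
    have "measure (law z) {x. x (Suc t) \<le> w} \<le> 1" by simp
    also have "1 \<le> ladder_tail a w w"
      using ladder_tail_step[OF sm order_refl] ladder_tail_nonneg[OF summable_ladder_shift[OF sm, of "w + 1"]] by simp
    finally show ?thesis using True by simp
  next
    case False
    then have z: "w \<le> z - 1" "w \<le> z" "w \<le> z + 1" using Suc.prems by auto
    let ?P = "\<Prod>i\<in>{w + 1..z - 1}. odds a i"
    have set: "{w + 1..z} = insert z {w + 1..z - 1}" using z by auto
    have P: "(\<Prod>i\<in>{w + 1..z}. odds a i) = odds a z * ?P" unfolding set by (subst prod.insert) auto
    have L: "ladder_tail a w (z - 1) = ?P + ladder_tail a w z" "ladder_tail a w z = odds a z * ?P + ladder_tail a w (z + 1)"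
      using ladder_tail_step[OF sm z(1)] ladder_tail_step[OF sm z(2)] P by auto
    have "measure (law z) {x. x (Suc t) \<le> w} \<le> a z * ladder_tail a w (z + 1) + (1 - a z) * ladder_tail a w (z - 1)"
      unfolding prob_position_Suc using Suc.IH[OF z(1)] Suc.IH[OF z(3)] a_pos[of z] a_less_1[of z]
      by (intro add_mono mult_left_mono) auto
    also have "\<dots> = ladder_tail a w z + ((1 - a z) - a z * odds a z) * ?P"
      using L by (simp add: algebra_simps)
    also have "\<dots> = ladder_tail a w z" by (simp add: odds_mult)
    finally show ?thesis .
  qed
qed

text \<open>A walk at or below \<open>w\<close> at time \<open>t\<close> either has not reached
  \<open>n\<close> yet, or has fallen back from \<open>n\<close> to \<open>w\<close>. The induction
  stops at \<open>z = n\<close>, where the harmonic bound applies with the remaining time.\<close>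

lemma prob_position_le_survival:
  assumes sm: "summable (\<lambda>j. \<Prod>i\<in>{w + 1..w + int j}. odds a i)" and n: "w \<le> n" and z: "z \<le> n"
  shows "measure (law z) {x. x t \<le> w} \<le> survival a t z n + ladder_tail a w n"
  using z
proof (induction t arbitrary: z)
  have L0: "0 \<le> ladder_tail a w n" by (rule ladder_tail_nonneg[OF summable_ladder_shift[OF sm n]])
  case 0
  show ?case using L0 prob_position_le_ladder[OF sm n, of 0] by (cases "z = n") (auto simp: prob_position_0)
next
  case (Suc t)
  show ?case
  proof (cases "z = n")
    case True
    then show ?thesis using prob_position_le_ladder[OF sm n, of "Suc t"] by simp
  next
    case False
    then have z: "z + 1 \<le> n" "z - 1 \<le> n" using Suc.prems by auto
    have "measure (law z) {x. x (Suc t) \<le> w} \<le> a z * (survival a t (z + 1) n + ladder_tail a w n)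
       + (1 - a z) * (survival a t (z - 1) n + ladder_tail a w n)"
      unfolding prob_position_Suc using Suc.IH[OF z(1)] Suc.IH[OF z(2)] a_pos[of z] a_less_1[of z]
      by (intro add_mono mult_left_mono) auto
    also have "\<dots> = survival a (Suc t) z n + ladder_tail a w n" using False by (simp add: algebra_simps)
    finally show ?thesis .
  qed
qed

end

section \<open>Hitting times and their moments\<close>

lemma sums_expectation_nat_pmf:
  fixes f :: "nat \<Rightarrow> 'b::{banach, second_countable_topology}"
  assumes "summable (\<lambda>t. norm (pmf p t *\<^sub>R f t))"
  shows "integrable (measure_pmf p) f" "(\<lambda>t. pmf p t *\<^sub>R f t) sums measure_pmf.expectation p f"
proof -
  have i: "integrable (count_space UNIV) (\<lambda>t. pmf p t *\<^sub>R f t)"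
    using assms by (simp add: integrable_count_space_nat_iff)
  then show "integrable (measure_pmf p) f"
    by (subst measure_pmf_eq_density, subst integrable_density) auto
  have "measure_pmf.expectation p f = integral\<^sup>L (count_space UNIV) (\<lambda>t. pmf p t *\<^sub>R f t)"
    by (subst measure_pmf_eq_density, subst integral_density) auto
  then show "(\<lambda>t. pmf p t *\<^sub>R f t) sums measure_pmf.expectation p f"
    using sums_integral_count_space_nat[OF i] by simp
qed

lemma first_visit_unique:
  fixes s t :: nat
  assumes "(\<forall>r<s. x r \<noteq> y) \<and> x s = y" "(\<forall>r<t. x r \<noteq> y) \<and> x t = y"
  shows "s = t"
  using assms by (metis linorder_neqE_nat)

text \<open>The law of \<open>hitting_time\<close> itself, so it includes the default value given to
  paths that never visit \<open>y\<close>. As a distribution on the naturals it turns expectations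
  into series.\<close>

definition hit_pmf :: "(int \<Rightarrow> real) \<Rightarrow> int \<Rightarrow> int \<Rightarrow> nat pmf" where
  "hit_pmf a z y = embed_pmf (\<lambda>t. measure (quenched_law a z) {x. hitting_time x y = t})"

lemma measurable_hitting_time: "(\<lambda>x. hitting_time x y) \<in> path_space \<rightarrow>\<^sub>M count_space UNIV"
  unfolding hitting_time_def by measurable

lemma measurable_hitting_time_law: "(\<lambda>x. hitting_time x y) \<in> quenched_law a z \<rightarrow>\<^sub>M count_space UNIV"
  using measurable_hitting_time by (simp add: measurable_cong_sets[OF sets_quenched_law refl])

lemma sets_hitting_time: "{x. hitting_time x y = t} \<in> sets (quenched_law a z)"
  using measurable_sets[OF measurable_hitting_time_law[of y a z], of "{t}"]
  by (simp add: space_quenched_law vimage_def)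

lemma pmf_hit_pmf: "pmf (hit_pmf a z y) t = measure (quenched_law a z) {x. hitting_time x y = t}"
  unfolding hit_pmf_def
proof (rule pmf_embed_pmf)
  interpret prob_space "quenched_law a z" by (rule prob_space_quenched_law)
  have "(\<integral>\<^sup>+t. ennreal (prob {x. hitting_time x y = t}) \<partial>count_space UNIV) = (\<Sum>t. emeasure (quenched_law a z) {x. hitting_time x y = t})"
    by (simp add: nn_integral_count_space_nat emeasure_eq_measure)
  also have "\<dots> = emeasure (quenched_law a z) (\<Union>t. {x. hitting_time x y = t})"
    by (rule suminf_emeasure) (auto simp: sets_hitting_time disjoint_family_on_def)
  also have "(\<Union>t. {x. hitting_time x y = t}) = space (quenched_law a z)" by (auto simp: space_quenched_law)
  finally show "(\<integral>\<^sup>+t. ennreal (prob {x. hitting_time x y = t}) \<partial>count_space UNIV) = 1"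
    using emeasure_space_1 by simp
qed simp

lemma distr_hitting_time: "distr (quenched_law a z) (count_space UNIV) (\<lambda>x. hitting_time x y) = measure_pmf (hit_pmf a z y)"
proof (rule measure_eqI_countable[of _ UNIV])
  interpret prob_space "quenched_law a z" by (rule prob_space_quenched_law)
  show "emeasure (distr (quenched_law a z) (count_space UNIV) (\<lambda>x. hitting_time x y)) {t} = emeasure (hit_pmf a z y) {t}" for t
    by (subst emeasure_distr[OF measurable_hitting_time_law])
      (auto simp: emeasure_pmf_single pmf_hit_pmf space_quenched_law vimage_def emeasure_eq_measure)
qed auto

lemma var_tau_eq: "var_tau a k = measure_pmf.variance (hit_pmf a k (k + 1)) real"
proof -
  have e: "(\<integral>x. f (hitting_time x y) \<partial>quenched_law a z) = measure_pmf.expectation (hit_pmf a z y) f" for f :: "nat \<Rightarrow> real" and y z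
    using integral_distr[OF measurable_hitting_time_law[of y a z], of f] by (simp add: distr_hitting_time)
  show ?thesis unfolding var_tau_def e[where f = real]
    by (rule e[where f = "\<lambda>t. (real t - c)\<^sup>2" for c])
qed

text \<open>The truncated second moment of Lindeberg's condition, with a fixed threshold
  \<open>K\<close> in place of one growing with the number of summands. For a fixed threshold it is
  a stationary function of the site, so ergodic averages apply to it.\<close>

definition trunc_var :: "(int \<Rightarrow> real) \<Rightarrow> real \<Rightarrow> int \<Rightarrow> real" where
  "trunc_var a K k = measure_pmf.expectation (hit_pmf a k (k + 1))
     (\<lambda>t. (real t - mu_env a k)\<^sup>2 * indicator {t. K < \<bar>real t - mu_env a k\<bar>} t)"

context walk_env
begin

text \<open>Paths that never visit \<open>y\<close> all receive the value
  \<open>LEAST t. False\<close>, so their total mass is added there. In this form the law is an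
  explicit function of the first-passage probabilities for every environment, transient or not,
  which is what shift invariance and measurability rely on.\<close>

lemma pmf_hit_pmf_eq:
  "pmf (hit_pmf a z y) t = first_passage a t z y
     + (if t = (LEAST t. False) then 1 - (\<Sum>t. first_passage a t z y) else 0)"
proof -
  let ?F = "\<lambda>t::nat. {x. (\<forall>s<t. x s \<noteq> y) \<and> x t = y}" and ?N = "{x. \<forall>t::nat. x t \<noteq> y}"
  have F: "?F t \<in> sets (law z)" for t
    unfolding sets_quenched_law by (rule sets_path_pred) measurable
  have N: "?N \<in> sets (law z)"
    unfolding sets_quenched_law by (rule sets_path_pred) measurable
  have ex: "\<exists>t. (\<forall>s<t. x s \<noteq> y) \<and> x t = y" if "x t = y" for x :: "nat \<Rightarrow> int" and t
    using exists_least_iff[of "\<lambda>t. x t = y"] that by auto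
  have "?F s \<inter> ?F t = {}" if "s \<noteq> t" for s t
  proof (rule ccontr)
    assume "?F s \<inter> ?F t \<noteq> {}"
    then obtain x where "x \<in> ?F s" "x \<in> ?F t" by blast
    then have "s = t" using first_visit_unique[of s x y t] by simp
    with that show False by simp
  qed
  then have dj: "disjoint_family ?F" by (auto simp: disjoint_family_on_def)
  have "(\<lambda>t. measure (law z) (?F t)) sums measure (law z) (\<Union>t. ?F t)"
    by (rule law.finite_measure_UNION) (use F dj in auto)
  then have "measure (law z) (\<Union>t. ?F t) = (\<Sum>t. first_passage a t z y)"
    by (simp add: prob_first_passage sums_iff)
  moreover have "?N = space (law z) - (\<Union>t. ?F t)" using ex by (auto simp: space_quenched_law)
  ultimately have pN: "measure (law z) ?N = 1 - (\<Sum>t. first_passage a t z y)"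
    using law.prob_compl[of "\<Union>t. ?F t" z] F by auto
  have H: "hitting_time x y = t \<longleftrightarrow> x \<in> ?F t \<or> (x \<in> ?N \<and> t = (LEAST t. False))" for x
  proof (cases "\<exists>s. x s = y")
    case True
    then obtain s where s: "(\<forall>r<s. x r \<noteq> y) \<and> x s = y" using ex by blast
    then have "hitting_time x y = s" unfolding hitting_time_def by (metis (mono_tags, lifting) Least_equality linorder_not_less)
    moreover have "x \<in> ?F t \<longleftrightarrow> s = t" using s first_visit_unique[OF s, of t] by blast
    moreover have "x \<notin> ?N" using s by blast
    ultimately show ?thesis by blast
  next
    case False
    then show ?thesis by (auto simp: hitting_time_def)
  qed
  show ?thesis
  proof (cases "t = (LEAST t. False)")
    case True
    then have "{x. hitting_time x y = t} = ?F t \<union> ?N" using H by auto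
    moreover have "?F t \<inter> ?N = {}" by auto
    ultimately show ?thesis using True law.finite_measure_Union[OF F[of t] N]
      by (simp add: pmf_hit_pmf pN prob_first_passage)
  next
    case False
    then have "{x. hitting_time x y = t} = ?F t" using H by auto
    then show ?thesis using False by (simp add: pmf_hit_pmf prob_first_passage)
  qed
qed

end

section \<open>Means and second moments of the crossing times\<close>

locale summable_env = walk_env +
  assumes mu_summable: "summable (\<lambda>j. \<Prod>i\<in>{k - int j..k}. odds a i)"
begin

abbreviation "mu \<equiv> mu_env a"

lemma mu_rec: "mu k = 1 + odds a k * (1 + mu (k - 1))"
proof -
  have set: "{k - int (Suc j)..k} = insert k {k - 1 - int j..k - 1}" for j by auto
  have "(\<Prod>i\<in>{k - int (Suc j)..k}. odds a i) = odds a k * (\<Prod>i\<in>{k - 1 - int j..k - 1}. odds a i)" for j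
    unfolding set by (subst prod.insert) auto
  then have "(\<Sum>j. \<Prod>i\<in>{k - int j..k}. odds a i) = odds a k + (\<Sum>j. odds a k * (\<Prod>i\<in>{k - 1 - int j..k - 1}. odds a i))"
    using suminf_split_head[OF mu_summable[of k]] by simp
  also have "\<dots> = odds a k * (1 + (\<Sum>j. \<Prod>i\<in>{k - 1 - int j..k - 1}. odds a i))"
    using mu_summable[of "k - 1"] by (subst suminf_mult) (auto simp: algebra_simps)
  finally show ?thesis by (simp add: mu_env_def algebra_simps)
qed

lemma mu_gt_1: "1 < mu k"
proof -
  have "0 < (\<Sum>j. \<Prod>i\<in>{k - int j..k}. odds a i)"
    by (rule suminf_pos[OF mu_summable]) (auto intro!: prod_pos odds_pos)
  then show ?thesis by (simp add: mu_env_def)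
qed

lemma mu_balance: "a k * mu k = 1 + (1 - a k) * mu (k - 1)"
proof -
  have "a k * mu k = a k + (a k * odds a k) * (1 + mu (k - 1))" by (subst mu_rec) (simp add: algebra_simps)
  then show ?thesis by (simp add: odds_mult algebra_simps)
qed

end

text \<open>\<open>v\<close> majorises the variances of the crossing times: the recursion below is the one
  they satisfy, obtained by conditioning on the first step.\<close>

locale ballistic_env = summable_env +
  fixes v :: "int \<Rightarrow> real"
  assumes v_nonneg: "0 \<le> v k"
    and v_rec: "v k = odds a k * v (k - 1) + (mu_env a k - 1)\<^sup>2 / (1 - a k)"
begin

text \<open>The law of total variance over the first step. From \<open>k\<close> a step to the left
  is followed by crossings of \<open>k - 1\<close> and of \<open>k\<close>, which adds both
  variances with weight 1 - p, and the Bernoulli choice contributes p (1 - p) times the square of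
  the total mean of those two crossings.\<close>

lemma v_balance: "a k * v k = (1 - a k) * v (k - 1) + a k * (1 - a k) * (mu k + mu (k - 1))\<^sup>2"
proof -
  have q: "1 - a k \<noteq> 0" using a_less_1[of k] by simp
  have "mu k - 1 = (1 - a k) * (mu k + mu (k - 1))" using mu_balance[of k] by (simp add: algebra_simps)
  then have "(mu k - 1)\<^sup>2 / (1 - a k) = (1 - a k) * (mu k + mu (k - 1))\<^sup>2"
    using q by (simp add: power_mult_distrib power2_eq_square)
  moreover have "a k * v k = (a k * odds a k) * v (k - 1) + a k * ((mu k - 1)\<^sup>2 / (1 - a k))"
    by (subst v_rec) (simp add: distrib_left mult.assoc)
  ultimately show ?thesis by (simp add: odds_mult)
qed

text \<open>The expected answers for the mean and the variance of the hitting time of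
  \<open>y\<close> from \<open>z\<close>, additive over the sites to be crossed. Until the
  comparison with first-passage probabilities is made they are only solutions of the first-step
  equations.\<close>

definition mean_time :: "int \<Rightarrow> int \<Rightarrow> real" where
  "mean_time z y = (\<Sum>k\<in>{z..<y}. mu k)"

definition var_time :: "int \<Rightarrow> int \<Rightarrow> real" where
  "var_time z y = (\<Sum>k\<in>{z..<y}. v k)"

lemma time_step:
  assumes "z < y"
  shows "mean_time (z + 1) y = mean_time z y - mu z" "mean_time (z - 1) y = mean_time z y + mu (z - 1)"
    "var_time (z + 1) y = var_time z y - v z" "var_time (z - 1) y = var_time z y + v (z - 1)"
proof -
  have s: "{z..<y} = insert z {z + 1..<y}" "{z - 1..<y} = insert (z - 1) {z..<y}" using assms by auto
  show "mean_time (z + 1) y = mean_time z y - mu z" "var_time (z + 1) y = var_time z y - v z"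
    unfolding mean_time_def var_time_def s(1) by (subst sum.insert; simp)+
  show "mean_time (z - 1) y = mean_time z y + mu (z - 1)" "var_time (z - 1) y = var_time z y + v (z - 1)"
    unfolding mean_time_def var_time_def s(2) by (subst sum.insert; simp)+
qed

lemma mean_time_nonneg: "0 \<le> mean_time z y"
  unfolding mean_time_def using mu_gt_1 by (intro sum_nonneg) (metis less_imp_le less_trans zero_less_one)

lemma var_time_nonneg: "0 \<le> var_time z y"
  unfolding var_time_def by (intro sum_nonneg v_nonneg)

lemma mean_time_harmonic:
  assumes "z < y"
  shows "1 + (a z * mean_time (z + 1) y + (1 - a z) * mean_time (z - 1) y) = mean_time z y"
  unfolding time_step[OF assms] using mu_balance[of z] by (simp add: algebra_simps)

text \<open>Expanding the square of one plus the remaining time gives the three groups on the left.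
  The mean terms cancel by \<open>mu_balance\<close>, and \<open>v_balance\<close> completes the
  square.\<close>

lemma second_moment_harmonic:
  assumes "z < y"
  defines "h \<equiv> \<lambda>z. mean_time z y" and "w \<equiv> \<lambda>z. var_time z y + (mean_time z y)\<^sup>2"
  shows "1 + 2 * (a z * h (z + 1) + (1 - a z) * h (z - 1)) + (a z * w (z + 1) + (1 - a z) * w (z - 1)) = w z"
proof -
  define H V p m m' where "H = mean_time z y" and "V = var_time z y" and "p = a z" and "m = mu z" and "m' = mu (z - 1)"
  have mb: "p * m = 1 + (1 - p) * m'" using mu_balance[of z] by (simp add: p_def m_def m'_def)
  have vb: "(1 - p) * v (z - 1) - p * v z = - (p * (1 - p) * (m + m')\<^sup>2)"
    using v_balance[of z] by (simp add: p_def m_def m'_def)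
  have "1 + 2 * (p * (H - m) + (1 - p) * (H + m')) + (p * (V - v z + (H - m)\<^sup>2) + (1 - p) * (V + v (z - 1) + (H + m')\<^sup>2))
     = V + H\<^sup>2 + 2 * H * (1 + ((1 - p) * m' - p * m)) + 1 + 2 * ((1 - p) * m' - p * m) + p * m\<^sup>2 + (1 - p) * m'\<^sup>2 + ((1 - p) * v (z - 1) - p * v z)"
    by (simp add: power2_eq_square algebra_simps)
  also have "(1 - p) * m' - p * m = -1" using mb by simp
  also have "V + H\<^sup>2 + 2 * H * (1 + - 1) + 1 + 2 * - 1 + p * m\<^sup>2 + (1 - p) * m'\<^sup>2 + ((1 - p) * v (z - 1) - p * v z)
     = V + H\<^sup>2 - 1 + (p * m - (1 - p) * m')\<^sup>2"
    unfolding vb by (simp add: power2_eq_square algebra_simps)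
  also have "\<dots> = V + H\<^sup>2" using mb by simp
  finally show ?thesis unfolding h_def w_def time_step[OF assms(1)] H_def V_def p_def m_def m'_def .
qed

text \<open>The sum truncated at \<open>N\<close> obeys the first-step equation that
  \<open>mean_time\<close> solves, starting from 0 at \<open>N = 0\<close>, so it stays below the
  nonnegative solution. The bound is uniform in \<open>N\<close>, which later yields certain
  hitting.\<close>

lemma sum_survival_le: "z \<le> y \<Longrightarrow> (\<Sum>t<N. survival a t z y) \<le> mean_time z y"
proof (induction N arbitrary: z)
  case (Suc N)
  show ?case
  proof (cases "z = y")
    case True
    have "survival a t y y = 0" for t by (cases t) auto
    then show ?thesis using True mean_time_nonneg[of z y] by simp
  next
    case False
    with Suc.prems have z: "z < y" by simp
    have "(\<Sum>t<Suc N. survival a t z y) = 1 + (a z * (\<Sum>t<N. survival a t (z + 1) y) + (1 - a z) * (\<Sum>t<N. survival a t (z - 1) y))"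
      using False by (subst sum.lessThan_Suc_shift) (simp add: sum.distrib sum_distrib_left)
    also have "\<dots> \<le> 1 + (a z * mean_time (z + 1) y + (1 - a z) * mean_time (z - 1) y)"
      using Suc.IH[of "z + 1"] Suc.IH[of "z - 1"] z a_pos[of z] a_less_1[of z]
      by (intro add_left_mono add_mono mult_left_mono) auto
    finally show ?thesis using mean_time_harmonic[OF z] by simp
  qed
qed (simp add: mean_time_nonneg)

lemma sums_first_passage:
  assumes "z \<le> y"
  shows "(\<lambda>t. first_passage a t z y) sums 1"
proof -
  have "summable (\<lambda>t. survival a t z y)"
    by (rule summableI_nonneg_bounded[OF survival_nonneg sum_survival_le[OF assms]])
  then have "(\<lambda>t. survival a t z y) \<longlonglongrightarrow> 0" by (rule summable_LIMSEQ_zero)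
  then have "(\<lambda>t. 1 - survival a t z y) \<longlonglongrightarrow> 1 - 0" by (intro tendsto_intros)
  then have "(\<lambda>t. \<Sum>s\<le>t. first_passage a s z y) \<longlonglongrightarrow> 1" by (simp add: survival_eq)
  then show ?thesis by (simp add: sums_def_le)
qed

lemma pmf_hit: "z \<le> y \<Longrightarrow> pmf (hit_pmf a z y) t = first_passage a t z y"
  using sums_first_passage[of z y] by (simp add: pmf_hit_pmf_eq sums_iff)

text \<open>The truncated moments satisfy the first-step equations with the total mass replaced by a
  truncated mass of at most 1, hence remain below the exact solutions. Both bounds run in one
  induction since the second moment involves the first.\<close>

lemma moments_le:
  assumes "z \<le> y"
  shows "(\<Sum>t\<le>N. real t * first_passage a t z y) \<le> mean_time z y"
    and "(\<Sum>t\<le>N. (real t)\<^sup>2 * first_passage a t z y) \<le> var_time z y + (mean_time z y)\<^sup>2"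
  using assms
proof (induction N arbitrary: z)
  case 0
  { case 1 show ?case by (simp add: mean_time_nonneg)
  next case 2 show ?case by (simp add: var_time_nonneg)
  }
next
  case (Suc N)
  have fp: "first_passage a (Suc t) z y = a z * first_passage a t (z + 1) y + (1 - a z) * first_passage a t (z - 1) y" if "z < y" for t z
    using that by simp
  have zero: "first_passage a (Suc t) y y = 0" for t by simp
  { case 1
    show ?case
    proof (cases "z = y")
      case True
      then show ?thesis by (subst sum.atMost_Suc_shift) (simp add: mean_time_nonneg)
    next
      case False
      with 1 have z: "z < y" by simp
      let ?c = "\<lambda>z. \<Sum>t\<le>N. first_passage a t z y" and ?u = "\<lambda>z. \<Sum>t\<le>N. real t * first_passage a t z y"
      have "(\<Sum>t\<le>Suc N. real t * first_passage a t z y) =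
         (a z * ?c (z + 1) + (1 - a z) * ?c (z - 1)) + (a z * ?u (z + 1) + (1 - a z) * ?u (z - 1))"
        unfolding sum.atMost_Suc_shift fp[OF z] by (simp add: sum.distrib sum_distrib_left sum_subtractf algebra_simps)
      also have "\<dots> \<le> (a z * 1 + (1 - a z) * 1) + (a z * mean_time (z + 1) y + (1 - a z) * mean_time (z - 1) y)"
        using Suc(1)[of "z + 1"] Suc(1)[of "z - 1"] z a_pos[of z] a_less_1[of z] sum_first_passage_le_1
        by (intro add_mono mult_left_mono) auto
      finally show ?thesis using mean_time_harmonic[OF z] by simp
    qed
  next
    case 2
    show ?case
    proof (cases "z = y")
      case True
      then show ?thesis by (subst sum.atMost_Suc_shift) (simp add: var_time_nonneg)
    next
      case False
      with 2 have z: "z < y" by simp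
      let ?c = "\<lambda>z. \<Sum>t\<le>N. first_passage a t z y" and ?u = "\<lambda>z. \<Sum>t\<le>N. real t * first_passage a t z y"
        and ?s = "\<lambda>z. \<Sum>t\<le>N. (real t)\<^sup>2 * first_passage a t z y"
      let ?w = "\<lambda>z. var_time z y + (mean_time z y)\<^sup>2"
      have "(\<Sum>t\<le>Suc N. (real t)\<^sup>2 * first_passage a t z y) =
         (a z * ?c (z + 1) + (1 - a z) * ?c (z - 1)) + 2 * (a z * ?u (z + 1) + (1 - a z) * ?u (z - 1))
         + (a z * ?s (z + 1) + (1 - a z) * ?s (z - 1))"
        unfolding sum.atMost_Suc_shift fp[OF z] by (simp add: power2_eq_square sum.distrib sum_distrib_left sum_subtractf algebra_simps)
      also have "\<dots> \<le> (a z * 1 + (1 - a z) * 1) + 2 * (a z * mean_time (z + 1) y + (1 - a z) * mean_time (z - 1) y)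
         + (a z * ?w (z + 1) + (1 - a z) * ?w (z - 1))"
        using Suc(1)[of "z + 1"] Suc(1)[of "z - 1"] Suc(2)[of "z + 1"] Suc(2)[of "z - 1"]
          z a_pos[of z] a_less_1[of z] sum_first_passage_le_1
        by (intro add_mono mult_left_mono) auto
      finally show ?thesis using second_moment_harmonic[OF z] by simp
    qed
  }
qed

lemma summable_moment1: "z \<le> y \<Longrightarrow> summable (\<lambda>t. real t * first_passage a t z y)"
  by (rule bounded_imp_summable[OF _ moments_le(1)]) (auto simp: first_passage_nonneg)

lemma summable_moment2: "z \<le> y \<Longrightarrow> summable (\<lambda>t. (real t)\<^sup>2 * first_passage a t z y)"
  by (rule bounded_imp_summable[OF _ moments_le(2)]) (auto simp: first_passage_nonneg)

definition fp_mean :: "int \<Rightarrow> int \<Rightarrow> real" where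
  "fp_mean z y = (\<Sum>t. real t * first_passage a t z y)"

lemma fp_mean_nonneg: "z \<le> y \<Longrightarrow> 0 \<le> fp_mean z y"
  unfolding fp_mean_def by (rule suminf_nonneg[OF summable_moment1]) (auto simp: first_passage_nonneg)

lemma fp_mean_le:
  assumes "z \<le> y"
  shows "fp_mean z y \<le> mean_time z y"
  unfolding fp_mean_def
proof (rule suminf_le_const[OF summable_moment1[OF assms]])
  fix n show "(\<Sum>t<n. real t * first_passage a t z y) \<le> mean_time z y"
    using moments_le(1)[OF assms] by (cases n) (simp_all only: lessThan_Suc_atMost lessThan_0 sum.empty mean_time_nonneg)
qed

text \<open>Mean of a convolution: writing \<open>t\<close> as \<open>s + (t - s)\<close> splits the
  series into two Cauchy products, and each companion factor has total mass 1.\<close>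

lemma fp_mean_add:
  assumes "z \<le> n" "n \<le> y"
  shows "fp_mean z y = fp_mean z n + fp_mean n y"
proof -
  let ?f = "\<lambda>t. first_passage a t z n" and ?g = "\<lambda>t. first_passage a t n y"
  have f: "summable (\<lambda>t. norm (?f t))" "summable (\<lambda>t. norm (real t * ?f t))"
    and g: "summable (\<lambda>t. norm (?g t))" "summable (\<lambda>t. norm (real t * ?g t))"
    using summable_first_passage summable_moment1[OF assms(1)] summable_moment1[OF assms(2)]
    by (simp_all add: first_passage_nonneg)
  have f1: "(\<Sum>t. ?f t) = 1" "(\<Sum>t. ?g t) = 1" using sums_first_passage assms by (auto simp: sums_iff)
  have "(\<lambda>t. (\<Sum>s\<le>t. (real s * ?f s) * ?g (t - s)) + (\<Sum>s\<le>t. ?f s * (real (t - s) * ?g (t - s)))) sums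
     ((\<Sum>t. real t * ?f t) * (\<Sum>t. ?g t) + (\<Sum>t. ?f t) * (\<Sum>t. real t * ?g t))"
    by (intro sums_add Cauchy_product_sums f g)
  moreover have "(\<Sum>s\<le>t. (real s * ?f s) * ?g (t - s)) + (\<Sum>s\<le>t. ?f s * (real (t - s) * ?g (t - s))) = real t * first_passage a t z y" for t
    unfolding first_passage_convolution[OF assms] sum_distrib_left sum.distrib[symmetric]
    by (intro sum.cong refl) (auto simp: algebra_simps of_nat_diff)
  ultimately show ?thesis using f1 by (simp add: fp_mean_def sums_iff)
qed

lemma fp_mean_step: "fp_mean k (k + 1) = 1 + (1 - a k) * fp_mean (k - 1) (k + 1)"
proof -
  let ?f = "\<lambda>t. first_passage a t (k + 1) (k + 1)" and ?g = "\<lambda>t. first_passage a t (k - 1) (k + 1)"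
  have f: "?f t = (if t = 0 then 1 else 0)" for t by (cases t) auto
  have sg: "summable ?g" "summable (\<lambda>t. real t * ?g t)"
    using summable_first_passage summable_moment1[of "k - 1" "k + 1"] by auto
  have g1: "(\<Sum>t. ?g t) = 1" using sums_first_passage[of "k - 1" "k + 1"] by (simp add: sums_iff)
  have "fp_mean k (k + 1) = (\<Sum>t. real (Suc t) * first_passage a (Suc t) k (k + 1))"
    unfolding fp_mean_def using suminf_split_head[OF summable_moment1[of k "k + 1"]] by simp
  also have "\<dots> = (\<Sum>t. a k * (if t = 0 then 1 else 0) + (1 - a k) * (?g t + real t * ?g t))"
  proof (rule suminf_cong)
    fix t
    have "first_passage a (Suc t) k (k + 1) = a k * ?f t + (1 - a k) * ?g t" by simp
    then show "real (Suc t) * first_passage a (Suc t) k (k + 1) = a k * (if t = 0 then 1 else 0) + (1 - a k) * (?g t + real t * ?g t)"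
      unfolding f by (cases t) (simp_all add: algebra_simps)
  qed
  also have "\<dots> = (\<Sum>t::nat. a k * (if t = 0 then 1 else 0)) + (\<Sum>t. (1 - a k) * (?g t + real t * ?g t))"
    using sg by (intro suminf_add[symmetric] summable_mult summable_add) (auto intro: summable_finite[of "{0}"])
  also have "(\<Sum>t::nat. a k * (if t = 0 then 1 else 0)) = a k"
    by (subst suminf_finite[of "{0}"]) auto
  also have "(\<Sum>t. (1 - a k) * (?g t + real t * ?g t)) = (1 - a k) * (1 + fp_mean (k - 1) (k + 1))"
    using sg g1 by (subst suminf_mult) (auto simp: fp_mean_def suminf_add[symmetric] intro: summable_add)
  finally show ?thesis by (simp add: algebra_simps)
qed

text \<open>The recursion satisfied by \<open>mu\<close>. Since it may have other nonnegative
  solutions, the identification with \<open>mu\<close> needs the separate domination argument of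
  \<open>fp_mean_eq\<close>.\<close>

lemma fp_mean_rec: "fp_mean k (k + 1) = 1 + odds a k * (1 + fp_mean (k - 1) k)"
proof -
  have "fp_mean k (k + 1) = 1 + (1 - a k) * (fp_mean (k - 1) k + fp_mean k (k + 1))"
    using fp_mean_step[of k] fp_mean_add[of "k - 1" k "k + 1"] by simp
  then have "a k * fp_mean k (k + 1) = 1 + (1 - a k) * fp_mean (k - 1) k" by (simp add: algebra_simps)
  then have "fp_mean k (k + 1) = (1 + (1 - a k) * fp_mean (k - 1) k) / a k"
    using a_pos[of k] by (simp add: field_simps)
  also have "\<dots> = 1 + odds a k * (1 + fp_mean (k - 1) k)"
    using a_pos[of k] by (simp add: odds_def field_simps)
  finally show ?thesis .
qed

text \<open>The defect \<open>mu k - fp_mean k (k + 1)\<close> is multiplied by \<open>odds a k\<close> at every step, and its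
  value at \<open>k - j\<close> is at most \<open>mu (k - j)\<close>, so it is dominated by a tail of the series \<open>mu k\<close>.\<close>

lemma fp_mean_eq: "fp_mean k (k + 1) = mu k"
proof -
  let ?P = "\<lambda>j k. \<Prod>i\<in>{k - int j..k}. odds a i"
  define d where "d k = mu k - fp_mean k (k + 1)" for k
  have d: "d k = odds a k * d (k - 1)" for k
    unfolding d_def using mu_rec[of k] fp_mean_rec[of k] by (simp add: algebra_simps)
  have mt: "mean_time k (k + 1) = mu k" for k
  proof -
    have "{k..<k + 1} = {k}" by auto
    then show ?thesis by (simp add: mean_time_def)
  qed
  have d0: "0 \<le> d k" "d k \<le> mu k" for k
    using fp_mean_le[of k "k + 1"] fp_mean_nonneg[of k "k + 1"] by (auto simp: d_def mt)
  have P: "?P (Suc j) k = ?P j k * odds a (k - int (Suc j))" for j k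
  proof -
    have "{k - int (Suc j)..k} = insert (k - int (Suc j)) {k - int j..k}" by auto
    then show ?thesis by (simp add: mult.commute)
  qed
  have dj: "d k = ?P j k * d (k - int (Suc j))" for j
  proof (induction j)
    case 0
    then show ?case using d[of k] by simp
  next
    case (Suc j)
    have "d k = ?P j k * (odds a (k - int (Suc j)) * d (k - int (Suc j) - 1))" using Suc d by metis
    then show ?case unfolding P by (simp add: algebra_simps)
  qed
  have Ptail: "?P j k * mu (k - int (Suc j)) = ?P j k + 2 * (\<Sum>i. ?P (i + Suc j) k)" for j
  proof -
    have split: "?P (i + Suc j) k = ?P j k * ?P i (k - int (Suc j))" for i
    proof -
      have "{k - int (i + Suc j)..k} = {k - int (Suc j) - int i..k - int (Suc j)} \<union> {k - int j..k}" by auto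
      then show ?thesis by (simp add: prod.union_disjoint mult.commute)
    qed
    have "(\<Sum>i. ?P (i + Suc j) k) = ?P j k * (\<Sum>i. ?P i (k - int (Suc j)))"
      unfolding split by (rule suminf_mult[OF mu_summable])
    then show ?thesis by (simp add: mu_env_def algebra_simps)
  qed
  have "(\<lambda>j. ?P j k + 2 * (\<Sum>i. ?P (i + Suc j) k)) \<longlonglongrightarrow> 0 + 2 * 0"
  proof (intro tendsto_intros)
    show "(\<lambda>j. ?P j k) \<longlonglongrightarrow> 0" by (rule summable_LIMSEQ_zero[OF mu_summable])
    show "(\<lambda>j. \<Sum>i. ?P (i + Suc j) k) \<longlonglongrightarrow> 0"
      using suminf_exist_split2[OF mu_summable[of k], THEN LIMSEQ_Suc] by simp
  qed
  moreover have "d k \<le> ?P j k + 2 * (\<Sum>i. ?P (i + Suc j) k)" for j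
  proof -
    have "d k = ?P j k * d (k - int (Suc j))" by (rule dj)
    also have "\<dots> \<le> ?P j k * mu (k - int (Suc j))"
      using d0 by (intro mult_left_mono prod_nonneg) (auto simp: less_imp_le odds_pos)
    finally show ?thesis unfolding Ptail .
  qed
  ultimately have "d k \<le> 0" by (intro LIMSEQ_le_const) auto
  then show ?thesis using d0(1)[of k] by (simp add: d_def)
qed

end

section \<open>Characteristic functions of hitting times and the central limit theorem for
  them\<close>

context ballistic_env
begin

lemma summable_fp_iexp: "summable (\<lambda>t. norm (complex_of_real (first_passage a t z y) * iexp (u * real t)))"
  using summable_first_passage[of z y] by (simp add: norm_mult first_passage_nonneg)

lemma expectation_iexp_hit:
  assumes "z \<le> y"
  shows "(\<lambda>t. complex_of_real (first_passage a t z y) * iexp (u * real t)) sums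
    measure_pmf.expectation (hit_pmf a z y) (\<lambda>t. iexp (u * real t))"
  using sums_expectation_nat_pmf(2)[of "hit_pmf a z y" "\<lambda>t. iexp (u * real t)"] summable_fp_iexp[of z y u]
  by (simp add: pmf_hit[OF assms] scaleR_conv_of_real)

text \<open>Independence of successive crossing times in Fourier form: the convolution identity
  becomes a Cauchy product of absolutely convergent series.\<close>

lemma expectation_iexp_add:
  assumes "z \<le> n" "n \<le> y"
  shows "measure_pmf.expectation (hit_pmf a z y) (\<lambda>t. iexp (u * real t)) =
    measure_pmf.expectation (hit_pmf a z n) (\<lambda>t. iexp (u * real t)) *
    measure_pmf.expectation (hit_pmf a n y) (\<lambda>t. iexp (u * real t))"
proof -
  let ?f = "\<lambda>z y t. complex_of_real (first_passage a t z y) * iexp (u * real t)"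
  have "(\<lambda>t. \<Sum>s\<le>t. ?f z n s * ?f n y (t - s)) sums ((\<Sum>t. ?f z n t) * (\<Sum>t. ?f n y t))"
    by (intro Cauchy_product_sums summable_fp_iexp)
  moreover have "(\<Sum>s\<le>t. ?f z n s * ?f n y (t - s)) = ?f z y t" for t
  proof -
    have "?f z n s * ?f n y (t - s) = complex_of_real (first_passage a s z n * first_passage a (t - s) n y) * iexp (u * real t)" if "s \<le> t" for s
    proof -
      have "iexp (u * real s) * iexp (u * real (t - s)) = iexp (u * real t)"
        using that by (simp add: mult_exp_exp of_nat_diff algebra_simps)
      then show ?thesis by (simp add: mult_ac)
    qed
    then have "(\<Sum>s\<le>t. ?f z n s * ?f n y (t - s)) = (\<Sum>s\<le>t. complex_of_real (first_passage a s z n * first_passage a (t - s) n y) * iexp (u * real t))"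
      by (intro sum.cong) auto
    also have "\<dots> = ?f z y t"
      unfolding first_passage_convolution[OF assms] sum_distrib_right[symmetric] by simp
    finally show ?thesis .
  qed
  ultimately have "(\<lambda>t. ?f z y t) sums ((\<Sum>t. ?f z n t) * (\<Sum>t. ?f n y t))" by simp
  with expectation_iexp_hit[of z y u] expectation_iexp_hit[of z n u] expectation_iexp_hit[of n y u] assms show ?thesis
    by (simp add: sums_iff)
qed

lemma expectation_hit_centered:
  "measure_pmf.expectation (hit_pmf a z y) (\<lambda>t. iexp (u * (real t - c))) =
   iexp (- (u * c)) * measure_pmf.expectation (hit_pmf a z y) (\<lambda>t. iexp (u * real t))"
proof -
  have "iexp (u * (real t - c)) = iexp (- (u * c)) * iexp (u * real t)" for t
    by (simp add: mult_exp_exp algebra_simps)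
  then show ?thesis by simp
qed

lemma expectation_iexp_prod:
  "measure_pmf.expectation (hit_pmf a 0 (int n)) (\<lambda>t. iexp (u * (real t - (\<Sum>k<n. mu (int k))))) =
   (\<Prod>k<n. measure_pmf.expectation (hit_pmf a (int k) (int k + 1)) (\<lambda>t. iexp (u * (real t - mu (int k)))))"
proof (induction n)
  case 0
  have "(\<lambda>t. complex_of_real (first_passage a t 0 0) * iexp (u * real t)) sums 1"
  proof -
    have "complex_of_real (first_passage a t 0 0) * iexp (u * real t) = (if t = 0 then 1 else 0)" for t
      by (cases t) auto
    then show ?thesis using sums_single[of 0 "\<lambda>_. 1::complex"] by simp
  qed
  then show ?case using expectation_iexp_hit[of 0 0 u] by (simp add: sums_iff)
next
  case (Suc n)
  have e: "int (Suc n) = int n + 1" by simp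
  have "iexp (- (u * (\<Sum>k<Suc n. mu (int k)))) = iexp (- (u * (\<Sum>k<n. mu (int k)))) * iexp (- (u * mu (int n)))"
    by (simp add: mult_exp_exp algebra_simps)
  then show ?case
    using Suc expectation_iexp_add[of 0 "int n" "int n + 1" u]
    unfolding expectation_hit_centered e by (simp add: mult_ac)
qed

lemma hit_moments:
  shows "integrable (measure_pmf (hit_pmf a k (k + 1))) real"
    and "measure_pmf.expectation (hit_pmf a k (k + 1)) real = mu k"
    and "integrable (measure_pmf (hit_pmf a k (k + 1))) (\<lambda>t. (real t)\<^sup>2)"
    and "measure_pmf.expectation (hit_pmf a k (k + 1)) (\<lambda>t. (real t)\<^sup>2) \<le> v k + (mu k)\<^sup>2"
proof -
  have k: "k \<le> k + 1" by simp
  have s1: "summable (\<lambda>t. norm (pmf (hit_pmf a k (k + 1)) t *\<^sub>R real t))"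
    using summable_moment1[OF k] by (simp add: pmf_hit first_passage_nonneg mult.commute)
  have s2: "summable (\<lambda>t. norm (pmf (hit_pmf a k (k + 1)) t *\<^sub>R (real t)\<^sup>2))"
    using summable_moment2[OF k] by (simp add: pmf_hit first_passage_nonneg mult.commute)
  show "integrable (measure_pmf (hit_pmf a k (k + 1))) real" "integrable (measure_pmf (hit_pmf a k (k + 1))) (\<lambda>t. (real t)\<^sup>2)"
    using sums_expectation_nat_pmf(1)[OF s1] sums_expectation_nat_pmf(1)[OF s2] by auto
  show "measure_pmf.expectation (hit_pmf a k (k + 1)) real = mu k"
    using sums_expectation_nat_pmf(2)[OF s1] fp_mean_eq[of k] by (simp add: pmf_hit sums_iff fp_mean_def mult.commute)
  have s: "{k..<k + 1} = {k}" by auto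
  have "measure_pmf.expectation (hit_pmf a k (k + 1)) (\<lambda>t. (real t)\<^sup>2) = (\<Sum>t. (real t)\<^sup>2 * first_passage a t k (k + 1))"
    using sums_expectation_nat_pmf(2)[OF s2] by (simp add: pmf_hit sums_iff mult.commute)
  also have "\<dots> \<le> v k + (mu k)\<^sup>2"
  proof (rule suminf_le_const[OF summable_moment2[OF k]])
    fix n show "(\<Sum>t<n. (real t)\<^sup>2 * first_passage a t k (k + 1)) \<le> v k + (mu k)\<^sup>2"
      using moments_le(2)[OF k, of "n - 1"] v_nonneg[of k]
      by (cases n) (simp_all add: lessThan_Suc_atMost mean_time_def var_time_def s)
  qed
  finally show "measure_pmf.expectation (hit_pmf a k (k + 1)) (\<lambda>t. (real t)\<^sup>2) \<le> v k + (mu k)\<^sup>2" .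
qed

lemma integrable_centered_square: "integrable (measure_pmf (hit_pmf a k (k + 1))) (\<lambda>t. (real t - mu k)\<^sup>2)"
  using hit_moments[of k] by (simp add: power2_diff)

lemma var_tau_eq_centered: "var_tau a k = measure_pmf.expectation (hit_pmf a k (k + 1)) (\<lambda>t. (real t - mu k)\<^sup>2)"
  by (simp add: var_tau_eq hit_moments)

lemma var_tau_le: "var_tau a k \<le> v k"
proof -
  have "var_tau a k = measure_pmf.expectation (hit_pmf a k (k + 1)) (\<lambda>t. (real t)\<^sup>2) - (mu k)\<^sup>2"
    using measure_pmf.variance_eq[OF hit_moments(1)[of k] hit_moments(3)[of k]] by (simp add: var_tau_eq hit_moments)
  then show ?thesis using hit_moments(4)[of k] by simp
qed

text \<open>Crossing in a single step has positive probability \<open>a k\<close>, while the mean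
  exceeds 1, so this one atom already has positive squared deviation.\<close>

lemma var_tau_pos: "0 < var_tau a k"
proof -
  let ?p = "hit_pmf a k (k + 1)"
  have "pmf ?p 1 = a k" using pmf_hit[of k "k + 1" 1] by simp
  have "(\<integral>t. (1 - mu k)\<^sup>2 * indicator {1} t \<partial>measure_pmf ?p) \<le> (\<integral>t. (real t - mu k)\<^sup>2 \<partial>measure_pmf ?p)"
  proof (rule integral_mono[OF _ integrable_centered_square])
    show "integrable (measure_pmf ?p) (\<lambda>t. (1 - mu k)\<^sup>2 * indicator {1} t)"
      by (rule measure_pmf.integrable_const_bound[where B="(1 - mu k)\<^sup>2"]) (auto intro!: AE_I2 simp: indicator_def)
  qed (auto simp: indicator_def)
  also have "(\<integral>t. (1 - mu k)\<^sup>2 * indicator {1} t \<partial>measure_pmf ?p) = (1 - mu k)\<^sup>2 * a k"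
    using \<open>pmf ?p 1 = a k\<close> by (simp add: measure_pmf_single)
  finally have "(1 - mu k)\<^sup>2 * a k \<le> var_tau a k" by (simp add: var_tau_eq_centered)
  moreover have "0 < (1 - mu k)\<^sup>2 * a k" using mu_gt_1[of k] a_pos[of k] by simp
  ultimately show ?thesis by simp
qed

lemma trunc_var_bounds: "0 \<le> trunc_var a K k" "trunc_var a K k \<le> var_tau a k"
proof -
  show "0 \<le> trunc_var a K k" unfolding trunc_var_def by (rule integral_nonneg_AE) auto
  show "trunc_var a K k \<le> var_tau a k"
    unfolding trunc_var_def var_tau_eq_centered
    by (rule integral_mono_AE')
      (auto simp: integrable_centered_square indicator_def)
qed

lemma trunc_var_tendsto: "(\<lambda>n. trunc_var a (real n) k) \<longlonglongrightarrow> 0"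
proof -
  have "(\<lambda>n. trunc_var a (real n) k) \<longlonglongrightarrow> (\<integral>t. 0 \<partial>measure_pmf (hit_pmf a k (k + 1)))"
    unfolding trunc_var_def
  proof (rule integral_dominated_convergence[where w = "\<lambda>t. (real t - mu k)\<^sup>2"])
    show "AE t in hit_pmf a k (k + 1). (\<lambda>n. (real t - mu k)\<^sup>2 * indicator {t. real n < \<bar>real t - mu k\<bar>} t) \<longlonglongrightarrow> 0"
    proof (rule AE_I2)
      fix t
      obtain N :: nat where "\<bar>real t - mu k\<bar> \<le> real N" using real_arch_simple by blast
      then have "eventually (\<lambda>n. (real t - mu k)\<^sup>2 * indicator {t. real n < \<bar>real t - mu k\<bar>} t = (0::real)) sequentially"
        by (intro eventually_sequentiallyI[of N]) (auto simp: indicator_def)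
      then show "(\<lambda>n. (real t - mu k)\<^sup>2 * indicator {t. real n < \<bar>real t - mu k\<bar>} t) \<longlonglongrightarrow> (0::real)"
        by (rule tendsto_eventually)
    qed
  qed (auto simp: integrable_centered_square indicator_def)
  then show ?thesis by simp
qed

definition scaled_hit :: "real \<Rightarrow> nat \<Rightarrow> real measure" where
  "scaled_hit s2 n = distr (hit_pmf a 0 (int n)) borel (\<lambda>t. (real t - (\<Sum>k<n. mu (int k))) / sqrt (s2 * real n))"

lemma real_distribution_scaled_hit: "real_distribution (scaled_hit s2 n)"
  unfolding scaled_hit_def by (rule prob_space.real_distribution_distr[OF measure_pmf.prob_space_axioms]) simp

theorem hitting_time_clt:
  assumes s2: "0 < s2" and lim: "(\<lambda>n. (\<Sum>k<n. var_tau a (int k)) / n) \<longlonglongrightarrow> s2"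
    and lind: "\<And>e. 0 < e \<Longrightarrow> \<exists>K::nat. eventually (\<lambda>n. (\<Sum>k<n. trunc_var a K (int k)) / n \<le> e) sequentially"
  shows "weak_conv_m (scaled_hit s2) std_normal_distribution"
proof (rule levy_continuity)
  fix u
  let ?N = "\<lambda>k::nat. distr (hit_pmf a (int k) (int k + 1)) borel (\<lambda>t. real t - mu (int k))"
  have charN: "char (?N k) u = measure_pmf.expectation (hit_pmf a (int k) (int k + 1)) (\<lambda>t. iexp (u * (real t - mu (int k))))" for k u
    unfolding char_def by (subst integral_distr) auto
  have "char (scaled_hit s2 n) u = (\<Prod>k<n. char (?N k) (u / sqrt (s2 * n)))" for n
  proof -
    have "char (scaled_hit s2 n) u = measure_pmf.expectation (hit_pmf a 0 (int n))
        (\<lambda>t. iexp (u * ((real t - (\<Sum>k<n. mu (int k))) / sqrt (s2 * real n))))"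
      unfolding char_def scaled_hit_def by (subst integral_distr) auto
    also have "\<dots> = measure_pmf.expectation (hit_pmf a 0 (int n))
        (\<lambda>t. iexp (u / sqrt (s2 * real n) * (real t - (\<Sum>k<n. mu (int k)))))"
      by (simp only: times_divide_eq_right times_divide_eq_left)
    also have "\<dots> = (\<Prod>k<n. char (?N k) (u / sqrt (s2 * n)))"
      unfolding charN by (rule expectation_iexp_prod)
    finally show ?thesis .
  qed
  moreover have "(\<lambda>n. \<Prod>k<n. char (?N k) (u / sqrt (s2 * n))) \<longlonglongrightarrow> of_real (exp (- u\<^sup>2 / 2))"
  proof (rule lindeberg_char_prod[OF _ _ _ _ _ _ lim s2 lind])
    show "real_distribution (?N k)" for k by (rule prob_space.real_distribution_distr[OF measure_pmf.prob_space_axioms]) simp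
    show "integrable (?N k) (\<lambda>x. x)" for k
      using hit_moments(1)[of "int k"] by (simp add: integrable_distr_eq)
    show "(\<integral>x. x \<partial>?N k) = 0" for k
      using hit_moments(1,2)[of "int k"] by (simp add: integral_distr)
    show "integrable (?N k) (\<lambda>x. x\<^sup>2)" for k
      using integrable_centered_square[of "int k"] by (simp add: integrable_distr_eq)
    show "var_tau a (int k) = (\<integral>x. x\<^sup>2 \<partial>?N k)" for k
      by (simp add: integral_distr var_tau_eq_centered)
    show "trunc_var a (real K) (int k) = (\<integral>x. x\<^sup>2 * indicator {x. real K < \<bar>x\<bar>} x \<partial>?N k)" for K k
      by (subst integral_distr) (auto simp: trunc_var_def indicator_def)
  qed
  ultimately show "(\<lambda>n. char (scaled_hit s2 n) u) \<longlonglongrightarrow> char std_normal_distribution u"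
    by (simp add: char_std_normal_distribution)
qed (auto intro: real_distribution_scaled_hit real_dist_normal_dist)

text \<open>Rewrites the event that site \<open>n\<close> is not reached by time \<open>t\<close> in
  terms of the normalised hitting time; \<open>0 < n\<close> keeps the scale nonzero.\<close>

lemma survival_eq_cdf:
  assumes "0 < s2" "0 < n"
  shows "survival a t 0 (int n) = 1 - cdf (scaled_hit s2 n) ((real t - (\<Sum>k<n. mu (int k))) / sqrt (s2 * n))"
proof -
  have s: "0 < sqrt (s2 * real n)" using assms by simp
  have "cdf (scaled_hit s2 n) ((real t - (\<Sum>k<n. mu (int k))) / sqrt (s2 * n)) = measure (hit_pmf a 0 (int n)) {..t}"
    unfolding cdf_def scaled_hit_def
    by (subst measure_distr) (use s in \<open>auto simp: divide_le_cancel intro!: arg_cong[where f = "measure _"]\<close>)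
  also have "\<dots> = (\<Sum>s\<le>t. first_passage a s 0 (int n))"
    by (subst measure_measure_pmf_finite) (auto simp: pmf_hit)
  finally show ?thesis by (simp add: survival_eq)
qed

end

section \<open>Position of the walk\<close>

lemma continuous_cdf_std_normal: "continuous_on UNIV (cdf std_normal_distribution)"
proof -
  interpret N: real_distribution std_normal_distribution by (rule real_dist_normal_dist)
  have "measure std_normal_distribution {x} = 0" for x
  proof -
    have "emeasure std_normal_distribution {x} = 0"
      by (subst emeasure_density) (auto intro!: nn_integral_null_set simp: null_sets_def)
    then show ?thesis by (simp add: measure_def)
  qed
  then show ?thesis by (simp add: continuous_on_eq_continuous_at N.isCont_cdf)
qed

text \<open>The characteristic function is even, so the law is symmetric; no density computation is
  required. The reflection is needed because being far to the right corresponds to a short hitting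
  time.\<close>

lemma cdf_std_normal_uminus: "cdf std_normal_distribution (- x) = 1 - cdf std_normal_distribution x"
proof -
  interpret N: real_distribution std_normal_distribution by (rule real_dist_normal_dist)
  let ?U = "distr std_normal_distribution borel uminus"
  have U: "?U = std_normal_distribution"
  proof (rule Levy_uniqueness)
    show "real_distribution ?U" by (rule N.real_distribution_distr) simp
    have "char ?U t = char std_normal_distribution (- t)" for t
      unfolding char_def by (subst integral_distr) auto
    then show "char ?U = char std_normal_distribution" by (auto simp: char_std_normal_distribution)
  qed (rule real_dist_normal_dist)
  have at0: "measure std_normal_distribution {x} = 0"
    using continuous_cdf_std_normal by (simp add: continuous_on_eq_continuous_at N.isCont_cdf)
  have "cdf std_normal_distribution (- x) = measure ?U {..- x}" by (simp add: cdf_def U)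
  also have "\<dots> = measure std_normal_distribution {x..}"
    by (subst measure_distr) (auto intro!: arg_cong[where f = "measure _"])
  also have "\<dots> = measure std_normal_distribution {x<..} + measure std_normal_distribution {x}"
    by (subst N.finite_measure_Union[symmetric]) (auto intro!: arg_cong[where f = "measure _"])
  also have "measure std_normal_distribution {x<..} = 1 - measure std_normal_distribution {..x}"
    using N.prob_compl[of "{..x}"] by (simp add: Compl_eq_Diff_UNIV[symmetric] not_le)
  finally show ?thesis by (simp add: at0 cdf_def)
qed

lemma ln_powr_tendsto_0:
  fixes e :: real
  assumes "e < 0"
  shows "(\<lambda>t::nat. (A + B * ln (real t)) * real t powr e) \<longlonglongrightarrow> 0"
  using assms by real_asymp

text \<open>Gathers the properties that hold for almost every environment, so that the passage from
  hitting times to positions is deterministic. \<open>m\<close> and \<open>s2\<close> stand for the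
  means of \<open>mu\<close> and of the crossing variance, and \<open>l w\<close> is a fall-back
  distance at \<open>w\<close> that is negligible on the square-root scale yet makes
  \<open>ladder_tail\<close> vanish.\<close>

locale quenched_env = ballistic_env +
  fixes m s2 s K :: real and l :: "nat \<Rightarrow> nat"
  assumes m_pos: "0 < m" and s2_pos: "0 < s2" and s_pos: "0 < s" and K_nonneg: "0 \<le> K"
    and var_limit: "(\<lambda>n. (\<Sum>k<n. var_tau a (int k)) / n) \<longlonglongrightarrow> s2"
    and lindeberg: "\<And>e. 0 < e \<Longrightarrow> \<exists>K::nat. eventually (\<lambda>n. (\<Sum>k<n. trunc_var a K (int k)) / n \<le> e) sequentially"
    and window: "\<And>x y i j. 1 \<le> y \<Longrightarrow> y \<le> x \<Longrightarrow> i \<le> j \<Longrightarrow> real j \<le> x \<Longrightarrow> real j \<le> real i + y \<Longrightarrow>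
     \<bar>(\<Sum>k<j. mu_env a (int k) - m) - (\<Sum>k<i. mu_env a (int k) - m)\<bar>
       \<le> K * (1 + ln x) * (x powr (1 + s / 8) * y powr s) powr (1 / (2 * (1 + s)))"
    and ladder_summable: "\<And>w. summable (\<lambda>j. \<Prod>i\<in>{w + 1..w + int j}. odds a i)"
    and ladder: "(\<lambda>w. ladder_tail a (int w) (int w + int (l w))) \<longlonglongrightarrow> 0"
    and l_small: "(\<lambda>w. real (l w) / sqrt (real w)) \<longlonglongrightarrow> 0"
begin

section \<open>Window sums and the explicit centring in a fixed environment\<close>

definition S :: "nat \<Rightarrow> real" where
  "S n = (\<Sum>k<n. mu (int k) - m)"

lemma S_eq: "S n = (\<Sum>k<n. mu (int k)) - m * real n"
  by (simp add: S_def sum_subtractf)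

lemma S_window_tendsto:
  assumes ev: "eventually (\<lambda>t. real (\<alpha> t) \<le> C * real t \<and> real (\<beta> t) \<le> C * real t \<and>
      \<bar>real (\<alpha> t) - real (\<beta> t)\<bar> \<le> C * real t powr (5/8)) sequentially"
  shows "(\<lambda>t. (S (\<alpha> t) - S (\<beta> t)) / sqrt (real t)) \<longlonglongrightarrow> 0"
proof -
  define D where "D = max 1 C"
  have D: "1 \<le> D" "C \<le> D" by (auto simp: D_def)
  define q where "q = 1 / (2 * (1 + s))"
  define A where "A = K * (D powr (1 + s / 8) * D powr s) powr q"
  define e where "e = ((1 + s / 8) + 5/8 * s) * q - 1/2"
  have e: "e < 0" using s_pos by (simp add: e_def q_def field_simps)
  have "eventually (\<lambda>t. norm ((S (\<alpha> t) - S (\<beta> t)) / sqrt (real t)) \<le> (A * (1 + ln D) + A * ln (real t)) * real t powr e) sequentially"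
    using ev eventually_ge_at_top[of 1]
  proof eventually_elim
    case (elim t)
    have t: "1 \<le> real t" "0 < real t" using elim by auto
    have tp: "real t powr (5/8) \<le> real t" "1 \<le> real t powr (5/8)"
      using powr_mono[of "5/8" 1 "real t"] ge_one_powr_ge_zero[OF t(1), of "5/8"] t by auto
    define x y where "x = D * real t" and "y = D * real t powr (5/8)"
    have xy: "1 \<le> y" "y \<le> x" using D tp mult_mono[of 1 D 1 "real t powr (5/8)"] by (auto simp: x_def y_def)
    have C1: "C * real t \<le> x" "C * real t powr (5/8) \<le> y" using D t by (auto simp: x_def y_def intro!: mult_right_mono)
    have "\<bar>S (\<alpha> t) - S (\<beta> t)\<bar> \<le> K * (1 + ln x) * (x powr (1 + s / 8) * y powr s) powr q"
    proof (cases "\<beta> t \<le> \<alpha> t")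
      case True
      then show ?thesis unfolding S_def q_def using elim C1 by (intro window xy) auto
    next
      case False
      then show ?thesis unfolding S_def q_def using elim C1 by (subst abs_minus_commute) (intro window xy; auto)
    qed
    also have "(x powr (1 + s / 8) * y powr s) powr q = (D powr (1 + s / 8) * D powr s) powr q * real t powr (e + 1/2)"
      using D t by (simp add: x_def y_def powr_mult powr_powr powr_add[symmetric] e_def algebra_simps)
    also have "ln x = ln D + ln (real t)" using D t by (simp add: x_def ln_mult)
    finally have "\<bar>S (\<alpha> t) - S (\<beta> t)\<bar> \<le> (A * (1 + ln D) + A * ln (real t)) * real t powr (e + 1/2)"
      by (simp add: A_def algebra_simps)
    then have "\<bar>S (\<alpha> t) - S (\<beta> t)\<bar> / sqrt (real t) \<le> (A * (1 + ln D) + A * ln (real t)) * real t powr (e + 1/2) / sqrt (real t)"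
      by (rule divide_right_mono) simp
    also have "\<dots> = (A * (1 + ln D) + A * ln (real t)) * real t powr e"
      using t by (simp add: powr_add powr_half_sqrt)
    finally show ?case by simp
  qed
  then show ?thesis by (rule Lim_null_comparison) (rule ln_powr_tendsto_0[OF e])
qed

text \<open>The window hypothesis with position and length both equal to \<open>n\<close> has
  exponent (1 + 9 s/8) / (2 + 2 s), which is below 9/16 and hence below 5/8 for every positive
  \<open>s\<close>.\<close>

lemma S_bound: "\<exists>C. \<forall>n. \<bar>S n\<bar> \<le> C + real n powr (5/8)"
proof -
  define q where "q = 1 / (2 * (1 + s))"
  define e where "e = ((1 + s / 8) + s) * q - 5/8"
  have e: "e < 0" using s_pos by (simp add: e_def q_def field_simps)
  have "(\<lambda>n::nat. (K + K * ln (real n)) * real n powr e) \<longlonglongrightarrow> 0" by (rule ln_powr_tendsto_0[OF e])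
  then have "eventually (\<lambda>n::nat. (K + K * ln (real n)) * real n powr e < 1) sequentially"
    by (rule order_tendstoD) simp
  then obtain N where N: "\<And>n. N \<le> n \<Longrightarrow> (K + K * ln (real n)) * real n powr e < 1"
    unfolding eventually_sequentially by blast
  have "\<bar>S n\<bar> \<le> real n powr (5/8)" if "max 1 N \<le> n" for n
  proof -
    have n: "1 \<le> real n" "0 < real n" using that by auto
    have "\<bar>S n - S 0\<bar> \<le> K * (1 + ln (real n)) * (real n powr (1 + s / 8) * real n powr s) powr q"
      unfolding S_def q_def using n by (intro window) auto
    also have "(real n powr (1 + s / 8) * real n powr s) powr q = real n powr e * real n powr (5/8)"
      using n by (simp add: powr_mult powr_powr powr_add[symmetric] e_def algebra_simps)
    also have "K * (1 + ln (real n)) * (real n powr e * real n powr (5/8)) = ((K + K * ln (real n)) * real n powr e) * real n powr (5/8)"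
      by (simp add: algebra_simps)
    also have "\<dots> \<le> 1 * real n powr (5/8)" using N[of n] that by (intro mult_right_mono) auto
    finally show ?thesis by (simp add: S_def)
  qed
  note large = this
  show ?thesis
  proof (intro exI allI)
    fix n
    show "\<bar>S n\<bar> \<le> (\<Sum>i\<le>max 1 N. \<bar>S i\<bar>) + real n powr (5/8)"
    proof (cases "max 1 N \<le> n")
      case True
      have "0 \<le> (\<Sum>i\<le>max 1 N. \<bar>S i\<bar>)" by (rule sum_nonneg) simp
      with large[OF True] show ?thesis by linarith
    next
      case False
      then have "\<bar>S n\<bar> \<le> (\<Sum>i\<le>max 1 N. \<bar>S i\<bar>)" by (intro member_le_sum[where f = "\<lambda>i. \<bar>S i\<bar>"]) auto
      then show ?thesis using powr_ge_zero[of "real n" "5/8"] by linarith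
    qed
  qed
qed

definition centre :: "nat \<Rightarrow> real" where
  "centre t = 2 * inverse m * real t - inverse m * H_sum a (inverse m * real t)"

definition n0 :: "nat \<Rightarrow> nat" where
  "n0 t = nat \<lfloor>inverse m * real t\<rfloor>"

lemma n0: "\<lfloor>inverse m * real t\<rfloor> = int (n0 t)" "real (n0 t) \<le> inverse m * real t" "inverse m * real t < real (n0 t) + 1"
proof -
  have "0 \<le> inverse m * real t" using m_pos by simp
  then show 1: "\<lfloor>inverse m * real t\<rfloor> = int (n0 t)" by (simp add: n0_def)
  show "real (n0 t) \<le> inverse m * real t" "inverse m * real t < real (n0 t) + 1"
    using of_int_floor_le[of "inverse m * real t"] real_of_int_floor_add_one_gt[of "inverse m * real t"] 1 by auto
qed

lemma n0_diff: "\<bar>inverse m * real t - real (n0 t)\<bar> \<le> 1"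
  using n0(2,3)[of t] by linarith

lemma sum_int_atLeastLessThan: "(\<Sum>k\<in>{0..<int n}. f k) = (\<Sum>k<n. f (int k))"
  by (rule sum.reindex_cong[of int]) (auto simp: image_int_atLeastLessThan[of 0 n, simplified] lessThan_atLeast0)

text \<open>The centring is one Newton step for solving H(n) = t, started at t / m with slope
  \<open>m\<close>. The middle term is the error of rounding t / m down to a site.\<close>

lemma centre_eq: "centre t = inverse m * real t + (inverse m * real t - real (n0 t)) - S (n0 t) / m"
proof -
  have "H_sum a (inverse m * real t) = S (n0 t) + m * real (n0 t)"
    by (simp only: H_sum_def n0(1) sum_int_atLeastLessThan) (simp add: S_eq)
  then show ?thesis using m_pos by (simp add: centre_def field_simps)
qed

lemma centre_bound: "\<exists>C. 0 \<le> C \<and> eventually (\<lambda>t. \<bar>centre t - inverse m * real t\<bar> \<le> C * real t powr (5/8)) sequentially"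
proof -
  obtain C where C: "\<And>n. \<bar>S n\<bar> \<le> C + real n powr (5/8)" using S_bound by blast
  define D where "D = 1 + (\<bar>C\<bar> + inverse m powr (5/8)) / m"
  show ?thesis
  proof (intro exI conjI)
    show "0 \<le> D" using m_pos by (simp add: D_def)
    show "eventually (\<lambda>t. \<bar>centre t - inverse m * real t\<bar> \<le> D * real t powr (5/8)) sequentially"
      using eventually_ge_at_top[of 1]
    proof eventually_elim
      case (elim t)
      have t: "1 \<le> real t" using elim by simp
      then have tp: "1 \<le> real t powr (5/8)" by (simp add: ge_one_powr_ge_zero)
      have "\<bar>S (n0 t)\<bar> \<le> \<bar>C\<bar> + (inverse m * real t) powr (5/8)"
      proof -
        have "real (n0 t) powr (5/8) \<le> (inverse m * real t) powr (5/8)" using n0(2) by (intro powr_mono2) auto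
        then show ?thesis using C[of "n0 t"] by linarith
      qed
      also have "\<dots> \<le> \<bar>C\<bar> * real t powr (5/8) + inverse m powr (5/8) * real t powr (5/8)"
        using m_pos tp mult_left_mono[OF tp, of "\<bar>C\<bar>"] by (simp add: powr_mult)
      finally have "\<bar>S (n0 t)\<bar> / m \<le> (\<bar>C\<bar> + inverse m powr (5/8)) * real t powr (5/8) / m"
        using m_pos by (intro divide_right_mono) (auto simp: algebra_simps)
      moreover have "\<bar>inverse m * real t - real (n0 t)\<bar> \<le> real t powr (5/8)" using n0[of t] tp by (simp add: abs_le_iff)
      moreover have "\<bar>centre t - inverse m * real t\<bar> \<le> \<bar>inverse m * real t - real (n0 t)\<bar> + \<bar>S (n0 t)\<bar> / m"
        unfolding centre_eq using m_pos abs_triangle_ineq4[of "inverse m * real t - real (n0 t)" "S (n0 t) / m"] by simp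
      ultimately show ?case by (simp add: D_def algebra_simps)
    qed
  qed
qed

definition sig :: real where
  "sig = sqrt (inverse m ^ 3 * s2)"

lemma sig_pos: "0 < sig"
  using m_pos s2_pos by (simp add: sig_def)

definition endpt :: "real \<Rightarrow> nat \<Rightarrow> real" where
  "endpt x t = centre t + sqrt (real t) * sig * x"

lemma endpt_bound: "\<exists>C. 0 \<le> C \<and> eventually (\<lambda>t. \<bar>endpt x t - inverse m * real t\<bar> \<le> C * real t powr (5/8)) sequentially"
proof -
  obtain C where C: "0 \<le> C" "eventually (\<lambda>t. \<bar>centre t - inverse m * real t\<bar> \<le> C * real t powr (5/8)) sequentially"
    using centre_bound by blast
  have "eventually (\<lambda>t. \<bar>endpt x t - inverse m * real t\<bar> \<le> (C + \<bar>sig * x\<bar>) * real t powr (5/8)) sequentially"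
    using C(2) eventually_ge_at_top[of 1]
  proof eventually_elim
    case (elim t)
    have "sqrt (real t) = real t powr (1/2)" by (simp add: powr_half_sqrt)
    also have "\<dots> \<le> real t powr (5/8)" using elim by (intro powr_mono) auto
    finally have "\<bar>sqrt (real t) * sig * x\<bar> \<le> real t powr (5/8) * \<bar>sig * x\<bar>"
      by (simp add: abs_mult mult.assoc mult_right_mono)
    then show ?case using elim unfolding endpt_def by (simp add: algebra_simps)
  qed
  then show ?thesis using C(1) by (intro exI[of _ "C + \<bar>sig * x\<bar>"]) auto
qed

text \<open>The index \<alpha> may be off the end point by a full sqrt t, so the same lemma serves
  for rounded end points and for levels shifted by the fall-back distance. In the constant,
  \<open>C\<close> measures the distance from the end point to t / m, the two units cover the
  deviations of \<alpha> and \<beta>, and \<open>inverse m\<close> covers t / m itself.\<close>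

lemma endpt_window:
  assumes n: "eventually (\<lambda>t. \<bar>real (\<alpha> t) - endpt x t\<bar> \<le> sqrt (real t)) sequentially"
    and \<beta>: "eventually (\<lambda>t. \<bar>real (\<beta> t) - inverse m * real t\<bar> \<le> 1) sequentially"
  shows "(\<lambda>t. (S (\<alpha> t) - S (\<beta> t)) / sqrt (real t)) \<longlonglongrightarrow> 0"
proof -
  obtain C where C: "0 \<le> C" "eventually (\<lambda>t. \<bar>endpt x t - inverse m * real t\<bar> \<le> C * real t powr (5/8)) sequentially"
    using endpt_bound by blast
  show ?thesis
  proof (rule S_window_tendsto[where C = "C + 2 + inverse m"])
    show "eventually (\<lambda>t. real (\<alpha> t) \<le> (C + 2 + inverse m) * real t \<and> real (\<beta> t) \<le> (C + 2 + inverse m) * real t \<and>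
      \<bar>real (\<alpha> t) - real (\<beta> t)\<bar> \<le> (C + 2 + inverse m) * real t powr (5/8)) sequentially"
      using n \<beta> C(2) eventually_ge_at_top[of 1]
    proof eventually_elim
      case (elim t)
      have t: "1 \<le> real t" using elim by simp
      have t1: "real t powr (5/8) \<le> real t" "1 \<le> real t powr (5/8)"
        using powr_mono[of "5/8" 1 "real t"] ge_one_powr_ge_zero[OF t, of "5/8"] t by auto
      have "sqrt (real t) = real t powr (1/2)" by (simp add: powr_half_sqrt)
      also have "\<dots> \<le> real t powr (5/8)" using t by (intro powr_mono) auto
      finally have t2: "sqrt (real t) \<le> real t powr (5/8)" .
      have Ct: "C * real t powr (5/8) \<le> C * real t" using C(1) t1 by (intro mult_left_mono)
      have 1: "\<bar>real (\<alpha> t) - real (\<beta> t)\<bar> \<le> C * real t powr (5/8) + 2 * real t powr (5/8)"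
        using elim t2 t1 by linarith
      have "0 \<le> inverse m * real t powr (5/8)" using m_pos by simp
      with 1 have "\<bar>real (\<alpha> t) - real (\<beta> t)\<bar> \<le> (C + 2 + inverse m) * real t powr (5/8)"
        by (simp add: algebra_simps)
      moreover have "real (\<alpha> t) \<le> C * real t + 2 * real t + inverse m * real t"
        using elim t2 t1 Ct by linarith
      moreover have "real (\<beta> t) \<le> C * real t + 2 * real t + inverse m * real t"
        using elim t C(1) mult_nonneg_nonneg[of C "real t"] by linarith
      ultimately show ?case by (simp add: algebra_simps)
    qed
  qed
qed

lemma endpt_at_top: "filterlim (endpt x) at_top sequentially"
proof -
  obtain C where C: "0 \<le> C" "eventually (\<lambda>t. \<bar>endpt x t - inverse m * real t\<bar> \<le> C * real t powr (5/8)) sequentially"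
    using endpt_bound by blast
  have "filterlim (\<lambda>t::nat. inverse m * real t - C * real t powr (5/8)) at_top sequentially"
    using m_pos by real_asymp
  moreover have "eventually (\<lambda>t. inverse m * real t - C * real t powr (5/8) \<le> endpt x t) sequentially"
    using C(2) by eventually_elim linarith
  ultimately show ?thesis by (rule filterlim_at_top_mono)
qed

lemma endpt_ratio: "(\<lambda>t. endpt x t / real t) \<longlonglongrightarrow> inverse m"
proof -
  obtain C where C: "0 \<le> C" "eventually (\<lambda>t. \<bar>endpt x t - inverse m * real t\<bar> \<le> C * real t powr (5/8)) sequentially"
    using endpt_bound by blast
  have "(\<lambda>t. endpt x t / real t - inverse m) \<longlonglongrightarrow> 0"
  proof (rule Lim_null_comparison)
    show "eventually (\<lambda>t. norm (endpt x t / real t - inverse m) \<le> C * real t powr (5/8) / real t) sequentially"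
      using C(2) eventually_ge_at_top[of 1]
    proof eventually_elim
      case (elim t)
      have "endpt x t / real t - inverse m = (endpt x t - inverse m * real t) / real t"
        using elim by (simp add: field_simps)
      then show ?case using elim by (simp add: divide_right_mono)
    qed
    show "(\<lambda>t::nat. C * real t powr (5/8) / real t) \<longlonglongrightarrow> 0" by real_asymp
  qed
  then show ?thesis by (simp add: LIM_zero_iff)
qed

lemma floor_endpt:
  "eventually (\<lambda>t. \<lfloor>endpt x t\<rfloor> = int (nat \<lfloor>endpt x t\<rfloor>) \<and> \<bar>real (nat \<lfloor>endpt x t\<rfloor>) - endpt x t\<bar> \<le> 1) sequentially"
  using endpt_at_top[of x, unfolded filterlim_at_top, rule_format, of 0]
proof eventually_elim
  case (elim t)
  then have 1: "\<lfloor>endpt x t\<rfloor> = int (nat \<lfloor>endpt x t\<rfloor>)" by simp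
  from elim have "real (nat \<lfloor>endpt x t\<rfloor>) = real_of_int \<lfloor>endpt x t\<rfloor>" by simp
  with 1 show ?case
    using of_int_floor_le[of "endpt x t"] real_of_int_floor_add_one_gt[of "endpt x t"]
    by (simp only: abs_le_iff) linarith
qed

text \<open>The first difference is the sum when \<open>i \<le> j\<close>, the second one when
  \<open>j < i\<close>; both end points are counted in either orientation, whence the two shifts by
  \<open>Suc\<close>. Adding the absolute values spares a case distinction in the limit.\<close>

lemma sum_between_nat:
  assumes "\<lfloor>b1\<rfloor> = int i" "\<lfloor>b2\<rfloor> = int j"
  shows "\<bar>sum_between (\<lambda>k. mu k - m) b1 b2\<bar> \<le> \<bar>S (Suc j) - S i\<bar> + \<bar>S j - S (Suc i)\<bar>"
proof -
  have s: "(\<Sum>k\<in>{int i..int j}. mu k - m) = S (Suc j) - S i" if "i \<le> j" for i j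
  proof -
    have e: "{0..<int (Suc j)} = {0..<int i} \<union> {int i..int j}" using that by auto
    have "S (Suc j) = (\<Sum>k\<in>{0..<int (Suc j)}. mu k - m)" by (simp only: sum_int_atLeastLessThan S_def)
    also have "\<dots> = S i + (\<Sum>k\<in>{int i..int j}. mu k - m)"
      unfolding e by (subst sum.union_disjoint) (auto simp: sum_int_atLeastLessThan S_def)
    finally show ?thesis by simp
  qed
  show ?thesis
  proof (cases "i \<le> j")
    case True
    then show ?thesis unfolding sum_between_def assms by (simp add: s)
  next
    case False
    then show ?thesis unfolding sum_between_def assms by (simp add: s)
  qed
qed

theorem correction_negligible:
  "(\<lambda>t::nat. real t powr (- 1 / 2) * sum_between (\<lambda>k. mu k - m) (inverse m * real t) (endpt x t)) \<longlonglongrightarrow> 0"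
proof -
  define j where "j t = nat \<lfloor>endpt x t\<rfloor>" for t
  have j: "eventually (\<lambda>t. \<lfloor>endpt x t\<rfloor> = int (j t) \<and> \<bar>real (j t) - endpt x t\<bar> \<le> 1) sequentially"
    unfolding j_def by (rule floor_endpt)
  have sq: "eventually (\<lambda>t. 2 \<le> sqrt (real t)) sequentially" by real_asymp
  have 1: "(\<lambda>t. (S (Suc (j t)) - S (n0 t)) / sqrt (real t)) \<longlonglongrightarrow> 0"
  proof (rule endpt_window)
    show "eventually (\<lambda>t. \<bar>real (Suc (j t)) - endpt x t\<bar> \<le> sqrt (real t)) sequentially"
      using j sq by eventually_elim (unfold of_nat_Suc, linarith)
    show "eventually (\<lambda>t. \<bar>real (n0 t) - inverse m * real t\<bar> \<le> 1) sequentially"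
      using n0(2,3) by (intro always_eventually allI) (smt (verit))
  qed
  have 2: "(\<lambda>t. (S (j t) - S (Suc (n0 t))) / sqrt (real t)) \<longlonglongrightarrow> 0"
  proof (rule endpt_window)
    show "eventually (\<lambda>t. \<bar>real (j t) - endpt x t\<bar> \<le> sqrt (real t)) sequentially"
      using j sq by eventually_elim linarith
    show "eventually (\<lambda>t. \<bar>real (Suc (n0 t)) - inverse m * real t\<bar> \<le> 1) sequentially"
      using n0(2,3) by (intro always_eventually allI) (smt (verit) of_nat_Suc)
  qed
  have 3: "(\<lambda>t. \<bar>(S (Suc (j t)) - S (n0 t)) / sqrt (real t)\<bar> + \<bar>(S (j t) - S (Suc (n0 t))) / sqrt (real t)\<bar>) \<longlonglongrightarrow> \<bar>0\<bar> + \<bar>0\<bar>"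
    by (intro tendsto_intros 1 2)
  show ?thesis
  proof (rule Lim_null_comparison)
    show "eventually (\<lambda>t. norm (real t powr (- 1 / 2) * sum_between (\<lambda>k. mu k - m) (inverse m * real t) (endpt x t))
      \<le> \<bar>(S (Suc (j t)) - S (n0 t)) / sqrt (real t)\<bar> + \<bar>(S (j t) - S (Suc (n0 t))) / sqrt (real t)\<bar>) sequentially"
      using j eventually_ge_at_top[of 1]
    proof eventually_elim
      case (elim t)
      have p: "real t powr (- 1 / 2) = 1 / sqrt (real t)"
        using elim powr_minus_divide[of "real t" "1/2"] by (simp add: powr_half_sqrt)
      have "\<bar>sum_between (\<lambda>k. mu k - m) (inverse m * real t) (endpt x t)\<bar> \<le> \<bar>S (Suc (j t)) - S (n0 t)\<bar> + \<bar>S (j t) - S (Suc (n0 t))\<bar>"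
        using elim by (intro sum_between_nat n0(1)) auto
      then show ?case unfolding p by (simp add: abs_mult add_divide_distrib[symmetric] divide_right_mono)
    qed
    show "(\<lambda>t. \<bar>(S (Suc (j t)) - S (n0 t)) / sqrt (real t)\<bar> + \<bar>(S (j t) - S (Suc (n0 t))) / sqrt (real t)\<bar>) \<longlonglongrightarrow> 0"
      using 3 by simp
  qed
qed

text \<open>Inserting the Newton form of the centring leaves in t - H(\<alpha>) a window sum, a
  rounding error, \<open>m\<close> times the distance from \<alpha> to the end point, and m sig x
  sqrt t. Only the last survives division by sqrt t. As the normalisation is asymptotic to sqrt (s2
  t / m), the limit is - x precisely for the chosen \<open>sig\<close>.\<close>

lemma scaled_deviation_tendsto:
  assumes n: "(\<lambda>t. (real (\<alpha> t) - endpt x t) / sqrt (real t)) \<longlonglongrightarrow> 0"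
  shows "(\<lambda>t. (real t - (\<Sum>k<\<alpha> t. mu (int k))) / sqrt (s2 * real (\<alpha> t))) \<longlonglongrightarrow> - x"
    and "filterlim \<alpha> at_top sequentially"
    and "(\<lambda>t. real (\<alpha> t) / real t) \<longlonglongrightarrow> inverse m"
proof -
  have "eventually (\<lambda>t. \<bar>(real (\<alpha> t) - endpt x t) / sqrt (real t)\<bar> < 1) sequentially"
    using tendsto_rabs[OF n] by (intro order_tendstoD) auto
  then have n1: "eventually (\<lambda>t. \<bar>real (\<alpha> t) - endpt x t\<bar> \<le> sqrt (real t)) sequentially"
    using eventually_gt_at_top[of 0] by eventually_elim (simp add: abs_divide)
  have Sn: "(\<lambda>t. (S (\<alpha> t) - S (n0 t)) / sqrt (real t)) \<longlonglongrightarrow> 0"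
  proof (rule endpt_window[OF n1])
    show "eventually (\<lambda>t. \<bar>real (n0 t) - inverse m * real t\<bar> \<le> 1) sequentially"
      using n0(2,3) by (intro always_eventually allI) (smt (verit))
  qed
  have r0: "(\<lambda>t. (inverse m * real t - real (n0 t)) / sqrt (real t)) \<longlonglongrightarrow> 0"
  proof (rule Lim_null_comparison)
    show "eventually (\<lambda>t. norm ((inverse m * real t - real (n0 t)) / sqrt (real t)) \<le> 1 / sqrt (real t)) sequentially"
      by (intro always_eventually allI) (simp add: divide_right_mono n0_diff)
    show "(\<lambda>t::nat. 1 / sqrt (real t)) \<longlonglongrightarrow> 0" by real_asymp
  qed
  let ?E = "\<lambda>t. - ((S (\<alpha> t) - S (n0 t)) / sqrt (real t)) - m * ((inverse m * real t - real (n0 t)) / sqrt (real t))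
     - m * ((real (\<alpha> t) - endpt x t) / sqrt (real t)) - m * sig * x"
  have "?E \<longlonglongrightarrow> - 0 - m * 0 - m * 0 - m * sig * x" by (intro tendsto_intros Sn r0 n)
  moreover have "eventually (\<lambda>t. ?E t = (real t - (\<Sum>k<\<alpha> t. mu (int k))) / sqrt (real t)) sequentially"
    using eventually_gt_at_top[of 0]
  proof eventually_elim
    case (elim t)
    then have st: "0 < sqrt (real t)" by simp
    have c: "S (n0 t) = m * (inverse m * real t + (inverse m * real t - real (n0 t)) - centre t)"
      using m_pos unfolding centre_eq by simp
    have "real t - (\<Sum>k<\<alpha> t. mu (int k)) = - (S (\<alpha> t) - S (n0 t)) - m * (inverse m * real t - real (n0 t))
       - m * (real (\<alpha> t) - endpt x t) - m * sig * x * sqrt (real t)"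
      using m_pos unfolding c S_eq[of "\<alpha> t"] endpt_def by (simp add: algebra_simps)
    moreover have "- (A / r) - m * (B / r) - m * (C / r) - D = P / r" if "P = - A - m * B - m * C - D * r" "0 < r" for A B C D P r :: real
      unfolding that(1) using that(2) by (simp add: diff_divide_distrib)
    ultimately show ?case using st by blast
  qed
  ultimately have num: "(\<lambda>t. (real t - (\<Sum>k<\<alpha> t. mu (int k))) / sqrt (real t)) \<longlonglongrightarrow> - (m * sig * x)"
    by (auto dest: Lim_transform_eventually)
  have "(\<lambda>t. (real (\<alpha> t) - endpt x t) / sqrt (real t) * (1 / sqrt (real t)) + endpt x t / real t) \<longlonglongrightarrow> 0 * 0 + inverse m"
    by (intro tendsto_intros n endpt_ratio) real_asymp
  moreover have "eventually (\<lambda>t. (real (\<alpha> t) - endpt x t) / sqrt (real t) * (1 / sqrt (real t)) + endpt x t / real t = real (\<alpha> t) / real t) sequentially"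
    using eventually_gt_at_top[of 0] by eventually_elim (simp add: add_divide_distrib[symmetric])
  ultimately show ratio: "(\<lambda>t. real (\<alpha> t) / real t) \<longlonglongrightarrow> inverse m"
    by (auto dest: Lim_transform_eventually)
  then have "(\<lambda>t. sqrt (s2 * (real (\<alpha> t) / real t))) \<longlonglongrightarrow> sqrt (s2 * inverse m)"
    by (intro tendsto_intros)
  then have quot: "(\<lambda>t. ((real t - (\<Sum>k<\<alpha> t. mu (int k))) / sqrt (real t)) / sqrt (s2 * (real (\<alpha> t) / real t))) \<longlonglongrightarrow> - (m * sig * x) / sqrt (s2 * inverse m)"
    using s2_pos m_pos by (intro tendsto_divide num) auto
  have c: "- (m * sig * x) / sqrt (s2 * inverse m) = - x"
  proof -
    have "m * sig = sqrt (m\<^sup>2) * sqrt (inverse m ^ 3 * s2)" using m_pos by (simp add: sig_def)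
    also have "\<dots> = sqrt (m\<^sup>2 * (inverse m ^ 3 * s2))" by (simp only: real_sqrt_mult)
    also have "m\<^sup>2 * (inverse m ^ 3 * s2) = s2 * inverse m"
      using m_pos by (simp add: power2_eq_square power3_eq_cube field_simps)
    finally show ?thesis using s2_pos m_pos by simp
  qed
  have ev: "eventually (\<lambda>t. ((real t - (\<Sum>k<\<alpha> t. mu (int k))) / sqrt (real t)) / sqrt (s2 * (real (\<alpha> t) / real t))
      = (real t - (\<Sum>k<\<alpha> t. mu (int k))) / sqrt (s2 * real (\<alpha> t))) sequentially"
    using eventually_gt_at_top[of 0] by eventually_elim (simp add: real_sqrt_mult real_sqrt_divide)
  show "(\<lambda>t. (real t - (\<Sum>k<\<alpha> t. mu (int k))) / sqrt (s2 * real (\<alpha> t))) \<longlonglongrightarrow> - x"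
    by (rule Lim_transform_eventually[OF quot[unfolded c] ev])
  have "filterlim (\<lambda>t. real (\<alpha> t) / real t * real t) at_top sequentially"
    using m_pos by (intro filterlim_tendsto_pos_mult_at_top[OF ratio] filterlim_real_sequentially) simp
  then have "filterlim (\<lambda>t. real (\<alpha> t)) at_top sequentially"
    by (rule filterlim_mono_eventually[OF _ order_refl order_refl])
      (rule eventually_mono[OF eventually_gt_at_top[of 0]], simp)
  then show "filterlim \<alpha> at_top sequentially"
    by (simp add: filterlim_sequentially_iff_filterlim_real)
qed

text \<open>Both the level \<alpha> and the argument of the distribution function move with t, so
  convergence has to be uniform in the argument before the limit can be taken.\<close>

lemma survival_tendsto:
  assumes n: "(\<lambda>t. (real (\<alpha> t) - endpt x t) / sqrt (real t)) \<longlonglongrightarrow> 0"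
  shows "(\<lambda>t. survival a t 0 (int (\<alpha> t))) \<longlonglongrightarrow> cdf std_normal_distribution x"
proof -
  let ?\<Phi> = "cdf std_normal_distribution"
  interpret Z: real_distribution "scaled_hit s2 n" for n by (rule real_distribution_scaled_hit)
  interpret N: real_distribution std_normal_distribution by (rule real_dist_normal_dist)
  have cont: "isCont ?\<Phi> y" for y using continuous_cdf_std_normal by (simp add: continuous_on_eq_continuous_at)
  have "weak_conv_m (scaled_hit s2) std_normal_distribution"
    by (rule hitting_time_clt[OF s2_pos var_limit lindeberg])
  then have "(\<lambda>n. cdf (scaled_hit s2 n) y) \<longlonglongrightarrow> ?\<Phi> y" for y
    using cont by (auto simp: weak_conv_m_def weak_conv_def)
  then have unif: "uniform_limit UNIV (\<lambda>n. cdf (scaled_hit s2 n)) ?\<Phi> sequentially"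
    by (intro uniform_limit_cdf[OF real_dist_normal_dist refl continuous_cdf_std_normal])
      (auto simp: mono_def Z.cdf_nondecreasing Z.cdf_nonneg Z.cdf_bounded_prob)
  define \<theta> where "\<theta> t = (real t - (\<Sum>k<\<alpha> t. mu (int k))) / sqrt (s2 * real (\<alpha> t))" for t
  note lims = scaled_deviation_tendsto[OF n, folded \<theta>_def]
  have "(\<lambda>t. cdf (scaled_hit s2 (\<alpha> t)) (\<theta> t) - ?\<Phi> (\<theta> t)) \<longlonglongrightarrow> 0"
  proof (rule tendstoI)
    fix e :: real assume "0 < e"
    with unif have "eventually (\<lambda>n. \<forall>y\<in>UNIV. dist (cdf (scaled_hit s2 n) y) (?\<Phi> y) < e) sequentially"
      by (rule uniform_limitD)
    then have "eventually (\<lambda>t. \<forall>y\<in>UNIV. dist (cdf (scaled_hit s2 (\<alpha> t)) y) (?\<Phi> y) < e) sequentially"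
      using lims(2) by (rule eventually_compose_filterlim)
    then show "eventually (\<lambda>t. dist (cdf (scaled_hit s2 (\<alpha> t)) (\<theta> t) - ?\<Phi> (\<theta> t)) 0 < e) sequentially"
      by eventually_elim (simp add: dist_real_def)
  qed
  moreover have "(\<lambda>t. ?\<Phi> (\<theta> t)) \<longlonglongrightarrow> ?\<Phi> (- x)"
    by (rule isCont_tendsto_compose[OF cont lims(1)])
  ultimately have "(\<lambda>t. (cdf (scaled_hit s2 (\<alpha> t)) (\<theta> t) - ?\<Phi> (\<theta> t)) + ?\<Phi> (\<theta> t)) \<longlonglongrightarrow> 0 + ?\<Phi> (- x)"
    by (rule tendsto_add)
  then have "(\<lambda>t. 1 - cdf (scaled_hit s2 (\<alpha> t)) (\<theta> t)) \<longlonglongrightarrow> 1 - ?\<Phi> (- x)"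
    by (intro tendsto_intros) simp
  moreover have "eventually (\<lambda>t. 0 < \<alpha> t) sequentially"
    by (rule eventually_compose_filterlim[OF eventually_gt_at_top lims(2)])
  then have "eventually (\<lambda>t. 1 - cdf (scaled_hit s2 (\<alpha> t)) (\<theta> t) = survival a t 0 (int (\<alpha> t))) sequentially"
    by eventually_elim (simp add: survival_eq_cdf[OF s2_pos] \<theta>_def)
  ultimately show ?thesis
    by (auto dest: Lim_transform_eventually simp: cdf_std_normal_uminus)
qed

text \<open>Sandwich for the event X(t) \<le> w. It contains the event that w + 1 is not yet hit,
  and up to the fall-back probability it is contained in the event that w + l(w) is not yet hit.
  Both levels differ from the end point by o(sqrt t), so the two bounds have the same limit.\<close>

lemma prob_position_tendsto:
  "(\<lambda>t. measure (law 0) {X. real_of_int (X t) \<le> endpt x t}) \<longlonglongrightarrow> cdf std_normal_distribution x"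
proof -
  define w where "w t = nat \<lfloor>endpt x t\<rfloor>" for t
  have w: "eventually (\<lambda>t. \<lfloor>endpt x t\<rfloor> = int (w t) \<and> \<bar>real (w t) - endpt x t\<bar> \<le> 1) sequentially"
    unfolding w_def by (rule floor_endpt)
  have wt: "(\<lambda>t. (real (w t) - endpt x t) / sqrt (real t)) \<longlonglongrightarrow> 0"
  proof (rule Lim_null_comparison)
    show "eventually (\<lambda>t. norm ((real (w t) - endpt x t) / sqrt (real t)) \<le> 1 / sqrt (real t)) sequentially"
      using w by eventually_elim (auto intro!: divide_right_mono)
    show "(\<lambda>t::nat. 1 / sqrt (real t)) \<longlonglongrightarrow> 0" by real_asymp
  qed
  have wtop: "filterlim w at_top sequentially" by (rule scaled_deviation_tendsto(2)[OF wt])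
  have ratio: "(\<lambda>t. real (w t) / real t) \<longlonglongrightarrow> inverse m" by (rule scaled_deviation_tendsto(3)[OF wt])
  have lw: "(\<lambda>t. real (l (w t)) / sqrt (real t)) \<longlonglongrightarrow> 0"
  proof -
    have "(\<lambda>t. real (l (w t)) / sqrt (real (w t)) * sqrt (real (w t) / real t)) \<longlonglongrightarrow> 0 * sqrt (inverse m)"
      by (intro tendsto_intros ratio filterlim_compose[OF l_small wtop])
    moreover have "eventually (\<lambda>t. real (l (w t)) / sqrt (real (w t)) * sqrt (real (w t) / real t) = real (l (w t)) / sqrt (real t)) sequentially"
      using eventually_compose_filterlim[OF eventually_gt_at_top[of 0] wtop]
      by eventually_elim (simp add: real_sqrt_divide)
    ultimately show ?thesis by (auto dest: Lim_transform_eventually)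
  qed
  have lower: "(\<lambda>t. survival a t 0 (int (w t + 1))) \<longlonglongrightarrow> cdf std_normal_distribution x"
  proof (rule survival_tendsto)
    have "(\<lambda>t. (real (w t) - endpt x t) / sqrt (real t) + 1 / sqrt (real t)) \<longlonglongrightarrow> 0 + 0"
      by (intro tendsto_add wt) real_asymp
    then show "(\<lambda>t. (real (w t + 1) - endpt x t) / sqrt (real t)) \<longlonglongrightarrow> 0"
      by (simp add: add_divide_distrib diff_divide_distrib algebra_simps)
  qed
  have upper1: "(\<lambda>t. survival a t 0 (int (w t + l (w t)))) \<longlonglongrightarrow> cdf std_normal_distribution x"
  proof (rule survival_tendsto)
    have "(\<lambda>t. (real (w t) - endpt x t) / sqrt (real t) + real (l (w t)) / sqrt (real t)) \<longlonglongrightarrow> 0 + 0"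
      by (intro tendsto_add wt lw)
    then show "(\<lambda>t. (real (w t + l (w t)) - endpt x t) / sqrt (real t)) \<longlonglongrightarrow> 0"
      by (simp add: add_divide_distrib diff_divide_distrib algebra_simps)
  qed
  have upper: "(\<lambda>t. survival a t 0 (int (w t + l (w t))) + ladder_tail a (int (w t)) (int (w t) + int (l (w t)))) \<longlonglongrightarrow> cdf std_normal_distribution x + 0"
    by (intro tendsto_add upper1 filterlim_compose[OF ladder wtop])
  have eq: "eventually (\<lambda>t. {X. real_of_int (X t) \<le> endpt x t} = {X. X t \<le> int (w t)}) sequentially"
    using w by eventually_elim (auto simp: le_floor_iff[symmetric])
  show ?thesis
  proof (rule tendsto_sandwich[OF _ _ lower])
    show "eventually (\<lambda>t. survival a t 0 (int (w t + 1)) \<le> measure (law 0) {X. real_of_int (X t) \<le> endpt x t}) sequentially"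
      using eq
    proof eventually_elim
      case (elim t)
      show ?case unfolding elim using survival_le_prob_position[of 0 "int (w t)" t] by (simp add: add.commute)
    qed
    show "eventually (\<lambda>t. measure (law 0) {X. real_of_int (X t) \<le> endpt x t} \<le>
        survival a t 0 (int (w t + l (w t))) + ladder_tail a (int (w t)) (int (w t) + int (l (w t)))) sequentially"
      using eq
    proof eventually_elim
      case (elim t)
      show ?case unfolding elim using prob_position_le_survival[OF ladder_summable, of "int (w t)" "int (w t) + int (l (w t))" 0 t] by simp
    qed
    show "(\<lambda>t. survival a t 0 (int (w t + l (w t))) + ladder_tail a (int (w t)) (int (w t) + int (l (w t)))) \<longlonglongrightarrow> cdf std_normal_distribution x"
      using upper by simp
  qed
qed

theorem quenched_clt:
  "uniform_limit UNIV
     (\<lambda>(t::nat) (x::real). measure (law 0) {X \<in> space (law 0). (real_of_int (X t) - centre t) / (sqrt (real t) * sig) \<le> x})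
     (cdf std_normal_distribution) sequentially"
proof (rule uniform_limit_cdf[OF real_dist_normal_dist refl continuous_cdf_std_normal])
  show "mono (\<lambda>x. measure (law 0) {X \<in> space (law 0). (real_of_int (X t) - centre t) / (sqrt (real t) * sig) \<le> x})" for t
  proof (rule monoI, rule law.finite_measure_mono)
    fix y :: real
    have "{X. (real_of_int (X t) - centre t) / (sqrt (real t) * sig) \<le> y} \<in> sets path_space"
      by (rule sets_path_pred) measurable
    then show "{X \<in> space (law 0). (real_of_int (X t) - centre t) / (sqrt (real t) * sig) \<le> y} \<in> sets (law 0)"
      by (simp add: space_quenched_law sets_quenched_law)
  qed auto
  fix x
  show "(\<lambda>t. measure (law 0) {X \<in> space (law 0). (real_of_int (X t) - centre t) / (sqrt (real t) * sig) \<le> x}) \<longlonglongrightarrow> cdf std_normal_distribution x"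
  proof (rule Lim_transform_eventually[OF prob_position_tendsto])
    show "eventually (\<lambda>t. measure (law 0) {X. real_of_int (X t) \<le> endpt x t} =
       measure (law 0) {X \<in> space (law 0). (real_of_int (X t) - centre t) / (sqrt (real t) * sig) \<le> x}) sequentially"
      using eventually_gt_at_top[of 0]
    proof eventually_elim
      case (elim t)
      then have "0 < sqrt (real t) * sig" using sig_pos by simp
      then have "(real_of_int (X t) - centre t) / (sqrt (real t) * sig) \<le> x \<longleftrightarrow> real_of_int (X t) \<le> endpt x t" for X
        by (simp add: pos_divide_le_eq endpt_def algebra_simps)
      then show ?case by (simp add: space_quenched_law)
    qed
  qed
qed auto

end

section \<open>The random environment\<close>

text \<open>Monotone convergence with a finite bound, phrased with \<open>lim\<close> so that the
  limit is a real-valued measurable function everywhere; its values on the exceptional null set are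
  arbitrary. It is applied to the truncated means, the truncated variances and the ladder
  sums.\<close>

lemma monotone_bounded_integral:
  fixes f :: "nat \<Rightarrow> 'a \<Rightarrow> real"
  assumes f: "\<And>n. integrable M (f n)" "\<And>n x. x \<in> space M \<Longrightarrow> 0 \<le> f n x"
    and mono: "\<And>n x. x \<in> space M \<Longrightarrow> f n x \<le> f (Suc n) x"
    and B: "\<And>n. integral\<^sup>L M (f n) \<le> B"
  shows "AE x in M. convergent (\<lambda>n. f n x)"
    and "integrable M (\<lambda>x. lim (\<lambda>n. f n x))"
    and "(\<integral>x. lim (\<lambda>n. f n x) \<partial>M) \<le> B"
proof -
  have [measurable]: "f n \<in> borel_measurable M" for n using f(1) by auto
  let ?g = "\<lambda>x. SUP n. ennreal (f n x)"
  have "0 \<le> integral\<^sup>L M (f 0)" using f(2) by (intro integral_nonneg_AE AE_I2)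
  then have B0: "0 \<le> B" using B[of 0] by linarith
  have nn: "(\<integral>\<^sup>+x. ennreal (f n x) \<partial>M) = ennreal (integral\<^sup>L M (f n))" for n
    using f by (intro nn_integral_eq_integral AE_I2) auto
  have "(\<integral>\<^sup>+x. ?g x \<partial>M) = (SUP n. \<integral>\<^sup>+x. ennreal (f n x) \<partial>M)"
    using mono by (intro nn_integral_monotone_convergence_SUP_AE AE_I2) (auto intro: ennreal_leI)
  also have "\<dots> \<le> ennreal B" unfolding nn using B by (intro SUP_least ennreal_leI)
  finally have g: "(\<integral>\<^sup>+x. ?g x \<partial>M) \<le> ennreal B" .
  then have "(\<integral>\<^sup>+x. ?g x \<partial>M) \<noteq> \<infinity>" by (auto simp: top_unique)
  then have AEg: "AE x in M. ?g x \<noteq> \<infinity>" by (intro nn_integral_PInf_AE) auto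
  have conv: "convergent (\<lambda>n. f n x) \<and> 0 \<le> lim (\<lambda>n. f n x) \<and> ennreal (lim (\<lambda>n. f n x)) \<le> ?g x"
    if x: "x \<in> space M" and fin: "?g x \<noteq> \<infinity>" for x
  proof -
    have inc: "incseq (\<lambda>n. f n x)" using mono[OF x] by (rule incseq_SucI)
    have ft: "?g x < top" using fin by (metis infinity_ennreal_def top.not_eq_extremum)
    have le: "f n x \<le> enn2real (?g x)" for n
    proof -
      have "ennreal (f n x) \<le> ?g x" by (rule SUP_upper) simp
      then have "enn2real (ennreal (f n x)) \<le> enn2real (?g x)" using ft by (rule enn2real_mono)
      then show ?thesis using f(2)[OF x] by simp
    qed
    then have "\<forall>n. f n x \<le> enn2real (?g x)" by blast
    from incseq_convergent[OF inc this] obtain L where L: "(\<lambda>n. f n x) \<longlonglongrightarrow> L" by blast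
    then have lim: "lim (\<lambda>n. f n x) = L" by (rule limI)
    have "0 \<le> L" using L f(2)[OF x] by (intro LIMSEQ_le_const) auto
    moreover have "L \<le> enn2real (?g x)" using L le by (intro LIMSEQ_le_const2) auto
    then have "ennreal L \<le> ?g x" using fin by (metis ennreal_enn2real ennreal_leI infinity_ennreal_def top.not_eq_extremum)
    ultimately show ?thesis using L lim by (auto simp: convergent_def)
  qed
  show "AE x in M. convergent (\<lambda>n. f n x)"
    using AEg AE_space by eventually_elim (use conv in blast)
  have 1: "AE x in M. ennreal (lim (\<lambda>n. f n x)) \<le> ?g x" "AE x in M. 0 \<le> lim (\<lambda>n. f n x)"
    using AEg AE_space by (eventually_elim, use conv in blast)+
  have m: "(\<lambda>x. lim (\<lambda>n. f n x)) \<in> borel_measurable M" by measurable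
  have le: "(\<integral>\<^sup>+x. ennreal (lim (\<lambda>n. f n x)) \<partial>M) \<le> ennreal B"
    using nn_integral_mono_AE[OF 1(1)] g by (rule order_trans)
  show int: "integrable M (\<lambda>x. lim (\<lambda>n. f n x))"
    using le 1(2) by (intro integrableI_nonneg m) (auto simp: less_top[symmetric] top_unique)
  have "ennreal (\<integral>x. lim (\<lambda>n. f n x) \<partial>M) \<le> ennreal B"
    using nn_integral_eq_integral[OF int 1(2)] le by simp
  then show "(\<integral>x. lim (\<lambda>n. f n x) \<partial>M) \<le> B" using B0 by (simp add: ennreal_le_iff)
qed

section \<open>Shifts, measurability and truncations of the quenched quantities\<close>

lemma mu_env_shift: "mu_env (\<lambda>i. a (i + c)) k = mu_env a (k + c)"
proof -
  have "(\<Prod>i\<in>{k - int j..k}. odds (\<lambda>i. a (i + c)) i) = (\<Prod>i\<in>{k + c - int j..k + c}. odds a i)" for j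
    by (rule prod.reindex_bij_witness[of _ "\<lambda>i. i - c" "\<lambda>i. i + c"]) (auto simp: odds_def)
  then show ?thesis by (simp add: mu_env_def)
qed

lemma hit_pmf_shift:
  assumes "walk_env a"
  shows "hit_pmf (\<lambda>i. a (i + c)) z y = hit_pmf a (z + c) (y + c)"
proof -
  interpret walk_env a by fact
  interpret sh: walk_env "\<lambda>i. a (i + c)" by standard (simp_all add: a_pos a_less_1)
  show ?thesis by (rule pmf_eqI) (simp add: pmf_hit_pmf_eq sh.pmf_hit_pmf_eq first_passage_shift)
qed

lemma var_tau_shift: "walk_env a \<Longrightarrow> var_tau (\<lambda>i. a (i + c)) k = var_tau a (k + c)"
  by (simp add: var_tau_eq hit_pmf_shift algebra_simps)

lemma trunc_var_shift: "walk_env a \<Longrightarrow> trunc_var (\<lambda>i. a (i + c)) K k = trunc_var a K (k + c)"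
  by (simp add: trunc_var_def hit_pmf_shift mu_env_shift algebra_simps)

lemma measurable_odds: "i \<in> U \<Longrightarrow> (\<lambda>x. odds x i) \<in> borel_measurable (PiM U (\<lambda>_. borel))"
  unfolding odds_def by measurable

lemma measurable_mu_env:
  assumes "{..k} \<subseteq> U"
  shows "(\<lambda>x. mu_env x k) \<in> borel_measurable (PiM U (\<lambda>_. borel))"
proof -
  have "(\<lambda>x. \<Prod>i\<in>{k - int j..k}. odds x i) \<in> borel_measurable (PiM U (\<lambda>_. borel))" for j
    using assms by (intro borel_measurable_prod measurable_odds) auto
  note [measurable] = this
  show ?thesis unfolding mu_env_def by measurable
qed

text \<open>Approximates \<open>1 + mu_env a k\<close> from below. Adding 1 turns the recursion of
  the means into Y_k = 2 + A_k Y_(k-1), where the random factor multiplies the whole preceding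
  value.\<close>

fun trunc_mu :: "nat \<Rightarrow> (int \<Rightarrow> real) \<Rightarrow> int \<Rightarrow> real" where
  "trunc_mu 0 a k = 2"
| "trunc_mu (Suc n) a k = 2 + odds a k * trunc_mu n a (k - 1)"

text \<open>Iterates, started from 0, of the recursion required of the variance majorant. Only the
  variance is truncated; the means in the inhomogeneous term are the exact ones.\<close>

fun trunc_v :: "nat \<Rightarrow> (int \<Rightarrow> real) \<Rightarrow> int \<Rightarrow> real" where
  "trunc_v 0 a k = 0"
| "trunc_v (Suc n) a k = odds a k * trunc_v n a (k - 1) + (mu_env a k - 1)\<^sup>2 / (1 - a k)"

lemma trunc_mu_eq: "trunc_mu n a k = 2 + 2 * (\<Sum>j<n. \<Prod>i\<in>{k - int j..k}. odds a i)"
proof (induction n arbitrary: k)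
  case (Suc n)
  have "(\<Prod>i\<in>{k - int (Suc j)..k}. odds a i) = odds a k * (\<Prod>i\<in>{k - 1 - int j..k - 1}. odds a i)" for j
  proof -
    have "{k - int (Suc j)..k} = insert k {k - 1 - int j..k - 1}" by auto
    then show ?thesis by (simp only:) (subst prod.insert, auto)
  qed
  then show ?case
    by (subst sum.lessThan_Suc_shift) (simp add: Suc sum_distrib_left[symmetric] algebra_simps)
qed simp

lemma measurable_trunc_mu: "{..k} \<subseteq> U \<Longrightarrow> (\<lambda>x. trunc_mu n x k) \<in> borel_measurable (PiM U (\<lambda>_. borel))"
proof (induction n arbitrary: k)
  case (Suc n)
  have "{..k - 1} \<subseteq> U" "k \<in> U" using Suc.prems by (auto simp: subset_iff)
  then show ?case using Suc.IH[of "k - 1"] measurable_odds[of k U] by simp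
qed simp

lemma measurable_trunc_v: "{..k} \<subseteq> U \<Longrightarrow> (\<lambda>x. trunc_v n x k) \<in> borel_measurable (PiM U (\<lambda>_. borel))"
proof (induction n arbitrary: k)
  case (Suc n)
  have k: "{..k - 1} \<subseteq> U" "k \<in> U" using Suc.prems by (auto simp: subset_iff)
  have [measurable]: "(\<lambda>x. x k) \<in> borel_measurable (PiM U (\<lambda>_. borel :: real measure))"
    by (rule measurable_component_singleton[OF k(2)])
  show ?case using Suc.IH[OF k(1)] measurable_odds[OF k(2)] measurable_mu_env[OF Suc.prems] by simp
qed simp

text \<open>Dependence on the sites up to \<open>k\<close> alone. Together with measurability on the
  product over those sites it makes such a quantity independent of all later sites.\<close>

lemma mu_env_cong: "(\<And>i. i \<le> k \<Longrightarrow> a i = b i) \<Longrightarrow> mu_env a k = mu_env b k"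
  unfolding mu_env_def odds_def by (auto intro!: arg_cong[where f = suminf] prod.cong)

lemma trunc_mu_cong: "(\<And>i. i \<le> k \<Longrightarrow> a i = b i) \<Longrightarrow> trunc_mu n a k = trunc_mu n b k"
  by (induction n arbitrary: k) (auto simp: odds_def)

lemma trunc_v_cong: "(\<And>i. i \<le> k \<Longrightarrow> a i = b i) \<Longrightarrow> trunc_v n a k = trunc_v n b k"
proof (induction n arbitrary: k)
  case (Suc n)
  have "trunc_v n a (k - 1) = trunc_v n b (k - 1)" using Suc by (intro Suc.IH) auto
  then show ?case using Suc.prems mu_env_cong[of k a b] by (simp add: odds_def)
qed simp

section \<open>Independence in the environment and the choice of the moment exponent\<close>

locale iid_env = prob_space M for M :: "'a measure" +
  fixes T :: "'a \<Rightarrow> 'a" and p :: "'a \<Rightarrow> real"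
  assumes renv: "random_environment M T p"
    and cond: "condition_C' M T p"
    and growth2: "growth_rate M T p 2 < 1"
    and iid: "iid_environment M T p"
begin

abbreviation "E \<equiv> env M T p"

lemma bij_T: "bij_betw T (space M) (space M)"
  and meas_T [measurable]: "T \<in> M \<rightarrow>\<^sub>M M"
  and meas_Tinv [measurable]: "the_inv_into (space M) T \<in> M \<rightarrow>\<^sub>M M"
  and pres_T: "distr M M T = M"
  and meas_p [measurable]: "p \<in> borel_measurable M"
  and p_range: "\<omega> \<in> space M \<Longrightarrow> 0 < p \<omega>" "\<omega> \<in> space M \<Longrightarrow> p \<omega> < 1"
  and ergodic: "ergodic_mpt M T"
  using renv cond unfolding random_environment_def invertible_mpt_def condition_C'_def by auto

lemma meas_int_iterate [measurable]: "int_iterate M T n \<in> M \<rightarrow>\<^sub>M M"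
  unfolding int_iterate_def by (auto intro!: measurable_compose_n)

lemma meas_E [measurable]: "(\<lambda>\<omega>. E \<omega> k) \<in> borel_measurable M"
  unfolding env_def by measurable

lemma walk_env_E: "\<omega> \<in> space M \<Longrightarrow> walk_env (E \<omega>)"
  using measurable_space[OF meas_int_iterate] p_range by (auto simp: walk_env_def env_def)

lemma E_T: 
  assumes \<omega>: "\<omega> \<in> space M"
  shows "E (T \<omega>) k = E \<omega> (k + 1)"
proof (cases "0 \<le> k")
  case True
  then have "nat (k + 1) = Suc (nat k)" by simp
  then show ?thesis using True by (simp add: env_def int_iterate_def funpow_swap1)
next
  case False
  \<comment> \<open>For negative \<open>k\<close> one inverse iterate cancels against
    \<open>T\<close>, and \<open>n\<close> is the number that remain. At \<open>k = -1\<close> none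
    remain and \<open>int_iterate\<close> changes to its nonnegative branch, hence the case
    distinction below.\<close>
  define n where "n = nat (- (k + 1))"
  have n: "nat (- k) = Suc n" using False by (simp add: n_def)
  have inv: "the_inv_into (space M) T (T \<omega>) = \<omega>"
    using bij_T \<omega> by (intro the_inv_into_f_f) (auto simp: bij_betw_def)
  have "int_iterate M T k (T \<omega>) = (the_inv_into (space M) T ^^ n) \<omega>"
    using False n inv by (simp add: int_iterate_def funpow_swap1)
  also have "\<dots> = int_iterate M T (k + 1) \<omega>"
  proof (cases "k = -1")
    case True
    then show ?thesis by (simp add: n_def int_iterate_def)
  next
    case F2: False
    then show ?thesis using False by (simp add: n_def int_iterate_def)
  qed
  finally show ?thesis by (simp add: env_def)
qed

lemma E_T': "\<omega> \<in> space M \<Longrightarrow> E (T \<omega>) = (\<lambda>i. E \<omega> (i + 1))"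
  using E_T by auto

lemma E_funpow:
  assumes "\<omega> \<in> space M"
  shows "E ((T ^^ n) \<omega>) = (\<lambda>i. E \<omega> (i + int n))"
proof (induction n)
  case (Suc n)
  have "(T ^^ n) \<omega> \<in> space M" using measurable_space[OF measurable_compose_n[OF meas_T] assms] .
  then show ?case using Suc E_T'[of "(T ^^ n) \<omega>"] by (simp add: add_ac)
qed simp

lemma measurable_E_PiM: "(\<lambda>\<omega>. restrict (E \<omega>) U) \<in> M \<rightarrow>\<^sub>M PiM U (\<lambda>_. borel)"
  by (rule measurable_restrict) simp

lemma meas_mu [measurable]: "(\<lambda>\<omega>. mu_env (E \<omega>) k) \<in> borel_measurable M"
proof -
  have "(\<lambda>\<omega>. mu_env (restrict (E \<omega>) UNIV) k) \<in> borel_measurable M"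
    using measurable_compose[OF measurable_E_PiM measurable_mu_env[of k UNIV]] by auto
  moreover have "restrict a UNIV = a" for a :: "int \<Rightarrow> real" by (simp add: restrict_def)
  ultimately show ?thesis by simp
qed

lemma meas_odds [measurable]: "(\<lambda>\<omega>. odds (E \<omega>) k) \<in> borel_measurable M"
  unfolding odds_def by measurable

lemma odds_nonneg: "\<omega> \<in> space M \<Longrightarrow> 0 < odds (E \<omega>) k"
  using walk_env.odds_pos[OF walk_env_E] .

lemma indep_E: "indep_vars (\<lambda>_. borel) (\<lambda>n \<omega>. E \<omega> n) UNIV"
  and distr_E: "distr M borel (\<lambda>\<omega>. E \<omega> j) = distr M borel (\<lambda>\<omega>. E \<omega> k)"
  using iid unfolding iid_environment_def by auto

lemma integral_E:
  fixes f :: "real \<Rightarrow> real"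
  assumes [measurable]: "f \<in> borel_measurable borel"
  shows "integrable M (\<lambda>\<omega>. f (E \<omega> j)) \<longleftrightarrow> integrable M (\<lambda>\<omega>. f (E \<omega> k))"
    "(\<integral>\<omega>. f (E \<omega> j) \<partial>M) = (\<integral>\<omega>. f (E \<omega> k) \<partial>M)"
proof -
  have "integrable (distr M borel (\<lambda>\<omega>. E \<omega> i)) f \<longleftrightarrow> integrable M (\<lambda>\<omega>. f (E \<omega> i))" for i
    by (rule integrable_distr_eq) auto
  then show "integrable M (\<lambda>\<omega>. f (E \<omega> j)) \<longleftrightarrow> integrable M (\<lambda>\<omega>. f (E \<omega> k))" using distr_E[of j k] by metis
  have "integral\<^sup>L (distr M borel (\<lambda>\<omega>. E \<omega> i)) f = (\<integral>\<omega>. f (E \<omega> i) \<partial>M)" for i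
    by (rule integral_distr) auto
  then show "(\<integral>\<omega>. f (E \<omega> j) \<partial>M) = (\<integral>\<omega>. f (E \<omega> k) \<partial>M)" using distr_E[of j k] by metis
qed

text \<open>Factorisation over site \<open>k\<close> and the sites before it. Independence holds for
  \<open>G\<close> applied to the restricted environment, whose later coordinates are
  \<open>undefined\<close>; the congruence hypothesis transfers it to the full environment.\<close>

lemma integral_past:
  fixes f :: "real \<Rightarrow> real" and G :: "(int \<Rightarrow> real) \<Rightarrow> real"
  assumes f [measurable]: "f \<in> borel_measurable borel" and G: "G \<in> borel_measurable (PiM {..<k} (\<lambda>_. borel))"
    and cong: "\<And>a b. (\<And>i. i < k \<Longrightarrow> a i = b i) \<Longrightarrow> G a = G b"
    and int: "integrable M (\<lambda>\<omega>. f (E \<omega> k))" "integrable M (\<lambda>\<omega>. G (E \<omega>))"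
  shows "integrable M (\<lambda>\<omega>. f (E \<omega> k) * G (E \<omega>))"
    and "(\<integral>\<omega>. f (E \<omega> k) * G (E \<omega>) \<partial>M) = (\<integral>\<omega>. f (E \<omega> k) \<partial>M) * (\<integral>\<omega>. G (E \<omega>) \<partial>M)"
proof -
  have ff: "(\<lambda>x. f (x k)) \<in> borel_measurable (PiM {k} (\<lambda>_. borel))"
    by (rule measurable_compose[of "\<lambda>x. x k" _ borel, OF _ f]) (rule measurable_component_singleton, simp)
  have "indep_var borel ((\<lambda>x. f (x k)) \<circ> (\<lambda>\<omega>. restrict (E \<omega>) {k})) borel (G \<circ> (\<lambda>\<omega>. restrict (E \<omega>) {..<k}))"
    by (rule indep_var_compose[OF indep_var_restrict[OF indep_E] ff G]) auto
  moreover have "G (restrict a {..<k}) = G a" for a by (rule cong) simp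
  ultimately have ind: "indep_var borel (\<lambda>\<omega>. f (E \<omega> k)) borel (\<lambda>\<omega>. G (E \<omega>))"
    by (simp add: comp_def)
  show "integrable M (\<lambda>\<omega>. f (E \<omega> k) * G (E \<omega>))"
    "(\<integral>\<omega>. f (E \<omega> k) * G (E \<omega>) \<partial>M) = (\<integral>\<omega>. f (E \<omega> k) \<partial>M) * (\<integral>\<omega>. G (E \<omega>) \<partial>M)"
    using indep_var_integrable[OF ind int] indep_var_lebesgue_integral[OF ind int] by auto
qed

end

lemma powr_le_one_add:
  fixes x \<kappa> b :: real
  assumes "0 < x" "0 \<le> \<kappa>" "\<kappa> \<le> b"
  shows "x powr \<kappa> \<le> 1 + x powr b"
proof (cases "1 \<le> x")
  case True
  then have "x powr \<kappa> \<le> x powr b" using assms by (intro powr_mono) auto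
  then show ?thesis by simp
next
  case False
  then have "x powr \<kappa> \<le> 1" using assms by (intro powr_le1) auto
  then show ?thesis by (simp add: add.commute add_increasing2)
qed

context iid_env
begin

lemma odds_powr_eq: "odds (E \<omega>) k powr \<kappa> = ((1 - E \<omega> k) / E \<omega> k) powr \<kappa>"
  by (simp add: odds_def)

lemma meas_odds_powr: "(\<lambda>x::real. ((1 - x) / x) powr \<kappa>) \<in> borel_measurable borel"
  by measurable

lemma integrable_odds_powr_iff:
  "integrable M (\<lambda>\<omega>. odds (E \<omega>) j powr \<kappa>) \<longleftrightarrow> integrable M (\<lambda>\<omega>. odds (E \<omega>) k powr \<kappa>)"
  "(\<integral>\<omega>. odds (E \<omega>) j powr \<kappa> \<partial>M) = (\<integral>\<omega>. odds (E \<omega>) k powr \<kappa> \<partial>M)"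
  unfolding odds_powr_eq using integral_E[OF meas_odds_powr] by blast+

lemma integrable_odds_powr_mono:
  assumes "integrable M (\<lambda>\<omega>. odds (E \<omega>) k powr b)" "0 \<le> \<kappa>" "\<kappa> \<le> b"
  shows "integrable M (\<lambda>\<omega>. odds (E \<omega>) k powr \<kappa>)"
proof (rule Bochner_Integration.integrable_bound[where f = "\<lambda>\<omega>. 1 + odds (E \<omega>) k powr b"])
  show "AE \<omega> in M. norm (odds (E \<omega>) k powr \<kappa>) \<le> norm (1 + odds (E \<omega>) k powr b)"
    using assms by (intro AE_I2) (auto intro!: powr_le_one_add odds_nonneg)
qed (use assms in auto)

lemma odds_product_moment:
  assumes "integrable M (\<lambda>\<omega>. odds (E \<omega>) 0 powr \<kappa>)"
  defines "r \<equiv> \<integral>\<omega>. odds (E \<omega>) 0 powr \<kappa> \<partial>M"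
  shows "integrable M (\<lambda>\<omega>. \<Prod>i\<in>{w + 1..w + int j}. odds (E \<omega>) i powr \<kappa>)"
    and "(\<integral>\<omega>. (\<Prod>i\<in>{w + 1..w + int j}. odds (E \<omega>) i powr \<kappa>) \<partial>M) = r ^ j"
proof (induction j)
  case 0
  { case 1 show ?case by simp
  next case 2 show ?case by (simp add: prob_space) }
next
  case (Suc j)
  let ?k = "w + int (Suc j)"
  have set: "{w + 1..w + int (Suc j)} = insert ?k {w + 1..w + int j}" by auto
  have P: "(\<Prod>i\<in>{w + 1..w + int (Suc j)}. odds a i powr \<kappa>) =
      ((1 - a ?k) / a ?k) powr \<kappa> * (\<Prod>i\<in>{w + 1..w + int j}. odds a i powr \<kappa>)" for a
    unfolding set by (subst prod.insert) (auto simp: odds_def)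
  let ?G = "\<lambda>a. \<Prod>i\<in>{w + 1..w + int j}. odds a i powr \<kappa>"
  have G: "?G \<in> borel_measurable (PiM {..<?k} (\<lambda>_. borel))"
  proof (rule borel_measurable_prod)
    fix i assume "i \<in> {w + 1..w + int j}"
    then have [measurable]: "(\<lambda>a. odds a i) \<in> borel_measurable (PiM {..<?k} (\<lambda>_. borel))"
      by (intro measurable_odds) auto
    show "(\<lambda>a. odds a i powr \<kappa>) \<in> borel_measurable (PiM {..<?k} (\<lambda>_. borel))" by measurable
  qed
  have c: "?G a = ?G b" if "\<And>i. i < ?k \<Longrightarrow> a i = b i" for a b
    using that by (intro prod.cong refl) (auto simp: odds_def)
  have i: "integrable M (\<lambda>\<omega>. ((1 - E \<omega> ?k) / E \<omega> ?k) powr \<kappa>)"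
    using assms(1) integrable_odds_powr_iff(1)[of 0 \<kappa> ?k] by (simp add: odds_powr_eq)
  have e: "(\<integral>\<omega>. ((1 - E \<omega> ?k) / E \<omega> ?k) powr \<kappa> \<partial>M) = r"
    unfolding r_def using integrable_odds_powr_iff(2)[of 0 \<kappa> ?k] by (simp add: odds_powr_eq)
  note past = integral_past[OF meas_odds_powr[of \<kappa>] G c i Suc(1)]
  { case 1 show ?case using past(1) by (simp only: P)
  next case 2 show ?case using past(2) Suc(2) e by (simp only: P power_Suc) }
qed

text \<open>For independent sites the moments of products are powers, so the growth rate at 2 is the
  second moment of A_0, and it is below 1. Dominated convergence along exponents decreasing to 2
  keeps the moment below 1 for some exponent beyond 2. The domination uses A_0 \<le> 1 / p_0 and the
  moment condition on p_0.\<close>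

lemma moment_exponent:
  obtains s where "0 < s" "integrable M (\<lambda>\<omega>. odds (E \<omega>) 0 powr (2 + 2 * s))"
    "(\<integral>\<omega>. odds (E \<omega>) 0 powr (2 + 2 * s) \<partial>M) < 1" "integrable M (\<lambda>\<omega>. E \<omega> 0 powr (- 2))"
proof -
  from cond obtain \<gamma> where \<gamma>: "2 < \<gamma>" "(\<integral>\<^sup>+ \<omega>. ennreal (E \<omega> 0 powr (- \<gamma>)) \<partial>M) < \<infinity>"
    unfolding condition_C'_def by blast
  have iE: "integrable M (\<lambda>\<omega>. E \<omega> 0 powr (- \<gamma>))"
    using \<gamma>(2) by (intro integrableI_nonneg) auto
  have E01: "0 < E \<omega> 0" "E \<omega> 0 < 1" if "\<omega> \<in> space M" for \<omega>
    using walk_env_E[OF that] by (auto simp: walk_env_def)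
  have le: "odds (E \<omega>) 0 powr \<gamma> \<le> E \<omega> 0 powr (- \<gamma>)" if "\<omega> \<in> space M" for \<omega>
  proof -
    have "odds (E \<omega>) 0 powr \<gamma> \<le> (1 / E \<omega> 0) powr \<gamma>"
      using E01[OF that] \<gamma>(1) odds_nonneg[OF that, of 0] by (intro powr_mono2) (auto simp: odds_def divide_right_mono)
    also have "\<dots> = E \<omega> 0 powr (- \<gamma>)" using E01[OF that] by (simp add: powr_divide powr_minus_divide)
    finally show ?thesis .
  qed
  have io: "integrable M (\<lambda>\<omega>. odds (E \<omega>) 0 powr \<gamma>)"
    by (rule Bochner_Integration.integrable_bound[OF iE]) (auto intro!: AE_I2 le)
  have i2: "integrable M (\<lambda>\<omega>. E \<omega> 0 powr (- 2))"
  proof (rule Bochner_Integration.integrable_bound[OF iE])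
    show "AE \<omega> in M. norm (E \<omega> 0 powr (- 2)) \<le> norm (E \<omega> 0 powr (- \<gamma>))"
      using E01 \<gamma>(1) by (intro AE_I2) (auto intro!: powr_mono' simp: less_imp_le)
  qed simp
  let ?g = "\<lambda>\<kappa>. \<integral>\<omega>. odds (E \<omega>) 0 powr \<kappa> \<partial>M"
  have io2: "integrable M (\<lambda>\<omega>. odds (E \<omega>) 0 powr 2)" by (rule integrable_odds_powr_mono[OF io]) (use \<gamma> in auto)
  have g0: "0 \<le> ?g 2" by (rule integral_nonneg_AE) auto
  \<comment> \<open>\<open>n = 0\<close> is excluded because \<open>root 0\<close> is constantly 0;
    the limsup only sees large \<open>n\<close>.\<close>
  have "ennreal_root n (\<integral>\<^sup>+ \<omega>. ennreal (\<Prod>j\<in>{1..int n}. odds (E \<omega>) j powr 2) \<partial>M) = ennreal (?g 2)" if "0 < n" for n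
  proof -
    have "(\<integral>\<^sup>+ \<omega>. ennreal (\<Prod>j\<in>{1..int n}. odds (E \<omega>) j powr 2) \<partial>M) = ennreal (?g 2 ^ n)"
      using odds_product_moment[OF io2, of 0 n]
      by (subst nn_integral_eq_integral) (auto intro!: prod_nonneg)
    then show ?thesis using that g0 by (simp add: ennreal_root_def real_root_power_cancel)
  qed
  then have "growth_rate M T p 2 = limsup (\<lambda>n::nat. ennreal (?g 2))"
    unfolding growth_rate_def by (intro Limsup_eq eventually_mono[OF eventually_gt_at_top[of 0]]) auto
  then have g2: "?g 2 < 1" using growth2 g0 by (simp add: Limsup_const ennreal_less_one_iff)
  \<comment> \<open>Exponents descending from \<gamma> to 2 without reaching it.\<close>
  define \<kappa> where "\<kappa> n = 2 + (\<gamma> - 2) / real (Suc n)" for n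
  have \<kappa>: "2 < \<kappa> n" "\<kappa> n \<le> \<gamma>" for n
  proof -
    have "(\<gamma> - 2) / real (Suc n) \<le> (\<gamma> - 2) / 1" using \<gamma>(1) by (intro divide_left_mono) auto
    then show "\<kappa> n \<le> \<gamma>" by (simp add: \<kappa>_def)
    show "2 < \<kappa> n" using \<gamma>(1) by (simp add: \<kappa>_def)
  qed
  have \<kappa>lim: "\<kappa> \<longlonglongrightarrow> 2" unfolding \<kappa>_def by real_asymp
  have "(\<lambda>n. ?g (\<kappa> n)) \<longlonglongrightarrow> ?g 2"
  proof (rule integral_dominated_convergence[where w = "\<lambda>\<omega>. 1 + odds (E \<omega>) 0 powr \<gamma>"])
    show "AE \<omega> in M. (\<lambda>n. odds (E \<omega>) 0 powr \<kappa> n) \<longlonglongrightarrow> odds (E \<omega>) 0 powr 2"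
      by (intro AE_I2 tendsto_powr tendsto_const \<kappa>lim) (auto dest: odds_nonneg[of _ 0])
    show "AE \<omega> in M. norm (odds (E \<omega>) 0 powr \<kappa> n) \<le> 1 + odds (E \<omega>) 0 powr \<gamma>" for n
      using \<kappa>[of n] by (intro AE_I2) (auto intro!: powr_le_one_add odds_nonneg)
  qed (use io in auto)
  then have "eventually (\<lambda>n. ?g (\<kappa> n) < 1) sequentially" using g2 by (rule order_tendstoD)
  then obtain n where n: "?g (\<kappa> n) < 1" by (auto simp: eventually_sequentially)
  have e: "2 + 2 * ((\<kappa> n - 2) / 2) = \<kappa> n" by (simp add: field_simps)
  show ?thesis
  proof (rule that[of "(\<kappa> n - 2) / 2"], unfold e)
    show "integrable M (\<lambda>\<omega>. odds (E \<omega>) 0 powr \<kappa> n)"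
      by (rule integrable_odds_powr_mono[OF io]) (use \<kappa>[of n] in auto)
  qed (use n \<kappa>[of n] i2 in auto)
qed

end

locale moment_env = iid_env +
  fixes s :: real
  assumes s_pos: "0 < s"
    and int_odds: "integrable M (\<lambda>\<omega>. odds (E \<omega>) 0 powr (2 + 2 * s))"
    and odds_contract: "(\<integral>\<omega>. odds (E \<omega>) 0 powr (2 + 2 * s) \<partial>M) < 1"
    and int_inverse_square: "integrable M (\<lambda>\<omega>. E \<omega> 0 powr (- 2))"
begin

definition r :: real where "r = (\<integral>\<omega>. odds (E \<omega>) 0 powr (2 + 2 * s) \<partial>M)"

definition al :: real where "al = (\<integral>\<omega>. odds (E \<omega>) 0 \<partial>M)"

lemma int_odds_powr: "0 \<le> \<kappa> \<Longrightarrow> \<kappa> \<le> 2 + 2 * s \<Longrightarrow> integrable M (\<lambda>\<omega>. odds (E \<omega>) k powr \<kappa>)"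
  using integrable_odds_powr_mono[OF int_odds, of \<kappa>] integrable_odds_powr_iff(1)[of 0 \<kappa> k] by simp

lemma int_odds1: "integrable M (\<lambda>\<omega>. odds (E \<omega>) k)"
proof -
  have "integrable M (\<lambda>\<omega>. odds (E \<omega>) k powr 1)" using s_pos by (intro int_odds_powr) auto
  moreover have "odds (E \<omega>) k powr 1 = odds (E \<omega>) k" if "\<omega> \<in> space M" for \<omega>
    using odds_nonneg[OF that, of k] by simp
  ultimately show ?thesis by (simp cong: Bochner_Integration.integrable_cong)
qed

lemma integral_odds: "(\<integral>\<omega>. odds (E \<omega>) k \<partial>M) = al"
  unfolding al_def odds_def using integral_E(2)[of "\<lambda>x. (1 - x) / x" k 0] by simp

lemma r_bounds: "0 < r" "r < 1"
proof -
  show "r < 1" unfolding r_def by (rule odds_contract)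
  have "\<not> (AE \<omega> in M. odds (E \<omega>) 0 powr (2 + 2 * s) = 0)"
  proof
    assume "AE \<omega> in M. odds (E \<omega>) 0 powr (2 + 2 * s) = 0"
    then have "AE \<omega> in M. False" using AE_space
    proof eventually_elim
      case (elim \<omega>)
      then show ?case using odds_nonneg[of \<omega> 0] by simp
    qed
    then show False by simp
  qed
  moreover have "0 \<le> r" unfolding r_def by (rule integral_nonneg_AE) auto
  ultimately show "0 < r"
    using integral_nonneg_eq_0_iff_AE[OF int_odds] unfolding r_def by (auto simp: less_le)
qed

text \<open>Young's inequality x \<le> x^P / P + (P - 1) / P with P = 2 + 2 s bounds the mean by a
  convex combination of \<open>r\<close> and 1, which is below 1.\<close>

lemma al_bounds: "0 \<le> al" "al < 1"
proof -
  show 0: "0 \<le> al" unfolding al_def by (intro integral_nonneg_AE AE_I2) (auto dest: odds_nonneg[of _ 0])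
  define P where "P = 2 + 2 * s"
  have P: "1 < P" using s_pos by (simp add: P_def)
  have "x \<le> x powr P / P + (P - 1) / P" if "0 \<le> x" for x :: real
    using Youngs_inequality[of P "P / (P - 1)" x 1] P that by (simp add: field_simps)
  then have "al \<le> (\<integral>\<omega>. odds (E \<omega>) 0 powr P / P + (P - 1) / P \<partial>M)"
    unfolding al_def using int_odds int_odds1[of 0]
    by (intro integral_mono) (auto simp: P_def dest: odds_nonneg[of _ 0])
  also have "\<dots> = r / P + (P - 1) / P" using int_odds by (simp add: r_def P_def prob_space)
  also have "\<dots> < 1" using r_bounds(2) P by (simp add: field_simps)
  finally show "al < 1" .
qed

end

text \<open>For large y the ratio of (2 + y)^q to y^q is close to 1, and the remaining bounded range
  goes into the constant. Thus an additive term in a recursion costs a factor arbitrarily close to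
  1, small enough to preserve a contraction.\<close>

lemma powr_two_add_le:
  fixes q \<rho> :: real
  assumes "0 < q" "1 < \<rho>"
  shows "\<exists>C\<ge>0. \<forall>y\<ge>0. (2 + y) powr q \<le> \<rho> * y powr q + C"
proof -
  have "((\<lambda>L::real. (1 + 2 / L) powr q) \<longlongrightarrow> (1 + 0) powr q) at_top"
    by (intro tendsto_powr tendsto_add tendsto_const) (real_asymp, simp)
  then have "eventually (\<lambda>L::real. (1 + 2 / L) powr q < \<rho>) at_top"
    using assms(2) by (intro order_tendstoD) auto
  then obtain L0 where L0: "\<And>L. L0 \<le> L \<Longrightarrow> (1 + 2 / L) powr q < \<rho>" by (auto simp: eventually_at_top_linorder)
  define L where "L = max L0 1"
  have L: "0 < L" "(1 + 2 / L) powr q \<le> \<rho>" using L0[of L] by (auto simp: L_def intro: less_imp_le)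
  show ?thesis
  proof (intro exI[of _ "(2 + L) powr q"] conjI allI impI)
    fix y :: real assume y: "0 \<le> y"
    show "(2 + y) powr q \<le> \<rho> * y powr q + (2 + L) powr q"
    proof (cases "y \<le> L")
      case True
      have "(2 + y) powr q \<le> (2 + L) powr q" using True y assms by (intro powr_mono2) auto
      moreover have "0 \<le> \<rho> * y powr q" using assms by simp
      ultimately show ?thesis by linarith
    next
      case False
      have "(2 + y) powr q = (1 + 2 / y) powr q * y powr q"
        using False L(1) by (simp add: powr_mult[symmetric] algebra_simps)
      also have "\<dots> \<le> (1 + 2 / L) powr q * y powr q"
        using False L(1) assms by (intro mult_right_mono powr_mono2 add_left_mono divide_left_mono) auto
      also have "\<dots> \<le> \<rho> * y powr q" using L(2) by (intro mult_right_mono) auto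
      finally show ?thesis by (simp add: add_increasing2)
    qed
  qed simp
qed

section \<open>Moments of the quenched means\<close>

context moment_env
begin

definition pw :: real where "pw = 2 + 2 * s"

lemma pw: "2 < pw" "0 < pw" using s_pos by (auto simp: pw_def)

lemma trunc_mu_ge_2: "\<omega> \<in> space M \<Longrightarrow> 2 \<le> trunc_mu n (E \<omega>) k"
proof (induction n arbitrary: k)
  case (Suc n)
  have "0 \<le> odds (E \<omega>) k * trunc_mu n (E \<omega>) (k - 1)"
    using Suc.IH[OF Suc.prems, of "k - 1"] odds_nonneg[OF Suc.prems, of k] by (intro mult_nonneg_nonneg) auto
  then show ?case by simp
qed simp

lemma prod_odds_nonneg: "\<omega> \<in> space M \<Longrightarrow> 0 \<le> (\<Prod>i\<in>I. odds (E \<omega>) i)"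
  by (intro prod_nonneg) (auto intro: less_imp_le[OF odds_nonneg])

lemma trunc_mu_mono: "\<omega> \<in> space M \<Longrightarrow> trunc_mu n (E \<omega>) k \<le> trunc_mu (Suc n) (E \<omega>) k"
  unfolding trunc_mu_eq using prod_odds_nonneg[of \<omega> "{k - int n..k}"] by simp

lemma meas_past:
  assumes G: "G \<in> borel_measurable (PiM UNIV (\<lambda>_. borel))"
  shows "(\<lambda>\<omega>. G (E \<omega>)) \<in> borel_measurable M"
proof -
  have "restrict a UNIV = a" for a :: "int \<Rightarrow> real" by (simp add: restrict_def)
  then show ?thesis using measurable_compose[OF measurable_E_PiM[of UNIV] G] by simp
qed

lemma meas_trunc_mu [measurable]: "(\<lambda>\<omega>. trunc_mu n (E \<omega>) k) \<in> borel_measurable M"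
  by (rule meas_past[OF measurable_trunc_mu]) simp

lemma meas_trunc_v [measurable]: "(\<lambda>\<omega>. trunc_v n (E \<omega>) k) \<in> borel_measurable M"
  by (rule meas_past[OF measurable_trunc_v]) simp

text \<open>In Y_k = 2 + A_k Y_(k-1) the factor A_k is independent of Y_(k-1), so the moments of
  order \<open>pw\<close> obey an affine recursion with slope \<rho> r < 1 and stay bounded
  uniformly in the truncation and the site.\<close>

lemma trunc_mu_moments:
  "\<exists>B\<ge>0. \<forall>n k. integrable M (\<lambda>\<omega>. trunc_mu n (E \<omega>) k powr pw) \<and> (\<integral>\<omega>. trunc_mu n (E \<omega>) k powr pw \<partial>M) \<le> B"
proof -
  \<comment> \<open>The midpoint of 1 and 1/r: above 1, as the preceding inequality requires, while
    \<rho> r = (1 + r) / 2 is still below 1.\<close>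
  define \<rho> where "\<rho> = (1 + 1 / r) / 2"
  have \<rho>: "1 < \<rho>" "\<rho> * r < 1" "0 < \<rho>" using r_bounds by (auto simp: \<rho>_def field_simps)
  obtain C where C: "0 \<le> C" "\<And>y. 0 \<le> y \<Longrightarrow> (2 + y) powr pw \<le> \<rho> * y powr pw + C"
    using powr_two_add_le[OF pw(2) \<rho>(1)] by blast
  \<comment> \<open>The larger of the initial moment and the fixed point of the affine
    recursion.\<close>
  define B where "B = max (2 powr pw) (C / (1 - \<rho> * r))"
  have B: "\<rho> * (r * B) + C \<le> B"
  proof -
    have "C / (1 - \<rho> * r) \<le> B" by (simp add: B_def)
    then have "C \<le> B * (1 - \<rho> * r)" using \<rho>(2) by (simp add: pos_divide_le_eq)
    then show ?thesis by (simp add: algebra_simps)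
  qed
  have main: "integrable M (\<lambda>\<omega>. trunc_mu n (E \<omega>) k powr pw) \<and> (\<integral>\<omega>. trunc_mu n (E \<omega>) k powr pw \<partial>M) \<le> B" for n k
  proof (induction n arbitrary: k)
    case 0
    then show ?case by (simp add: prob_space B_def)
  next
    case (Suc n)
    let ?f = "\<lambda>x::real. ((1 - x) / x) powr pw" and ?G = "\<lambda>a. trunc_mu n a (k - 1) powr pw"
    have G: "?G \<in> borel_measurable (PiM {..<k} (\<lambda>_. borel))"
      by (intro powr_real_measurable measurable_trunc_mu) auto
    have cg: "?G a = ?G b" if "\<And>i. i < k \<Longrightarrow> a i = b i" for a b
      using that trunc_mu_cong[of "k - 1" a b n] by simp
    have f: "?f (E \<omega> k) = odds (E \<omega>) k powr pw" for \<omega> by (simp add: odds_def)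
    have fi: "integrable M (\<lambda>\<omega>. ?f (E \<omega> k))" unfolding f using pw by (intro int_odds_powr) (auto simp: pw_def)
    have fe: "(\<integral>\<omega>. ?f (E \<omega> k) \<partial>M) = r" unfolding f by (simp add: r_def pw_def integrable_odds_powr_iff(2)[of k _ 0])
    note past = integral_past[OF meas_odds_powr[of pw] G cg fi conjunct1[OF Suc[of "k - 1"]]]
    have le: "trunc_mu (Suc n) (E \<omega>) k powr pw \<le> \<rho> * (?f (E \<omega> k) * ?G (E \<omega>)) + C" if "\<omega> \<in> space M" for \<omega>
    proof -
      have nn: "0 \<le> odds (E \<omega>) k" "0 \<le> trunc_mu n (E \<omega>) (k - 1)"
        using odds_nonneg[OF that, of k] trunc_mu_ge_2[OF that, of n "k - 1"] by auto
      then have "(2 + odds (E \<omega>) k * trunc_mu n (E \<omega>) (k - 1)) powr pw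
          \<le> \<rho> * (odds (E \<omega>) k * trunc_mu n (E \<omega>) (k - 1)) powr pw + C" by (intro C(2)) simp
      then show ?thesis using nn unfolding f by (simp add: powr_mult)
    qed
    have int: "integrable M (\<lambda>\<omega>. \<rho> * (?f (E \<omega> k) * ?G (E \<omega>)) + C)" using past(1) by simp
    have i1: "integrable M (\<lambda>\<omega>. trunc_mu (Suc n) (E \<omega>) k powr pw)"
    proof (rule Bochner_Integration.integrable_bound[OF int])
      show "AE \<omega> in M. norm (trunc_mu (Suc n) (E \<omega>) k powr pw) \<le> norm (\<rho> * (?f (E \<omega> k) * ?G (E \<omega>)) + C)"
      proof (rule AE_I2)
        fix \<omega> assume "\<omega> \<in> space M"
        from order_trans[OF le[OF this] abs_ge_self]
        show "norm (trunc_mu (Suc n) (E \<omega>) k powr pw) \<le> norm (\<rho> * (?f (E \<omega> k) * ?G (E \<omega>)) + C)"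
          by (simp only: real_norm_def abs_of_nonneg[OF powr_ge_zero])
      qed
    qed measurable
    have "(\<integral>\<omega>. trunc_mu (Suc n) (E \<omega>) k powr pw \<partial>M) \<le> (\<integral>\<omega>. \<rho> * (?f (E \<omega> k) * ?G (E \<omega>)) + C \<partial>M)"
      by (rule integral_mono[OF i1 int le])
    also have "\<dots> = \<rho> * (r * (\<integral>\<omega>. ?G (E \<omega>) \<partial>M)) + C"
      using past fe by (simp add: prob_space)
    also have "\<dots> \<le> \<rho> * (r * B) + C"
      using \<rho> r_bounds Suc[of "k - 1"] by (intro add_mono mult_left_mono) auto
    also have "\<dots> \<le> B" by (rule B)
    finally show ?case using i1 by simp
  qed
  have "0 \<le> B" by (simp add: B_def le_max_iff_disj)
  then show ?thesis using main by blast
qed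

text \<open>The moment bound passes to the monotone limit. Finiteness of the limit bounds the
  partial sums of the nonnegative series, so summability is a consequence of the moments.\<close>

lemma mu_moments:
  "AE \<omega> in M. \<forall>k. summable (\<lambda>j. \<Prod>i\<in>{k - int j..k}. odds (E \<omega>) i)"
  "integrable M (\<lambda>\<omega>. (1 + mu_env (E \<omega>) k) powr pw)"
  "\<exists>B\<ge>0. \<forall>k. (\<integral>\<omega>. (1 + mu_env (E \<omega>) k) powr pw \<partial>M) \<le> B"
proof -
  obtain B where B: "0 \<le> B" "\<And>n k. integrable M (\<lambda>\<omega>. trunc_mu n (E \<omega>) k powr pw)"
    "\<And>n k. (\<integral>\<omega>. trunc_mu n (E \<omega>) k powr pw \<partial>M) \<le> B"
    using trunc_mu_moments by metis
  have nn: "0 \<le> trunc_mu n (E \<omega>) k powr pw" for n k \<omega> by simp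
  have mono: "trunc_mu n (E \<omega>) k powr pw \<le> trunc_mu (Suc n) (E \<omega>) k powr pw" if "\<omega> \<in> space M" for n k \<omega>
    using trunc_mu_mono[OF that, of n k] trunc_mu_ge_2[OF that, of n k] pw by (intro powr_mono2) auto
  let ?f = "\<lambda>k n \<omega>. trunc_mu n (E \<omega>) k powr pw"
  have mb: "AE \<omega> in M. convergent (\<lambda>n. ?f k n \<omega>)" "integrable M (\<lambda>\<omega>. lim (\<lambda>n. ?f k n \<omega>))"
    "(\<integral>\<omega>. lim (\<lambda>n. ?f k n \<omega>) \<partial>M) \<le> B" for k
    by (rule monotone_bounded_integral[where f = "?f k" and B = B]; (rule B nn | erule mono))+
  have conv: "summable (\<lambda>j. \<Prod>i\<in>{k - int j..k}. odds (E \<omega>) i) \<and> lim (\<lambda>n. trunc_mu n (E \<omega>) k powr pw) = (1 + mu_env (E \<omega>) k) powr pw"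
    if \<omega>: "\<omega> \<in> space M" and c: "convergent (\<lambda>n. trunc_mu n (E \<omega>) k powr pw)" for \<omega> k
  proof -
    obtain K where K: "\<And>n. norm (trunc_mu n (E \<omega>) k powr pw) \<le> K"
      using convergent_imp_Bseq[OF c] by (auto simp: Bseq_def)
    have "(\<Sum>j<n. \<Prod>i\<in>{k - int j..k}. odds (E \<omega>) i) \<le> K powr (1 / pw)" for n
    proof -
      have "2 * (\<Sum>j<n. \<Prod>i\<in>{k - int j..k}. odds (E \<omega>) i) \<le> trunc_mu n (E \<omega>) k" by (simp add: trunc_mu_eq)
      moreover have "0 \<le> (\<Sum>j<n. \<Prod>i\<in>{k - int j..k}. odds (E \<omega>) i)" by (intro sum_nonneg prod_odds_nonneg \<omega>)
      ultimately have "(\<Sum>j<n. \<Prod>i\<in>{k - int j..k}. odds (E \<omega>) i) \<le> trunc_mu n (E \<omega>) k" by linarith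
      also have "\<dots> = (trunc_mu n (E \<omega>) k powr pw) powr (1 / pw)"
        using pw trunc_mu_ge_2[OF \<omega>, of n k] by (simp add: powr_powr)
      also have "\<dots> \<le> K powr (1 / pw)" using K[of n] pw by (intro powr_mono2) auto
      finally show ?thesis .
    qed
    then have sm: "summable (\<lambda>j. \<Prod>i\<in>{k - int j..k}. odds (E \<omega>) i)"
      by (intro summableI_nonneg_bounded[OF prod_odds_nonneg[OF \<omega>]])
    then have "(\<lambda>n. trunc_mu n (E \<omega>) k) \<longlonglongrightarrow> 2 + 2 * (\<Sum>j. \<Prod>i\<in>{k - int j..k}. odds (E \<omega>) i)"
      unfolding trunc_mu_eq by (intro tendsto_intros summable_LIMSEQ)
    then have l: "(\<lambda>n. trunc_mu n (E \<omega>) k) \<longlonglongrightarrow> 1 + mu_env (E \<omega>) k" by (simp add: mu_env_def)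
    have "2 \<le> 1 + mu_env (E \<omega>) k" using l trunc_mu_ge_2[OF \<omega>] by (intro LIMSEQ_le_const) auto
    then have "(\<lambda>n. trunc_mu n (E \<omega>) k powr pw) \<longlonglongrightarrow> (1 + mu_env (E \<omega>) k) powr pw"
      by (intro tendsto_powr l tendsto_const) auto
    with sm show ?thesis by (auto intro: limI)
  qed
  have AE: "AE \<omega> in M. summable (\<lambda>j. \<Prod>i\<in>{k - int j..k}. odds (E \<omega>) i) \<and> lim (\<lambda>n. trunc_mu n (E \<omega>) k powr pw) = (1 + mu_env (E \<omega>) k) powr pw" for k
    using mb(1)[of k] AE_space by eventually_elim (use conv in blast)
  have eq: "AE \<omega> in M. lim (\<lambda>n. trunc_mu n (E \<omega>) k powr pw) = (1 + mu_env (E \<omega>) k) powr pw" for k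
    using AE[of k] by eventually_elim simp
  show "AE \<omega> in M. \<forall>k. summable (\<lambda>j. \<Prod>i\<in>{k - int j..k}. odds (E \<omega>) i)"
    unfolding AE_all_countable using AE by (auto elim: AE_mp)
  show "integrable M (\<lambda>\<omega>. (1 + mu_env (E \<omega>) k) powr pw)"
    by (rule integrable_cong_AE_imp[OF mb(2)[of k]]) (use eq[of k] in \<open>auto elim: AE_mp\<close>)
  have "(\<integral>\<omega>. (1 + mu_env (E \<omega>) k) powr pw \<partial>M) \<le> B" for k
  proof -
    have "(\<integral>\<omega>. (1 + mu_env (E \<omega>) k) powr pw \<partial>M) = (\<integral>\<omega>. lim (\<lambda>n. trunc_mu n (E \<omega>) k powr pw) \<partial>M)"
      by (rule integral_cong_AE) (use eq[of k] in \<open>auto elim: AE_mp\<close>)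
    then show ?thesis using mb(3)[of k] by simp
  qed
  then show "\<exists>B\<ge>0. \<forall>k. (\<integral>\<omega>. (1 + mu_env (E \<omega>) k) powr pw \<partial>M) \<le> B" using B(1) by blast
qed

lemma AE_summable_env: "AE \<omega> in M. summable_env (E \<omega>)"
proof -
  have "AE \<omega> in M. \<forall>k. summable (\<lambda>j. \<Prod>i\<in>{k - int j..k}. odds (E \<omega>) i)" by (rule mu_moments)
  then show ?thesis using AE_space
    by eventually_elim (auto simp: summable_env_def summable_env_axioms_def walk_env_E)
qed

definition mean_pw :: real where
  "mean_pw = (SOME B. 0 \<le> B \<and> (\<forall>k. (\<integral>\<omega>. (1 + mu_env (E \<omega>) k) powr pw \<partial>M) \<le> B))"

lemma mean_pw: "0 \<le> mean_pw" "(\<integral>\<omega>. (1 + mu_env (E \<omega>) k) powr pw \<partial>M) \<le> mean_pw"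
proof -
  have "\<exists>B. 0 \<le> B \<and> (\<forall>k. (\<integral>\<omega>. (1 + mu_env (E \<omega>) k) powr pw \<partial>M) \<le> B)" using mu_moments(3) by blast
  from someI_ex[OF this] show "0 \<le> mean_pw" "(\<integral>\<omega>. (1 + mu_env (E \<omega>) k) powr pw \<partial>M) \<le> mean_pw"
    unfolding mean_pw_def by auto
qed

lemma int_mu_pw: "integrable M (\<lambda>\<omega>. (1 + mu_env (E \<omega>) k) powr pw)"
  by (rule mu_moments(2))

lemma AE_mu_ge_1: "AE \<omega> in M. 1 < mu_env (E \<omega>) k"
  using AE_summable_env by eventually_elim (rule summable_env.mu_gt_1)

lemma AE_mu_rec: "AE \<omega> in M. mu_env (E \<omega>) k = 1 + odds (E \<omega>) k * (1 + mu_env (E \<omega>) (k - 1))"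
  using AE_summable_env by eventually_elim (rule summable_env.mu_rec)

lemma mu_square_moment:
  "integrable M (\<lambda>\<omega>. (1 + mu_env (E \<omega>) k) powr 2)"
  "(\<integral>\<omega>. (1 + mu_env (E \<omega>) k) powr 2 \<partial>M) \<le> mean_pw"
proof -
  have le: "AE \<omega> in M. (1 + mu_env (E \<omega>) k) powr 2 \<le> (1 + mu_env (E \<omega>) k) powr pw"
    using AE_mu_ge_1[of k]
  proof eventually_elim
    case (elim \<omega>)
    then show ?case using pw by (intro powr_mono) auto
  qed
  show i: "integrable M (\<lambda>\<omega>. (1 + mu_env (E \<omega>) k) powr 2)"
    by (rule Bochner_Integration.integrable_bound[OF int_mu_pw[of k]]) (use le in \<open>auto elim: AE_mp\<close>)
  show "(\<integral>\<omega>. (1 + mu_env (E \<omega>) k) powr 2 \<partial>M) \<le> mean_pw"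
    using integral_mono_AE[OF i int_mu_pw[of k] le] mean_pw(2)[of k] by linarith
qed

lemma int_mu: "integrable M (\<lambda>\<omega>. mu_env (E \<omega>) k)"
proof (rule Bochner_Integration.integrable_bound[OF mu_square_moment(1)[of k]])
  show "AE \<omega> in M. norm (mu_env (E \<omega>) k) \<le> norm ((1 + mu_env (E \<omega>) k) powr 2)"
    using AE_mu_ge_1[of k]
  proof eventually_elim
    case (elim \<omega>)
    have "mu_env (E \<omega>) k \<le> (1 + mu_env (E \<omega>) k) powr 1" using elim by simp
    also have "\<dots> \<le> (1 + mu_env (E \<omega>) k) powr 2" using elim by (intro powr_mono) auto
    finally show ?case using elim by simp
  qed
qed simp

end

context moment_env
begin

subsection \<open>The variance majorant\<close>

lemma trunc_v_nonneg:
  assumes \<omega>: "\<omega> \<in> space M"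
  shows "0 \<le> trunc_v n (E \<omega>) k" "trunc_v n (E \<omega>) k \<le> trunc_v (Suc n) (E \<omega>) k"
proof -
  interpret walk_env "E \<omega>" by (rule walk_env_E[OF \<omega>])
  have b: "0 \<le> (mu_env (E \<omega>) k - 1)\<^sup>2 / (1 - E \<omega> k)" for k
    using a_less_1[of k] by simp
  show nn: "0 \<le> trunc_v n (E \<omega>) k" for n k
    using b by (induction n arbitrary: k) (auto intro!: add_nonneg_nonneg mult_nonneg_nonneg simp: less_imp_le[OF odds_pos])
  show "trunc_v n (E \<omega>) k \<le> trunc_v (Suc n) (E \<omega>) k"
  proof (induction n arbitrary: k)
    case 0
    then show ?case using b by simp
  next
    case (Suc n)
    show ?case using mult_left_mono[OF Suc[of "k - 1"] less_imp_le[OF odds_pos[of k]]] by simp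
  qed
qed

text \<open>Since \<open>mu_env a k - 1\<close> carries the factor (1 - p) / p, its square over 1 -
  p equals 1 - p times the square of (1 + mu_(k-1)) / p. Hence it is at most the product of p^(-2)
  and a quantity of the past, which are independent.\<close>

lemma innovation_bound:
  "integrable M (\<lambda>\<omega>. (mu_env (E \<omega>) k - 1)\<^sup>2 / (1 - E \<omega> k))"
  "(\<integral>\<omega>. (mu_env (E \<omega>) k - 1)\<^sup>2 / (1 - E \<omega> k) \<partial>M) \<le> (\<integral>\<omega>. E \<omega> 0 powr (- 2) \<partial>M) * mean_pw"
proof -
  let ?f = "\<lambda>x::real. x powr (- 2)" and ?G = "\<lambda>a. (1 + mu_env a (k - 1)) powr 2"
  have f: "?f \<in> borel_measurable borel" by measurable
  have G: "?G \<in> borel_measurable (PiM {..<k} (\<lambda>_. borel))"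
    by (intro powr_real_measurable borel_measurable_add measurable_mu_env) auto
  have cg: "?G a = ?G b" if "\<And>i. i < k \<Longrightarrow> a i = b i" for a b
    using that mu_env_cong[of "k - 1" a b] by simp
  have fi: "integrable M (\<lambda>\<omega>. ?f (E \<omega> k))" using integral_E(1)[OF f, of 0 k] int_inverse_square by simp
  note past = integral_past[OF f G cg fi mu_square_moment(1)]
  have le: "AE \<omega> in M. (mu_env (E \<omega>) k - 1)\<^sup>2 / (1 - E \<omega> k) \<le> ?f (E \<omega> k) * ?G (E \<omega>)"
    using AE_mu_rec[of k] AE_mu_ge_1[of "k - 1"] AE_space
  proof eventually_elim
    case (elim \<omega>)
    interpret walk_env "E \<omega>" by (rule walk_env_E[OF elim(3)])
    define x y where "x = E \<omega> k" and "y = 1 + mu_env (E \<omega>) (k - 1)"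
    have x: "0 < x" "x < 1" using a_pos[of k] a_less_1[of k] by (auto simp: x_def)
    have "(mu_env (E \<omega>) k - 1)\<^sup>2 / (1 - E \<omega> k) = ((1 - x) / x * y)\<^sup>2 / (1 - x)"
      using elim(1) by (simp add: x_def y_def odds_def)
    also have "\<dots> = (1 - x) * (y\<^sup>2 / x\<^sup>2)" using x by (simp add: power2_eq_square field_simps)
    also have "\<dots> \<le> 1 * (y\<^sup>2 / x\<^sup>2)" using x by (intro mult_right_mono) auto
    also have "\<dots> = ?f x * y powr 2" using x elim(2) by (simp add: y_def powr_minus_divide)
    finally show ?case by (simp add: x_def y_def)
  qed
  have nn: "AE \<omega> in M. 0 \<le> (mu_env (E \<omega>) k - 1)\<^sup>2 / (1 - E \<omega> k)"
    using AE_space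
  proof eventually_elim
    case (elim \<omega>)
    interpret walk_env "E \<omega>" by (rule walk_env_E[OF elim])
    show ?case using a_less_1[of k] by simp
  qed
  show i: "integrable M (\<lambda>\<omega>. (mu_env (E \<omega>) k - 1)\<^sup>2 / (1 - E \<omega> k))"
  proof (rule Bochner_Integration.integrable_bound[OF past(1)])
    show "AE \<omega> in M. norm ((mu_env (E \<omega>) k - 1)\<^sup>2 / (1 - E \<omega> k)) \<le> norm (?f (E \<omega> k) * ?G (E \<omega>))"
      using le nn by eventually_elim (metis abs_of_nonneg order_trans real_norm_def)
  qed measurable
  have "(\<integral>\<omega>. (mu_env (E \<omega>) k - 1)\<^sup>2 / (1 - E \<omega> k) \<partial>M) \<le> (\<integral>\<omega>. ?f (E \<omega> k) * ?G (E \<omega>) \<partial>M)"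
    by (rule integral_mono_AE[OF i past(1) le])
  also have "\<dots> = (\<integral>\<omega>. ?f (E \<omega> 0) \<partial>M) * (\<integral>\<omega>. ?G (E \<omega>) \<partial>M)"
    using past(2) integral_E(2)[OF f, of k 0] by simp
  also have "\<dots> \<le> (\<integral>\<omega>. ?f (E \<omega> 0) \<partial>M) * mean_pw"
    by (intro mult_left_mono mu_square_moment(2) integral_nonneg_AE) auto
  finally show "(\<integral>\<omega>. (mu_env (E \<omega>) k - 1)\<^sup>2 / (1 - E \<omega> k) \<partial>M) \<le> (\<integral>\<omega>. E \<omega> 0 powr (- 2) \<partial>M) * mean_pw" .
qed

lemma odds_times_past:
  assumes G: "G \<in> borel_measurable (PiM {..<k} (\<lambda>_. borel))"
    and cg: "\<And>a b. (\<And>i. i < k \<Longrightarrow> a i = b i) \<Longrightarrow> G a = G b" and i: "integrable M (\<lambda>\<omega>. G (E \<omega>))"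
  shows "integrable M (\<lambda>\<omega>. odds (E \<omega>) k * G (E \<omega>))"
    "(\<integral>\<omega>. odds (E \<omega>) k * G (E \<omega>) \<partial>M) = al * (\<integral>\<omega>. G (E \<omega>) \<partial>M)"
proof -
  have f: "(\<lambda>x::real. (1 - x) / x) \<in> borel_measurable borel" by measurable
  have fi: "integrable M (\<lambda>\<omega>. (1 - E \<omega> k) / E \<omega> k)" using int_odds1[of k] by (simp add: odds_def)
  show "integrable M (\<lambda>\<omega>. odds (E \<omega>) k * G (E \<omega>))"
    "(\<integral>\<omega>. odds (E \<omega>) k * G (E \<omega>) \<partial>M) = al * (\<integral>\<omega>. G (E \<omega>) \<partial>M)"
    using integral_past[OF f G cg fi i] integral_odds[of k] by (simp_all add: odds_def)
qed

text \<open>The fixed point of the affine recursion for the means of \<open>trunc_v\<close>, whose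
  slope is \<open>al\<close> and whose constant is the bound of
  \<open>innovation_bound\<close>.\<close>

definition v_bound :: real where
  "v_bound = (\<integral>\<omega>. E \<omega> 0 powr (- 2) \<partial>M) * mean_pw / (1 - al)"

lemma trunc_v_moment: "integrable M (\<lambda>\<omega>. trunc_v n (E \<omega>) k)" "(\<integral>\<omega>. trunc_v n (E \<omega>) k \<partial>M) \<le> v_bound"
proof (induction n arbitrary: k)
  case 0
  have "0 \<le> (\<integral>\<omega>. E \<omega> 0 powr (- 2) \<partial>M)" by (rule integral_nonneg_AE) auto
  then have "0 \<le> v_bound" using mean_pw(1) al_bounds by (simp add: v_bound_def)
  { case 1 show ?case by simp
  next case 2 show ?case using \<open>0 \<le> v_bound\<close> by simp }
next
  case (Suc n)
  have G: "(\<lambda>a. trunc_v n a (k - 1)) \<in> borel_measurable (PiM {..<k} (\<lambda>_. borel))" for k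
    by (intro measurable_trunc_v) auto
  have cg: "trunc_v n a (k - 1) = trunc_v n b (k - 1)" if "\<And>i. i < k \<Longrightarrow> a i = b i" for a b k
    using that by (intro trunc_v_cong) auto
  note past = odds_times_past[OF G cg Suc(1)]
  { case 1 show ?case using past(1)[of k] innovation_bound(1)[of k] by simp
  next case 2
    have "(\<integral>\<omega>. trunc_v (Suc n) (E \<omega>) k \<partial>M) = al * (\<integral>\<omega>. trunc_v n (E \<omega>) (k - 1) \<partial>M)
        + (\<integral>\<omega>. (mu_env (E \<omega>) k - 1)\<^sup>2 / (1 - E \<omega> k) \<partial>M)"
      using past[of k] innovation_bound(1)[of k] by simp
    also have "\<dots> \<le> al * v_bound + (\<integral>\<omega>. E \<omega> 0 powr (- 2) \<partial>M) * mean_pw"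
      using al_bounds by (intro add_mono mult_left_mono Suc(2) innovation_bound(2)) auto
    also have "\<dots> = v_bound" using al_bounds by (simp add: v_bound_def field_simps)
    finally show ?case .
  }
qed

definition v :: "(int \<Rightarrow> real) \<Rightarrow> int \<Rightarrow> real" where
  "v a k = lim (\<lambda>n. trunc_v n a k)"

lemma v_lim: "AE \<omega> in M. convergent (\<lambda>n. trunc_v n (E \<omega>) k)" "integrable M (\<lambda>\<omega>. v (E \<omega>) k)"
  unfolding v_def
  by (rule monotone_bounded_integral[where f = "\<lambda>n \<omega>. trunc_v n (E \<omega>) k" and B = v_bound];
      (rule trunc_v_moment | erule trunc_v_nonneg))+

text \<open>The iterates increase to a finite limit at all sites simultaneously, and passing to the
  limit on both sides of their recursion gives the recursion for \<open>v\<close>.\<close>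

lemma AE_ballistic: "AE \<omega> in M. ballistic_env (E \<omega>) (v (E \<omega>))"
proof -
  have "AE \<omega> in M. \<forall>k. convergent (\<lambda>n. trunc_v n (E \<omega>) k)"
    unfolding AE_all_countable using v_lim(1) by blast
  then show ?thesis using AE_summable_env AE_space
  proof eventually_elim
    case (elim \<omega>)
    then have l: "(\<lambda>n. trunc_v n (E \<omega>) k) \<longlonglongrightarrow> v (E \<omega>) k" for k
      unfolding v_def by (simp add: convergent_LIMSEQ_iff)
    have "(\<lambda>n. odds (E \<omega>) k * trunc_v n (E \<omega>) (k - 1) + (mu_env (E \<omega>) k - 1)\<^sup>2 / (1 - E \<omega> k))
      \<longlonglongrightarrow> odds (E \<omega>) k * v (E \<omega>) (k - 1) + (mu_env (E \<omega>) k - 1)\<^sup>2 / (1 - E \<omega> k)" for k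
      by (intro tendsto_intros l)
    then have "(\<lambda>n. trunc_v (Suc n) (E \<omega>) k) \<longlonglongrightarrow> odds (E \<omega>) k * v (E \<omega>) (k - 1) + (mu_env (E \<omega>) k - 1)\<^sup>2 / (1 - E \<omega> k)" for k
      by simp
    from LIMSEQ_unique[OF LIMSEQ_Suc[OF l] this]
    have rec: "v (E \<omega>) k = odds (E \<omega>) k * v (E \<omega>) (k - 1) + (mu_env (E \<omega>) k - 1)\<^sup>2 / (1 - E \<omega> k)" for k .
    have "0 \<le> v (E \<omega>) k" for k
      using l[of k] trunc_v_nonneg(1)[OF elim(3)] by (intro LIMSEQ_le_const) auto
    then show ?case by (intro ballistic_env.intro ballistic_env_axioms.intro elim(2) rec)
  qed
qed

subsection \<open>Backtracking\<close>

lemma ladder_product: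
  "integrable M (\<lambda>\<omega>. \<Prod>i\<in>{w + 1..w + int j}. odds (E \<omega>) i)"
  "(\<integral>\<omega>. (\<Prod>i\<in>{w + 1..w + int j}. odds (E \<omega>) i) \<partial>M) = al ^ j"
proof -
  have e: "(\<Prod>i\<in>I. odds (E \<omega>) i powr 1) = (\<Prod>i\<in>I. odds (E \<omega>) i)" if "\<omega> \<in> space M" for \<omega> I
    using odds_nonneg[OF that] by (intro prod.cong refl powr_one less_imp_le)
  have e0: "odds (E \<omega>) 0 powr 1 = odds (E \<omega>) 0" if "\<omega> \<in> space M" for \<omega>
    using odds_nonneg[OF that, of 0] by simp
  have i: "integrable M (\<lambda>\<omega>. odds (E \<omega>) 0 powr 1)" using s_pos by (intro int_odds_powr) auto
  have "(\<integral>\<omega>. odds (E \<omega>) 0 powr 1 \<partial>M) = al" unfolding al_def by (intro Bochner_Integration.integral_cong refl e0)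
  with odds_product_moment[OF i, of w j]
  show "integrable M (\<lambda>\<omega>. \<Prod>i\<in>{w + 1..w + int j}. odds (E \<omega>) i)"
    "(\<integral>\<omega>. (\<Prod>i\<in>{w + 1..w + int j}. odds (E \<omega>) i) \<partial>M) = al ^ j"
    using e by (simp_all cong: Bochner_Integration.integrable_cong Bochner_Integration.integral_cong)
qed

text \<open>Independence gives a product of \<open>l + j\<close> odds the mean al^(l + j), so the
  tail of the ladder series is a geometric series in expectation.\<close>

lemma ladder_moment:
  "AE \<omega> in M. summable (\<lambda>j. \<Prod>i\<in>{w + 1..w + int l + int j}. odds (E \<omega>) i)"
  "integrable M (\<lambda>\<omega>. ladder_tail (E \<omega>) w (w + int l))"
  "(\<integral>\<omega>. ladder_tail (E \<omega>) w (w + int l) \<partial>M) \<le> al ^ l / (1 - al)"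
proof -
  let ?f = "\<lambda>n \<omega>. \<Sum>j<n. \<Prod>i\<in>{w + 1..w + int l + int j}. odds (E \<omega>) i"
  have e: "w + int l + int j = w + int (l + j)" for j by simp
  have i: "integrable M (?f n)" for n
    unfolding e by (intro Bochner_Integration.integrable_sum ladder_product)
  have nn: "0 \<le> ?f n \<omega>" if "\<omega> \<in> space M" for n \<omega> by (intro sum_nonneg prod_odds_nonneg that)
  have mono: "?f n \<omega> \<le> ?f (Suc n) \<omega>" if "\<omega> \<in> space M" for n \<omega>
    using prod_odds_nonneg[OF that] by simp
  have B: "(\<integral>\<omega>. ?f n \<omega> \<partial>M) \<le> al ^ l / (1 - al)" for n
  proof -
    have "(\<integral>\<omega>. ?f n \<omega> \<partial>M) = (\<Sum>j<n. al ^ (l + j))"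
      unfolding e by (subst Bochner_Integration.integral_sum) (simp_all only: ladder_product)
    also have "\<dots> = al ^ l * (\<Sum>j<n. al ^ j)" by (simp add: power_add sum_distrib_left)
    also have "\<dots> \<le> al ^ l * (\<Sum>j. al ^ j)"
      using al_bounds by (intro mult_left_mono sum_le_suminf summable_geometric) auto
    also have "\<dots> = al ^ l / (1 - al)" using al_bounds by (simp add: suminf_geometric)
    finally show ?thesis .
  qed
  have m: "AE \<omega> in M. convergent (\<lambda>n. ?f n \<omega>)" "integrable M (\<lambda>\<omega>. lim (\<lambda>n. ?f n \<omega>))"
    "(\<integral>\<omega>. lim (\<lambda>n. ?f n \<omega>) \<partial>M) \<le> al ^ l / (1 - al)"
    by (rule monotone_bounded_integral[where f = ?f and B = "al ^ l / (1 - al)"]; (rule i B | erule nn mono))+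
  show "AE \<omega> in M. summable (\<lambda>j. \<Prod>i\<in>{w + 1..w + int l + int j}. odds (E \<omega>) i)"
    using m(1) by eventually_elim (simp add: summable_iff_convergent)
  have t: "ladder_tail (E \<omega>) w (w + int l) = lim (\<lambda>n. ?f n \<omega>)" for \<omega>
    unfolding ladder_tail_def suminf_eq_lim ..
  show "integrable M (\<lambda>\<omega>. ladder_tail (E \<omega>) w (w + int l))"
    "(\<integral>\<omega>. ladder_tail (E \<omega>) w (w + int l) \<partial>M) \<le> al ^ l / (1 - al)"
    unfolding t by (rule m)+
qed

text \<open>A logarithmic distance that makes the expected fall-back bound of order w^(-2), which is
  summable. The maximum with 1/2 keeps the base of the logarithm positive, as only
  \<open>0 \<le> al\<close> is recorded.\<close>

definition gap :: "nat \<Rightarrow> nat" where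
  "gap w = nat \<lceil>2 * ln (real w) / (- ln (max al (1/2)))\<rceil>"

lemma gap_small: "(\<lambda>w. real (gap w) / sqrt (real w)) \<longlonglongrightarrow> 0"
proof -
  define c where "c = - ln (max al (1/2))"
  have c: "0 < c" using al_bounds by (simp add: c_def)
  have "(\<lambda>w::nat. (2 * ln (real w) / c + 1) / sqrt (real w)) \<longlonglongrightarrow> 0" using c by real_asymp
  moreover have "eventually (\<lambda>w. norm (real (gap w) / sqrt (real w)) \<le> (2 * ln (real w) / c + 1) / sqrt (real w)) sequentially"
    using eventually_ge_at_top[of 1]
  proof eventually_elim
    case (elim w)
    then have "0 \<le> 2 * ln (real w) / c" using c by simp
    then have "real (gap w) \<le> 2 * ln (real w) / c + 1" unfolding gap_def c_def[symmetric] by linarith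
    then show ?case by (simp add: divide_right_mono)
  qed
  ultimately show ?thesis by (rule Lim_null_comparison[rotated])
qed

lemma AE_ladder: "AE \<omega> in M. (\<lambda>w. ladder_tail (E \<omega>) (int w) (int w + int (gap w))) \<longlonglongrightarrow> 0"
proof -
  have AEs: "AE \<omega> in M. \<forall>w::nat. 0 \<le> ladder_tail (E \<omega>) (int w) (int w + int (gap w))"
    unfolding AE_all_countable
  proof
    fix w :: nat
    show "AE \<omega> in M. 0 \<le> ladder_tail (E \<omega>) (int w) (int w + int (gap w))"
      using ladder_moment(1)[of "int w" "gap w"] AE_space
      by eventually_elim (auto intro!: walk_env.ladder_tail_nonneg walk_env_E)
  qed
  \<comment> \<open>The ladder sums are known to be nonnegative only where their series converges,
    whereas the criterion asks for nonnegativity at every point.\<close>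
  let ?f = "\<lambda>w \<omega>. max 0 (ladder_tail (E \<omega>) (int w) (int w + int (gap w)))"
  have "AE \<omega> in M. (\<lambda>w. ?f w \<omega>) \<longlonglongrightarrow> 0"
  proof (rule AE_tendsto_0_of_summable_integral[where c = "\<lambda>w. al ^ gap w / (1 - al)"])
    show "integrable M (?f w)" for w using ladder_moment(2)[of "int w" "gap w"] by simp
    show "(\<integral>\<omega>. ?f w \<omega> \<partial>M) \<le> al ^ gap w / (1 - al)" for w
    proof -
      have "(\<integral>\<omega>. ?f w \<omega> \<partial>M) = (\<integral>\<omega>. ladder_tail (E \<omega>) (int w) (int w + int (gap w)) \<partial>M)"
        by (rule integral_cong_AE) (use AEs ladder_moment(2)[of "int w" "gap w"] in \<open>auto elim: AE_mp\<close>)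
      then show ?thesis using ladder_moment(3)[of "int w" "gap w"] by simp
    qed
    show "summable (\<lambda>w. al ^ gap w / (1 - al))"
    proof (rule summable_divide, rule summable_comparison_test_ev)
      show "summable (\<lambda>w. real w powr (- 2))" by (simp add: summable_real_powr_iff)
      show "eventually (\<lambda>w. norm (al ^ gap w) \<le> real w powr (- 2)) sequentially"
        using eventually_ge_at_top[of 1]
      proof eventually_elim
        case (elim w)
        define b where "b = max al (1/2)"
        have b: "0 < b" "b < 1" "al \<le> b" using al_bounds by (auto simp: b_def less_max_iff_disj)
        have lb: "ln b < 0" using b by simp
        have "2 * ln (real w) / (- ln b) \<le> real (gap w)" unfolding gap_def b_def by linarith
        then have "2 * ln (real w) \<le> real (gap w) * (- ln b)" using lb by (subst (asm) pos_divide_le_eq) auto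
        then have "real (gap w) * ln b \<le> - 2 * ln (real w)" by simp
        then have "exp (real (gap w) * ln b) \<le> exp (- 2 * ln (real w))" by simp
        moreover have "exp (real (gap w) * ln b) = b ^ gap w" using b by (simp add: exp_of_nat_mult)
        moreover have "exp (- 2 * ln (real w)) = real w powr (- 2)" using elim by (simp add: powr_def)
        moreover have "al ^ gap w \<le> b ^ gap w" using b al_bounds by (intro power_mono) auto
        ultimately show ?case using al_bounds by simp
      qed
    qed
  qed auto
  then show ?thesis using AEs by eventually_elim (simp add: max_absorb2)
qed

lemma AE_ladder_summable: "AE \<omega> in M. \<forall>w. summable (\<lambda>j. \<Prod>i\<in>{w + 1..w + int j}. odds (E \<omega>) i)"
  unfolding AE_all_countable using ladder_moment(1)[of _ 0] by simp

end

context moment_env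
begin

subsection \<open>Window sums of the quenched means\<close>

abbreviation "mbar \<equiv> mu_mean M T p"

text \<open>Stationarity under \<open>T\<close> moves the site by one in either direction.\<close>

lemma integral_mu: "(\<integral>\<omega>. mu_env (E \<omega>) k \<partial>M) = mbar"
proof -
  have step: "(\<integral>\<omega>. mu_env (E \<omega>) (k + 1) \<partial>M) = (\<integral>\<omega>. mu_env (E \<omega>) k \<partial>M)" for k
  proof -
    have "(\<integral>\<omega>. mu_env (E \<omega>) (k + 1) \<partial>M) = (\<integral>\<omega>. mu_env (E (T \<omega>)) k \<partial>M)"
      by (rule Bochner_Integration.integral_cong) (simp_all add: E_T' mu_env_shift)
    also have "\<dots> = (\<integral>\<omega>. mu_env (E \<omega>) k \<partial>M)"
      by (rule integral_mpt(2)[OF meas_T pres_T int_mu])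
    finally show ?thesis .
  qed
  show ?thesis
  proof (induction k rule: int_induct[of _ 0])
    case base
    show ?case by (simp add: mu_mean_def)
  next
    case (step1 i)
    then show ?case by (simp add: step)
  next
    case (step2 i)
    then show ?case using step[of "i - 1"] by simp
  qed
qed

lemma mbar_eq: "mbar = 1 + al * (1 + mbar)"
proof -
  have G: "(\<lambda>a. 1 + mu_env a (0 - 1)) \<in> borel_measurable (PiM {..<0} (\<lambda>_. borel))"
    by (intro borel_measurable_add measurable_mu_env) auto
  have cg: "1 + mu_env a (0 - 1) = 1 + mu_env b (0 - 1)" if "\<And>i. i < 0 \<Longrightarrow> a i = b i" for a b
    using that mu_env_cong[of "0 - 1" a b] by simp
  have gi: "integrable M (\<lambda>\<omega>. 1 + mu_env (E \<omega>) (0 - 1))" using int_mu by simp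
  note past = odds_times_past[OF G cg gi]
  have "mbar = (\<integral>\<omega>. mu_env (E \<omega>) 0 \<partial>M)" by (simp add: integral_mu)
  also have "\<dots> = (\<integral>\<omega>. 1 + odds (E \<omega>) 0 * (1 + mu_env (E \<omega>) (0 - 1)) \<partial>M)"
    by (rule integral_cong_AE) (use AE_mu_rec[of 0] in auto)
  also have "\<dots> = 1 + al * (1 + mbar)"
    using past int_mu by (simp add: prob_space integral_mu)
  finally show ?thesis .
qed

lemma mbar_pos: "0 < mbar"
proof -
  have "1 \<le> mbar"
  proof -
    have "(\<integral>\<omega>. 1 \<partial>M) \<le> (\<integral>\<omega>. mu_env (E \<omega>) 0 \<partial>M)"
      by (rule integral_mono_AE) (use int_mu AE_mu_ge_1[of 0] in \<open>auto elim: AE_mp\<close>)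
    then show ?thesis by (simp add: integral_mu prob_space)
  qed
  then show ?thesis by simp
qed

text \<open>The innovation of \<open>mu\<close> at site \<open>k\<close>: its value minus its
  conditional mean given the sites before \<open>k\<close>.\<close>

definition mdiff :: "(int \<Rightarrow> real) \<Rightarrow> int \<Rightarrow> real" where
  "mdiff a k = (odds a k - al) * (1 + mu_env a (k - 1))"

lemma measurable_mdiff: "{..k} \<subseteq> U \<Longrightarrow> (\<lambda>a. mdiff a k) \<in> borel_measurable (PiM U (\<lambda>_. borel))"
  unfolding mdiff_def
  by (intro borel_measurable_times borel_measurable_diff borel_measurable_add measurable_odds measurable_mu_env) auto

lemma meas_mdiff [measurable]: "(\<lambda>\<omega>. mdiff (E \<omega>) k) \<in> borel_measurable M"
  by (rule meas_past[OF measurable_mdiff]) simp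

lemma mdiff_cong: "(\<And>i. i \<le> k \<Longrightarrow> a i = b i) \<Longrightarrow> mdiff a k = mdiff b k"
  unfolding mdiff_def using mu_env_cong[of "k - 1" a b] by (simp add: odds_def)

lemma square_powr: "0 \<le> y \<Longrightarrow> (y\<^sup>2) powr (1 + s) = y powr pw"
  by (cases "y = 0") (auto simp: pw_def powr_powr algebra_simps simp flip: powr_numeral)

definition c_odds :: real where
  "c_odds = (\<integral>\<omega>. ((odds (E \<omega>) 0 - al)\<^sup>2) powr (1 + s) \<partial>M)"

lemma int_centered_odds: "integrable M (\<lambda>\<omega>. ((odds (E \<omega>) k - al)\<^sup>2) powr (1 + s))"
proof (rule Bochner_Integration.integrable_bound[where f = "\<lambda>\<omega>. odds (E \<omega>) k powr pw + 1"])
  show "integrable M (\<lambda>\<omega>. odds (E \<omega>) k powr pw + 1)"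
    using int_odds_powr[of pw k] pw by (simp add: pw_def)
  show "AE \<omega> in M. norm (((odds (E \<omega>) k - al)\<^sup>2) powr (1 + s)) \<le> norm (odds (E \<omega>) k powr pw + 1)"
  proof (rule AE_I2)
    fix \<omega> assume \<omega>: "\<omega> \<in> space M"
    define x where "x = odds (E \<omega>) k"
    have x: "0 < x" using odds_nonneg[OF \<omega>] by (simp add: x_def)
    have "((x - al)\<^sup>2) powr (1 + s) = \<bar>x - al\<bar> powr pw" using square_powr[of "\<bar>x - al\<bar>"] by simp
    also have "\<dots> \<le> (max x 1) powr pw" using x al_bounds pw by (intro powr_mono2) (auto simp: max_def)
    also have "\<dots> \<le> x powr pw + 1" by (simp add: max_def)
    finally show "norm (((odds (E \<omega>) k - al)\<^sup>2) powr (1 + s)) \<le> norm (odds (E \<omega>) k powr pw + 1)"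
      by (simp add: x_def)
  qed
qed measurable

text \<open>The centred odds at site \<open>k\<close> and the mean at site \<open>k - 1\<close> are
  independent, so the moment factors.\<close>

lemma mdiff_moment:
  "integrable M (\<lambda>\<omega>. ((mdiff (E \<omega>) k)\<^sup>2) powr (1 + s))"
  "(\<integral>\<omega>. ((mdiff (E \<omega>) k)\<^sup>2) powr (1 + s) \<partial>M) \<le> c_odds * mean_pw"
proof -
  let ?f = "\<lambda>x::real. (((1 - x) / x - al)\<^sup>2) powr (1 + s)" and ?G = "\<lambda>a. ((1 + mu_env a (k - 1))\<^sup>2) powr (1 + s)"
  have f: "?f \<in> borel_measurable borel" by measurable
  have G: "?G \<in> borel_measurable (PiM {..<k} (\<lambda>_. borel))"
    by (intro powr_real_measurable borel_measurable_power borel_measurable_add measurable_mu_env) auto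
  have cg: "?G a = ?G b" if "\<And>i. i < k \<Longrightarrow> a i = b i" for a b
    using that mu_env_cong[of "k - 1" a b] by simp
  have eqG: "AE \<omega> in M. (1 + mu_env (E \<omega>) (k - 1)) powr pw = ?G (E \<omega>)"
    using AE_mu_ge_1[of "k - 1"] by eventually_elim (simp add: square_powr)
  have Gm: "(\<lambda>\<omega>. ?G (E \<omega>)) \<in> borel_measurable M" by measurable
  have Gi: "integrable M (\<lambda>\<omega>. ?G (E \<omega>))"
    by (rule integrable_cong_AE_imp[OF int_mu_pw Gm]) (use eqG in auto)
  have Ge: "(\<integral>\<omega>. ?G (E \<omega>) \<partial>M) \<le> mean_pw"
  proof -
    have "(\<integral>\<omega>. ?G (E \<omega>) \<partial>M) = (\<integral>\<omega>. (1 + mu_env (E \<omega>) (k - 1)) powr pw \<partial>M)"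
      by (rule integral_cong_AE) (use eqG in auto)
    then show ?thesis using mean_pw(2) by simp
  qed
  have fi: "integrable M (\<lambda>\<omega>. ?f (E \<omega> k))" using int_centered_odds[of k] by (simp add: odds_def)
  have fe: "(\<integral>\<omega>. ?f (E \<omega> k) \<partial>M) = c_odds"
    unfolding c_odds_def odds_def by (rule integral_E(2)[OF f])
  have e: "((mdiff a k)\<^sup>2) powr (1 + s) = ?f (a k) * ?G a" for a
    by (simp add: mdiff_def odds_def power_mult_distrib powr_mult)
  note past = integral_past[OF f G cg fi Gi]
  show "integrable M (\<lambda>\<omega>. ((mdiff (E \<omega>) k)\<^sup>2) powr (1 + s))" unfolding e by (rule past(1))
  have "0 \<le> c_odds" unfolding c_odds_def by (rule integral_nonneg_AE) auto
  then have "c_odds * (\<integral>\<omega>. ?G (E \<omega>) \<partial>M) \<le> c_odds * mean_pw" using Ge by (rule mult_left_mono[rotated])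
  moreover have "(\<integral>\<omega>. ((mdiff (E \<omega>) k)\<^sup>2) powr (1 + s) \<partial>M) = c_odds * (\<integral>\<omega>. ?G (E \<omega>) \<partial>M)"
    using past(2) unfolding e fe .
  ultimately show "(\<integral>\<omega>. ((mdiff (E \<omega>) k)\<^sup>2) powr (1 + s) \<partial>M) \<le> c_odds * mean_pw" by simp
qed

text \<open>The derivative at the preceding sum times 1 + mu_(k-1) depends on earlier sites only,
  and the remaining factor A_k - al is independent of it with mean zero. The hypothesis is used,
  through \<open>abs_smooth_pow'_mult_le\<close>, to make the past factor integrable.\<close>

lemma mdiff_orthogonal:
  assumes int: "integrable M (\<lambda>\<omega>. smooth_pow s (\<Sum>i<n. mdiff (E \<omega>) (j + int i)))"
  shows "(\<integral>\<omega>. smooth_pow' s (\<Sum>i<n. mdiff (E \<omega>) (j + int i)) * mdiff (E \<omega>) (j + int n) \<partial>M) = 0"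
proof -
  let ?k = "j + int n"
  let ?S = "\<lambda>a. \<Sum>i<n. mdiff a (j + int i)"
  let ?f = "\<lambda>x::real. (1 - x) / x - al" and ?G = "\<lambda>a. smooth_pow' s (?S a) * (1 + mu_env a (?k - 1))"
  have f: "?f \<in> borel_measurable borel" by measurable
  have SM: "?S \<in> borel_measurable (PiM {..<?k} (\<lambda>_. borel))"
    by (intro borel_measurable_sum measurable_mdiff) auto
  have G: "?G \<in> borel_measurable (PiM {..<?k} (\<lambda>_. borel))"
    by (intro borel_measurable_times borel_measurable_add measurable_mu_env measurable_compose[OF SM borel_measurable_smooth_pow(2)]) auto
  have cg: "?G a = ?G b" if ab: "\<And>i. i < ?k \<Longrightarrow> a i = b i" for a b
  proof -
    have "?S a = ?S b" using ab by (intro sum.cong refl mdiff_cong) auto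
    moreover have "mu_env a (?k - 1) = mu_env b (?k - 1)" using ab by (intro mu_env_cong) auto
    ultimately show ?thesis by simp
  qed
  have fi: "integrable M (\<lambda>\<omega>. ?f (E \<omega> ?k))" using int_odds1[of ?k] by (simp add: odds_def)
  have fe: "(\<integral>\<omega>. ?f (E \<omega> ?k) \<partial>M) = 0" using int_odds1[of ?k] integral_odds[of ?k] by (simp add: odds_def prob_space)
  have Gi: "integrable M (\<lambda>\<omega>. ?G (E \<omega>))"
  proof (rule Bochner_Integration.integrable_bound[where f = "\<lambda>\<omega>. 2 * (1 + s) * (smooth_pow s (?S (E \<omega>)) + (1 + mu_env (E \<omega>) (?k - 1)) powr pw)"])
    show "integrable M (\<lambda>\<omega>. 2 * (1 + s) * (smooth_pow s (?S (E \<omega>)) + (1 + mu_env (E \<omega>) (?k - 1)) powr pw))"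
      using int int_mu_pw by simp
    show "AE \<omega> in M. norm (?G (E \<omega>)) \<le> norm (2 * (1 + s) * (smooth_pow s (?S (E \<omega>)) + (1 + mu_env (E \<omega>) (?k - 1)) powr pw))"
      using AE_mu_ge_1[of "?k - 1"]
    proof eventually_elim
      case (elim \<omega>)
      have "\<bar>?G (E \<omega>)\<bar> \<le> 2 * (1 + s) * (smooth_pow s (?S (E \<omega>)) + ((1 + mu_env (E \<omega>) (?k - 1))\<^sup>2) powr (1 + s))"
        using s_pos by (intro abs_smooth_pow'_mult_le) simp
      also have "((1 + mu_env (E \<omega>) (?k - 1))\<^sup>2) powr (1 + s) = (1 + mu_env (E \<omega>) (?k - 1)) powr pw"
        using elim by (intro square_powr) simp
      finally show ?case unfolding real_norm_def by (rule order_trans[OF _ abs_ge_self])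
    qed
  qed measurable
  have e: "smooth_pow' s (?S a) * mdiff a ?k = ?f (a ?k) * ?G a" for a
    by (simp add: mdiff_def odds_def mult_ac)
  show ?thesis using integral_past(2)[OF f G cg fi Gi] unfolding e fe by simp
qed

lemma mdiff_sum_moment:
  "\<exists>C\<ge>0. \<forall>j n. 1 \<le> n \<longrightarrow> integrable M (\<lambda>\<omega>. smooth_pow s (\<Sum>i<n. mdiff (E \<omega>) (j + int i))) \<and>
    (\<integral>\<omega>. smooth_pow s (\<Sum>i<n. mdiff (E \<omega>) (j + int i)) \<partial>M) \<le> C * real n powr (1 + s)"
proof -
  define C where "C = (1 + s) * (1 + 2 * s) * 4 powr s"
  have C0: "0 \<le> C" using s_pos by (simp add: C_def)
  have m0: "0 \<le> c_odds * mean_pw"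
    using mean_pw(1) by (intro mult_nonneg_nonneg) (auto simp: c_odds_def intro!: integral_nonneg_AE)
  show ?thesis
  proof (intro exI[of _ "exp C * (1 + 2 * C * (c_odds * mean_pw))"] conjI allI impI)
    show "0 \<le> exp C * (1 + 2 * C * (c_odds * mean_pw))" using C0 m0 by simp
    fix j :: int and n :: nat assume n: "1 \<le> n"
    note mm = martingale_moment_bound[where D = "\<lambda>i \<omega>. mdiff (E \<omega>) (j + int i)" and m = "c_odds * mean_pw" and s = s and n = n,
        OF less_imp_le[OF s_pos] meas_mdiff mdiff_moment(1) mdiff_moment(2) mdiff_orthogonal n]
    show "integrable M (\<lambda>\<omega>. smooth_pow s (\<Sum>i<n. mdiff (E \<omega>) (j + int i)))" by (rule mm(1))
    show "(\<integral>\<omega>. smooth_pow s (\<Sum>i<n. mdiff (E \<omega>) (j + int i)) \<partial>M) \<le> exp C * (1 + 2 * C * (c_odds * mean_pw)) * real n powr (1 + s)"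
      using mm(2) by (simp add: C_def)
  qed
qed

text \<open>Subtracting \<open>al\<close> times the centred mean at site k from mu_k - mbar = D_k +
  al (mu_(k-1) - mbar) leaves the innovation and a telescoping difference.\<close>

lemma window_decomposition:
  assumes "summable_env (E \<omega>)"
  shows "(1 - al) * (\<Sum>i<n. mu_env (E \<omega>) (j + int i) - mbar) =
    (\<Sum>i<n. mdiff (E \<omega>) (j + int i)) + al * (mu_env (E \<omega>) (j - 1) - mu_env (E \<omega>) (j + int n - 1))"
proof (induction n)
  case (Suc n)
  let ?k = "j + int n"
  have "mu_env (E \<omega>) ?k = 1 + odds (E \<omega>) ?k * (1 + mu_env (E \<omega>) (?k - 1))"
    by (rule summable_env.mu_rec[OF assms])
  then have "mu_env (E \<omega>) ?k - mbar = mdiff (E \<omega>) ?k + al * (mu_env (E \<omega>) (?k - 1) - mbar)"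
    using mbar_eq by (simp add: mdiff_def algebra_simps)
  then have "(1 - al) * (mu_env (E \<omega>) ?k - mbar) = mdiff (E \<omega>) ?k + al * (mu_env (E \<omega>) (?k - 1) - mu_env (E \<omega>) ?k)"
    by (simp add: algebra_simps)
  then show ?case using Suc by (simp add: distrib_left algebra_simps)
qed simp

definition mu_sum :: "nat \<Rightarrow> 'a \<Rightarrow> real" where
  "mu_sum n \<omega> = (\<Sum>k<n. mu_env (E \<omega>) (int k) - mbar)"

text \<open>The innovation sum has the martingale bound, and the two boundary values have bounded
  moments whatever the length of the window.\<close>

lemma window_moment:
  "\<exists>C. \<forall>a b. a < b \<longrightarrow> integrable M (\<lambda>\<omega>. ((mu_sum b \<omega> - mu_sum a \<omega>)\<^sup>2) powr (1 + s)) \<and>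
    (\<integral>\<omega>. ((mu_sum b \<omega> - mu_sum a \<omega>)\<^sup>2) powr (1 + s) \<partial>M) \<le> C * real (b - a) powr (1 + s)"
proof -
  obtain C where C: "0 \<le> C" "\<And>j n. 1 \<le> n \<Longrightarrow> integrable M (\<lambda>\<omega>. smooth_pow s (\<Sum>i<n. mdiff (E \<omega>) (j + int i)))"
    "\<And>j n. 1 \<le> n \<Longrightarrow> (\<integral>\<omega>. smooth_pow s (\<Sum>i<n. mdiff (E \<omega>) (j + int i)) \<partial>M) \<le> C * real n powr (1 + s)"
    using mdiff_sum_moment by blast
  \<comment> \<open>Three terms, each at most sqrt m, give the factor 9 after squaring; the
    denominator comes from the factor \<open>1 - al\<close> in the decomposition.\<close>
  define K where "K = (9 / (1 - al)\<^sup>2) powr (1 + s)"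
  have K0: "0 \<le> K" by (simp add: K_def)
  have main: "integrable M (\<lambda>\<omega>. ((mu_sum b \<omega> - mu_sum a \<omega>)\<^sup>2) powr (1 + s)) \<and>
    (\<integral>\<omega>. ((mu_sum b \<omega> - mu_sum a \<omega>)\<^sup>2) powr (1 + s) \<partial>M) \<le> K * (C + 2 * mean_pw) * real (b - a) powr (1 + s)"
    if ab: "a < b" for a b
  proof -
    define n where "n = b - a"
    have n: "1 \<le> n" "b = a + n" using ab by (auto simp: n_def)
    let ?j = "int a"
    let ?S = "\<lambda>\<omega>. \<Sum>i<n. mdiff (E \<omega>) (?j + int i)"
    let ?M = "\<lambda>k \<omega>. 1 + mu_env (E \<omega>) k"
    let ?R = "\<lambda>\<omega>. K * (smooth_pow s (?S \<omega>) + ?M (?j - 1) \<omega> powr pw + ?M (?j + int n - 1) \<omega> powr pw)"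
    have X: "mu_sum b \<omega> - mu_sum a \<omega> = (\<Sum>i<n. mu_env (E \<omega>) (?j + int i) - mbar)" for \<omega>
    proof -
      have "mu_sum (a + m) \<omega> = mu_sum a \<omega> + (\<Sum>i<m. mu_env (E \<omega>) (?j + int i) - mbar)" for m
        by (induction m) (simp_all add: mu_sum_def)
      from this[of n] show ?thesis unfolding n(2) by simp
    qed
    have le: "AE \<omega> in M. ((mu_sum b \<omega> - mu_sum a \<omega>)\<^sup>2) powr (1 + s) \<le> ?R \<omega>"
      using AE_summable_env AE_mu_ge_1[of "?j - 1"] AE_mu_ge_1[of "?j + int n - 1"]
    proof eventually_elim
      case (elim \<omega>)
      define x y z w where "x = mu_sum b \<omega> - mu_sum a \<omega>" and "y = ?S \<omega>" and "z = ?M (?j - 1) \<omega>" and "w = ?M (?j + int n - 1) \<omega>"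
      have zw: "0 < z" "0 < w" using elim by (auto simp: z_def w_def)
      have id: "(1 - al) * x = y + al * (z - w)"
        using window_decomposition[OF elim(1), where n = n and j = ?j] by (simp add: X x_def y_def z_def w_def)
      have "\<bar>al * (z - w)\<bar> \<le> 1 * (z + w)"
        unfolding abs_mult using al_bounds zw by (intro mult_mono) auto
      have "(1 - al) * \<bar>x\<bar> \<le> \<bar>y\<bar> + z + w"
      proof -
        have "(1 - al) * \<bar>x\<bar> = \<bar>(1 - al) * x\<bar>" using al_bounds by (simp add: abs_mult)
        also have "\<dots> \<le> \<bar>y\<bar> + \<bar>al * (z - w)\<bar>" unfolding id by (rule abs_triangle_ineq)
        finally show ?thesis using \<open>\<bar>al * (z - w)\<bar> \<le> 1 * (z + w)\<close> by simp
      qed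
      define m where "m = max (1 + y\<^sup>2) (max (z\<^sup>2) (w\<^sup>2))"
      have m: "y\<^sup>2 \<le> m" "z\<^sup>2 \<le> m" "w\<^sup>2 \<le> m" "0 \<le> m" by (auto simp: m_def le_max_iff_disj)
      have sq: "\<bar>t\<bar> \<le> sqrt m" if "t\<^sup>2 \<le> m" for t using real_sqrt_le_mono[OF that] by simp
      have "(1 - al) * \<bar>x\<bar> \<le> 3 * sqrt m"
        using \<open>(1 - al) * \<bar>x\<bar> \<le> \<bar>y\<bar> + z + w\<close> sq[OF m(1)] sq[OF m(2)] sq[OF m(3)] by linarith
      then have "((1 - al) * \<bar>x\<bar>)\<^sup>2 \<le> (3 * sqrt m)\<^sup>2" using al_bounds by (intro power_mono) auto
      then have "(1 - al)\<^sup>2 * x\<^sup>2 \<le> 9 * m" using m(4) by (simp add: power_mult_distrib)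
      then have "x\<^sup>2 \<le> 9 / (1 - al)\<^sup>2 * m" using al_bounds by (simp add: pos_le_divide_eq mult.commute)
      then have "(x\<^sup>2) powr (1 + s) \<le> (9 / (1 - al)\<^sup>2 * m) powr (1 + s)" using s_pos by (intro powr_mono2) auto
      also have "\<dots> = K * m powr (1 + s)" unfolding K_def by (rule powr_mult)
      also have "\<dots> \<le> K * (smooth_pow s y + z powr pw + w powr pw)"
      proof (rule mult_left_mono[OF _ K0])
        have "m powr (1 + s) \<le> (1 + y\<^sup>2) powr (1 + s) + (z\<^sup>2) powr (1 + s) + (w\<^sup>2) powr (1 + s)"
          by (auto simp: m_def max_def)
        then show "m powr (1 + s) \<le> smooth_pow s y + z powr pw + w powr pw"
          using zw by (simp add: smooth_pow_def square_powr)
      qed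
      finally show ?case by (simp add: x_def y_def z_def w_def)
    qed
    have Ri: "integrable M ?R" using C(2)[OF n(1)] int_mu_pw by simp
    have meas: "(\<lambda>\<omega>. ((mu_sum b \<omega> - mu_sum a \<omega>)\<^sup>2) powr (1 + s)) \<in> borel_measurable M"
      unfolding mu_sum_def by measurable
    have i: "integrable M (\<lambda>\<omega>. ((mu_sum b \<omega> - mu_sum a \<omega>)\<^sup>2) powr (1 + s))"
    proof (rule Bochner_Integration.integrable_bound[OF Ri meas])
      show "AE \<omega> in M. norm (((mu_sum b \<omega> - mu_sum a \<omega>)\<^sup>2) powr (1 + s)) \<le> norm (?R \<omega>)"
        using le
      proof eventually_elim
        case (elim \<omega>)
        from order_trans[OF elim abs_ge_self] show ?case by (simp only: real_norm_def abs_of_nonneg[OF powr_ge_zero])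
      qed
    qed
    have "(\<integral>\<omega>. ((mu_sum b \<omega> - mu_sum a \<omega>)\<^sup>2) powr (1 + s) \<partial>M) \<le> (\<integral>\<omega>. ?R \<omega> \<partial>M)"
      by (rule integral_mono_AE[OF i Ri le])
    also have "\<dots> = K * ((\<integral>\<omega>. smooth_pow s (?S \<omega>) \<partial>M) + (\<integral>\<omega>. ?M (?j - 1) \<omega> powr pw \<partial>M) + (\<integral>\<omega>. ?M (?j + int n - 1) \<omega> powr pw \<partial>M))"
      using C(2)[OF n(1)] int_mu_pw by simp
    also have "\<dots> \<le> K * (C * real n powr (1 + s) + mean_pw + mean_pw)"
      by (intro mult_left_mono add_mono C(3) n(1) mean_pw(2) K0)
    \<comment> \<open>As \<open>n \<ge> 1\<close>, the bounded boundary terms can be charged to the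
      growing power.\<close>
    also have "\<dots> \<le> K * (C * real n powr (1 + s) + mean_pw * real n powr (1 + s) + mean_pw * real n powr (1 + s))"
    proof -
      have "1 \<le> real n powr (1 + s)" using n s_pos by (intro ge_one_powr_ge_zero) auto
      from mult_left_mono[OF this mean_pw(1)] have "mean_pw \<le> mean_pw * real n powr (1 + s)" by simp
      then show ?thesis by (intro mult_left_mono add_mono order_refl K0)
    qed
    also have "\<dots> = K * (C + 2 * mean_pw) * real (b - a) powr (1 + s)" by (simp add: n_def algebra_simps)
    finally show ?thesis using i by simp
  qed
  then show ?thesis by blast
qed

text \<open>The exceptional set and the constant are chosen before the window, so the bound may
  later be used at positions that depend on the environment and on x.\<close>

lemma AE_window:
  "AE \<omega> in M. \<exists>K\<ge>0. \<forall>x y i j. 1 \<le> y \<longrightarrow> y \<le> x \<longrightarrow> i \<le> j \<longrightarrow> real j \<le> x \<longrightarrow> real j \<le> real i + y \<longrightarrow>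
     \<bar>mu_sum j \<omega> - mu_sum i \<omega>\<bar> \<le> K * (1 + ln x) * (x powr (1 + s / 8) * y powr s) powr (1 / (2 * (1 + s)))"
proof -
  obtain C where C: "\<And>a b. a < b \<Longrightarrow> integrable M (\<lambda>\<omega>. ((mu_sum b \<omega> - mu_sum a \<omega>)\<^sup>2) powr (1 + s))"
    "\<And>a b. a < b \<Longrightarrow> (\<integral>\<omega>. ((mu_sum b \<omega> - mu_sum a \<omega>)\<^sup>2) powr (1 + s) \<partial>M) \<le> C * real (b - a) powr (1 + s)"
    using window_moment by blast
  have "AE \<omega> in M. \<exists>K>0. \<forall>N j i. j \<le> N \<longrightarrow> (i + 1) * 2 ^ j \<le> 2 ^ N \<longrightarrow>
    ((mu_sum ((i + 1) * 2 ^ j) \<omega> - mu_sum (i * 2 ^ j) \<omega>)\<^sup>2) powr (1 + s) \<le> K * ((2 ^ N) powr (1 + s / 8) * (2 ^ j) powr s)"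
    by (rule AE_dyadic_increments[OF s_pos, of mu_sum C]) (rule C, assumption)+
  then show ?thesis
  proof eventually_elim
    case (elim \<omega>)
    then obtain K where K: "0 < K" "\<And>N j i. j \<le> N \<Longrightarrow> (i + 1) * 2 ^ j \<le> 2 ^ N \<Longrightarrow>
      ((mu_sum ((i + 1) * 2 ^ j) \<omega> - mu_sum (i * 2 ^ j) \<omega>)\<^sup>2) powr (1 + s) \<le> K * ((2 ^ N) powr (1 + s / 8) * (2 ^ j) powr s)"
      by blast
    show ?case
    proof (rule window_bound[where S = "\<lambda>n. mu_sum n \<omega>", OF s_pos K])
      fix K' assume K': "0 \<le> K'" "\<And>x y a b. 1 \<le> y \<Longrightarrow> y \<le> x \<Longrightarrow> a \<le> b \<Longrightarrow> real b \<le> x \<Longrightarrow> real b \<le> real a + y \<Longrightarrow>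
        \<bar>mu_sum b \<omega> - mu_sum a \<omega>\<bar> \<le> K' * (1 + ln x) * (x powr (1 + s / 8) * y powr s) powr (1 / (2 * (1 + s)))"
      show ?case by (intro exI[of _ K'] conjI K'(1) allI impI K'(2))
    qed
  qed
qed

end

lemma expectation_eq_count_space:
  fixes f :: "nat \<Rightarrow> real"
  shows "measure_pmf.expectation q f = (\<integral>t. pmf q t * f t \<partial>count_space UNIV)"
  by (subst measure_pmf_eq_density, subst integral_density) auto

context moment_env
begin

subsection \<open>Ergodic averages\<close>

lemma meas_first_passage: "(\<lambda>\<omega>. first_passage (E \<omega>) t z y) \<in> borel_measurable M"
proof (induction t arbitrary: z)
  case (Suc t)
  note [measurable] = Suc
  show ?case by simp
qed simp

text \<open>The formula with the default mass holds for every environment in the space, so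
  measurability is obtained everywhere and not merely up to a null set.\<close>

lemma meas_pmf_hit: "(\<lambda>\<omega>. pmf (hit_pmf (E \<omega>) 0 1) t) \<in> borel_measurable M"
proof -
  note [measurable] = meas_first_passage
  have "(\<lambda>\<omega>. first_passage (E \<omega>) t 0 1 + (if t = (LEAST t. False) then 1 - (\<Sum>t. first_passage (E \<omega>) t 0 1) else 0)) \<in> borel_measurable M"
    by measurable
  then show ?thesis
    by (rule measurable_cong[THEN iffD1, rotated]) (simp add: walk_env.pmf_hit_pmf_eq[OF walk_env_E])
qed

text \<open>Both the law and the integrand vary with the environment. Writing the expectation as an
  integral over counting measure reduces this to joint measurability, which is automatic when one
  variable is countable.\<close>

lemma meas_expectation_hit:
  fixes f :: "'a \<Rightarrow> nat \<Rightarrow> real"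
  assumes [measurable]: "\<And>t. (\<lambda>\<omega>. f \<omega> t) \<in> borel_measurable M"
  shows "(\<lambda>\<omega>. measure_pmf.expectation (hit_pmf (E \<omega>) 0 1) (f \<omega>)) \<in> borel_measurable M"
proof -
  note [measurable] = meas_pmf_hit
  have "(\<lambda>(t, \<omega>). pmf (hit_pmf (E \<omega>) 0 1) t * f \<omega> t) \<in> borel_measurable (count_space UNIV \<Otimes>\<^sub>M M)"
    by (rule measurable_pair_measure_countable1) auto
  from measurable_compose[OF measurable_pair_swap' this]
  have "(\<lambda>(\<omega>, t). pmf (hit_pmf (E \<omega>) 0 1) t * f \<omega> t) \<in> borel_measurable (M \<Otimes>\<^sub>M count_space UNIV)"
    by (simp add: case_prod_beta')
  then show ?thesis unfolding expectation_eq_count_space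
    by (rule sigma_finite_measure.borel_measurable_lebesgue_integral[OF sigma_finite_measure_count_space])
qed

lemma meas_var_tau [measurable]: "(\<lambda>\<omega>. var_tau (E \<omega>) 0) \<in> borel_measurable M"
proof -
  have [measurable]: "(\<lambda>\<omega>. measure_pmf.expectation (hit_pmf (E \<omega>) 0 1) real) \<in> borel_measurable M"
    by (rule meas_expectation_hit) simp
  show ?thesis unfolding var_tau_eq using meas_expectation_hit[of "\<lambda>\<omega> t. (real t - measure_pmf.expectation (hit_pmf (E \<omega>) 0 1) real)\<^sup>2"] by simp
qed

lemma meas_trunc_var [measurable]: "(\<lambda>\<omega>. trunc_var (E \<omega>) K 0) \<in> borel_measurable M"
proof -
  have "(\<lambda>\<omega>. (real t - mu_env (E \<omega>) 0)\<^sup>2 * (if K < \<bar>real t - mu_env (E \<omega>) 0\<bar> then 1 else 0)) \<in> borel_measurable M" for t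
    by measurable
  then show ?thesis unfolding trunc_var_def
    using meas_expectation_hit[of "\<lambda>\<omega> t. (real t - mu_env (E \<omega>) 0)\<^sup>2 * indicator {t. K < \<bar>real t - mu_env (E \<omega>) 0\<bar>} t"]
    by (simp add: indicator_def)
qed

lemma int_var_tau: "integrable M (\<lambda>\<omega>. var_tau (E \<omega>) 0)"
proof (rule Bochner_Integration.integrable_bound[OF v_lim(2)[of 0]])
  show "AE \<omega> in M. norm (var_tau (E \<omega>) 0) \<le> norm (v (E \<omega>) 0)"
    using AE_ballistic
  proof eventually_elim
    case (elim \<omega>)
    from ballistic_env.var_tau_le[OF elim, of 0] ballistic_env.var_tau_pos[OF elim, of 0] show ?case by simp
  qed
qed measurable

lemma sigma2_pos: "0 < sigma2 M T p"
proof -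
  have pos: "AE \<omega> in M. 0 < var_tau (E \<omega>) 0"
    using AE_ballistic by eventually_elim (rule ballistic_env.var_tau_pos)
  have nn: "AE \<omega> in M. 0 \<le> var_tau (E \<omega>) 0" using pos by eventually_elim simp
  have "\<not> (AE \<omega> in M. var_tau (E \<omega>) 0 = 0)"
  proof
    assume "AE \<omega> in M. var_tau (E \<omega>) 0 = 0"
    then have "AE \<omega> in M. False" using pos by eventually_elim simp
    then show False by simp
  qed
  then have "sigma2 M T p \<noteq> 0"
    unfolding sigma2_def using integral_nonneg_eq_0_iff_AE[OF int_var_tau nn] by simp
  moreover have "0 \<le> sigma2 M T p" unfolding sigma2_def by (rule integral_nonneg_AE[OF nn])
  ultimately show ?thesis by simp
qed

lemma int_trunc_var: "integrable M (\<lambda>\<omega>. trunc_var (E \<omega>) K 0)"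
proof (rule Bochner_Integration.integrable_bound[OF int_var_tau])
  show "AE \<omega> in M. norm (trunc_var (E \<omega>) K 0) \<le> norm (var_tau (E \<omega>) 0)"
    using AE_ballistic
  proof eventually_elim
    case (elim \<omega>)
    from ballistic_env.trunc_var_bounds[OF elim, of K 0] show ?case by simp
  qed
qed measurable

lemma trunc_var_mean_tendsto: "(\<lambda>n. \<integral>\<omega>. trunc_var (E \<omega>) (real n) 0 \<partial>M) \<longlonglongrightarrow> 0"
proof -
  have "(\<lambda>n. \<integral>\<omega>. trunc_var (E \<omega>) (real n) 0 \<partial>M) \<longlonglongrightarrow> (\<integral>\<omega>. 0 \<partial>M)"
  proof (rule integral_dominated_convergence[OF _ _ int_var_tau])
    show "AE \<omega> in M. (\<lambda>n. trunc_var (E \<omega>) (real n) 0) \<longlonglongrightarrow> 0"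
      using AE_ballistic by eventually_elim (rule ballistic_env.trunc_var_tendsto)
    show "AE \<omega> in M. norm (trunc_var (E \<omega>) (real n) 0) \<le> var_tau (E \<omega>) 0" for n
      using AE_ballistic
    proof eventually_elim
      case (elim \<omega>)
      from ballistic_env.trunc_var_bounds[OF elim, of "real n" 0] show ?case by simp
    qed
  qed auto
  then show ?thesis by simp
qed

text \<open>The crossing variance at site k is the one at site 0 for the environment shifted k
  times, so the average over sites is a Birkhoff average.\<close>

lemma AE_var_average: "AE \<omega> in M. (\<lambda>n. (\<Sum>k<n. var_tau (E \<omega>) (int k)) / n) \<longlonglongrightarrow> sigma2 M T p"
  using birkhoff_ergodic[OF prob_space_axioms meas_T pres_T ergodic int_var_tau] AE_space
proof eventually_elim
  case (elim \<omega>)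
  then show ?case
    by (simp add: sigma2_def E_funpow var_tau_shift[OF walk_env_E])
qed

lemma AE_trunc_var_average:
  "AE \<omega> in M. \<forall>K::nat. (\<lambda>n. (\<Sum>k<n. trunc_var (E \<omega>) K (int k)) / n) \<longlonglongrightarrow> (\<integral>\<omega>. trunc_var (E \<omega>) K 0 \<partial>M)"
  unfolding AE_all_countable
proof
  fix K :: nat
  show "AE \<omega> in M. (\<lambda>n. (\<Sum>k<n. trunc_var (E \<omega>) K (int k)) / n) \<longlonglongrightarrow> (\<integral>\<omega>. trunc_var (E \<omega>) K 0 \<partial>M)"
    using birkhoff_ergodic[OF prob_space_axioms meas_T pres_T ergodic int_trunc_var[of K]] AE_space
  proof eventually_elim
    case (elim \<omega>)
    then show ?case by (simp add: E_funpow trunc_var_shift[OF walk_env_E])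
  qed
qed

lemma AE_quenched_env:
  "AE \<omega> in M. \<exists>K. quenched_env (E \<omega>) (v (E \<omega>)) mbar (sigma2 M T p) s K gap"
  using AE_ballistic AE_window AE_ladder AE_ladder_summable AE_var_average AE_trunc_var_average
proof eventually_elim
  case (elim \<omega>)
  from elim(2) obtain K where K: "0 \<le> K" "\<And>x y i j. 1 \<le> y \<Longrightarrow> y \<le> x \<Longrightarrow> i \<le> j \<Longrightarrow> real j \<le> x \<Longrightarrow> real j \<le> real i + y \<Longrightarrow>
     \<bar>mu_sum j \<omega> - mu_sum i \<omega>\<bar> \<le> K * (1 + ln x) * (x powr (1 + s / 8) * y powr s) powr (1 / (2 * (1 + s)))"
    by blast
  \<comment> \<open>First \<open>K\<close> makes the annealed truncated variance smaller than
    \<open>e\<close>; then the ergodic average at this fixed \<open>K\<close> is eventually below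
    \<open>e\<close> too.\<close>
  have lind: "\<exists>K::nat. eventually (\<lambda>n. (\<Sum>k<n. trunc_var (E \<omega>) K (int k)) / n \<le> e) sequentially" if e: "0 < e" for e
  proof -
    have "eventually (\<lambda>n. (\<integral>\<omega>. trunc_var (E \<omega>) (real n) 0 \<partial>M) < e) sequentially"
      using trunc_var_mean_tendsto e by (rule order_tendstoD)
    then obtain K :: nat where "(\<integral>\<omega>. trunc_var (E \<omega>) K 0 \<partial>M) < e" by (auto simp: eventually_sequentially)
    then have "eventually (\<lambda>n. (\<Sum>k<n. trunc_var (E \<omega>) K (int k)) / n < e) sequentially"
      using elim(6) by (intro order_tendstoD) auto
    then show ?thesis by (intro exI[of _ K]) (auto elim: eventually_mono)
  qed
  show ?case
  proof (intro exI[of _ K] quenched_env.intro quenched_env_axioms.intro elim(1))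
    fix x y :: real and i j :: nat
    assume "1 \<le> y" "y \<le> x" "i \<le> j" "real j \<le> x" "real j \<le> real i + y"
    from K(2)[OF this] show "\<bar>(\<Sum>k<j. mu_env (E \<omega>) (int k) - mbar) - (\<Sum>k<i. mu_env (E \<omega>) (int k) - mbar)\<bar>
      \<le> K * (1 + ln x) * (x powr (1 + s / 8) * y powr s) powr (1 / (2 * (1 + s)))"
      by (simp only: mu_sum_def)
  qed (use mbar_pos sigma2_pos s_pos K(1) elim lind gap_small in auto)
qed

text \<open>Both limits are read off in the same environment; the real number x is quantified inside
  because the deterministic argument treats every x.\<close>

lemma quenched_limits:
  "AE \<omega> in M. (\<forall>x::real. (\<lambda>t::nat. real t powr (- 1 / 2) *
           sum_between (\<lambda>k. mu_env (E \<omega>) k - mbar) (inverse mbar * real t)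
             (centering M T p (real t) \<omega> + sqrt (real t) * sigma_star M T p * x)) \<longlonglongrightarrow> 0) \<and>
     uniform_limit UNIV
          (\<lambda>(t::nat) (x::real). measure (quenched_law (E \<omega>) 0)
             {X \<in> space (quenched_law (E \<omega>) 0).
                (real_of_int (X t) - centering M T p (real t) \<omega>) / (sqrt (real t) * sigma_star M T p) \<le> x})
          (cdf std_normal_distribution) sequentially"
  using AE_quenched_env
proof eventually_elim
  case (elim \<omega>)
  then obtain K where "quenched_env (E \<omega>) (v (E \<omega>)) mbar (sigma2 M T p) s K gap" by blast
  then interpret q: quenched_env "E \<omega>" "v (E \<omega>)" mbar "sigma2 M T p" s K gap .
  have c: "q.centre t = centering M T p (real t) \<omega>" for t
    by (simp add: q.centre_def centering_def)
  have sg: "q.sig = sigma_star M T p" by (simp add: q.sig_def sigma_star_def)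
  show ?case
    using q.correction_negligible q.quenched_clt unfolding q.endpt_def c sg by blast
qed

end

theorem theorem5:
  fixes M :: "'a measure" and T :: "'a \<Rightarrow> 'a" and p :: "'a \<Rightarrow> real"
  assumes "random_environment M T p"
    and "condition_C' M T p"
    and "log_drift M T p < 0"
    and "growth_rate M T p 2 < 1"
    and "iid_environment M T p"
  shows
    "(AE \<omega> in M. \<forall>x::real.
        (\<lambda>t::nat. real t powr (- 1 / 2) *
           sum_between (\<lambda>k. mu_env (env M T p \<omega>) k - mu_mean M T p)
             (inverse (mu_mean M T p) * real t)
             (centering M T p (real t) \<omega> + sqrt (real t) * sigma_star M T p * x))
        \<longlonglongrightarrow> 0) \<and>
     (AE \<omega> in M.
        uniform_limit UNIV
          (\<lambda>(t::nat) (x::real). measure (quenched_law (env M T p \<omega>) 0)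
             {X \<in> space (quenched_law (env M T p \<omega>) 0).
                (real_of_int (X t) - centering M T p (real t) \<omega>)
                  / (sqrt (real t) * sigma_star M T p) \<le> x})
          (cdf std_normal_distribution)
          sequentially)"
proof -
  have "prob_space M" using assms(1) by (simp add: random_environment_def)
  then interpret iid_env M T p
    using assms by (simp add: iid_env_def iid_env_axioms_def)
  \<comment> \<open>The exponent is fixed once for the whole probability space, before any
    environment is chosen.\<close>
  obtain s where "0 < s" "integrable M (\<lambda>\<omega>. odds (E \<omega>) 0 powr (2 + 2 * s))"
    "(\<integral>\<omega>. odds (E \<omega>) 0 powr (2 + 2 * s) \<partial>M) < 1" "integrable M (\<lambda>\<omega>. E \<omega> 0 powr (- 2))"
    by (rule moment_exponent)
  then interpret moment_env M T p s by unfold_locales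
  show ?thesis
    using quenched_limits by (simp only: AE_conj_iff)
qed

end
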